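(* Let $(\mathbb{X},\mathbb{A},q,c)$ be an MDP with $\mathbb{X}=\mathbb{X}_W\times\mathbb{X}_Y$, where $\mathbb{X}_W,\mathbb{X}_Y,\mathbb{A}$ are nonempty Borel subsets of Polish spaces, the transition kernel $q$ on $\mathbb{X}=\mathbb{X}_W\times\mathbb{X}_Y$ given $\mathbb{X}\times\mathbb{A}$ is semi-uniform Feller, and the nonnegative function $c:\mathbb{X}\times\mathbb{A}\to[0,+\infty]$ is $\mathbb{M}\mathbb{K}$-inf-compact (on $\mathbb{X}_W\times\mathbb{X}_Y\times\mathbb{A}$). Let $\alpha\ge0$. Then: (i) the functions $v_{t,\alpha}$, $t=0,1,\ldots$, and $v_\alpha$ belong to $LW(\mathbb{X})$, and $v_{t,\alpha}(x)\uparrow v_\alpha(x)$ as $t\to+\infty$ for all $x\in\mathbb{X}$; (ii) $v_{t+1,\alpha}(x)=\min_{a\in\mathbb{A}}\eta^\alpha_{v_{t,\alpha}}(x,a)$, $x\in\mathbb{X}$, $t=0,1,\ldots$, where $v_{0,\alpha}(x)=0$ for all $x\in\mathbb{X}$, and the nonempty sets $A_{t,\alpha}(x):=\{a\in\mathbb{A}:v_{t+1,\alpha}(x)=\eta^\alpha_{v_{t,\alpha}}(x,a)\}$, $x\in\mathbb{X}$, $t=0,1,\ldots$, satisfy: (a) the graph $\mathrm{Gr}(A_{t,\alpha})=\{(x,a):x\in\mathbb{X},a\in A_{t,\alpha}(x)\}$ is a Borel subset of $\mathbb{X}\times\mathbb{A}$ for each $t=0,1,\ldots$, and (b) if $v_{t+1,\alpha}(x)=+\infty$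 then $A_{t,\alpha}(x)=\mathbb{A}$, and if $v_{t+1,\alpha}(x)<+\infty$ then $A_{t,\alpha}(x)$ is compact; (iii) for any $T=1,2,\ldots$ there exists a Markov optimal $T$-horizon policy $(\phi_0,\ldots,\phi_{T-1})$, and if for a $T$-horizon Markov policy $(\phi_0,\ldots,\phi_{T-1})$ the inclusions $\phi_{T-1-t}(x)\in A_{t,\alpha}(x)$, $x\in\mathbb{X}$, $t=0,\ldots,T-1$, hold, then this policy is $T$-horizon optimal; (iv) if $\alpha\in[0,1)$, then $v_\alpha(x)=\min_{a\in\mathbb{A}}\eta^\alpha_{v_\alpha}(x,a)$, $x\in\mathbb{X}$, and the nonempty sets $A_\alpha(x):=\{a\in\mathbb{A}:v_\alpha(x)=\eta^\alpha_{v_\alpha}(x,a)\}$, $x\in\mathbb{X}$, satisfy: (a) the graph $\mathrm{Gr}(A_\alpha)=\{(x,a):x\in\mathbb{X},a\in A_\alpha(x)\}$ is a Borel subset of $\mathbb{X}\times\mathbb{A}$, and (b) if $v_\alpha(x)=+\infty$ then $A_\alpha(x)=\mathbb{A}$, and if $v_\alpha(x)<+\infty$ then $A_\alpha(x)$ is compact; (v) if $\alpha\in[0,1)$, then for the infinite horizon there exists a stationary discount-optimal policy $\phi_\alpha$, and a stationary policy $\phi_\alpha$ is optimal if and only if $\phi_\alpha(x)\in A_\alpha(x)$ for all $x\in\mathbb{X}$.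
   Context: For a metric space $\mathbb{S}$, $\mathcal{B}(\mathbb{S})$ is its Borel $\sigma$-field. A stochastic kernel $\Psi$ on $\mathbb{S}$ given $\mathbb{S}'$ assigns to each $s'\in\mathbb{S}'$ a Borel probability measure $\Psi(\cdot|s')$ on $\mathbb{S}$, with $s'\mapsto\Psi(B|s')$ Borel measurable for each Borel $B$. Semi-uniform Feller: $\Psi$ on $\mathbb{S}_1\times\mathbb{S}_2$ given $\mathbb{S}_3$ is semi-uniform Feller if, whenever $s_3^{(n)}\to s_3$ in $\mathbb{S}_3$, for each bounded continuous $f$ on $\mathbb{S}_1$, $\lim_{n\to\infty}\sup_{B\in\mathcal{B}(\mathbb{S}_2)}\left|\int_{\mathbb{S}_1}f(s_1)\Psi(ds_1,B|s_3^{(n)})-\int_{\mathbb{S}_1}f(s_1)\Psi(ds_1,B|s_3)\right|=0$, where $\Psi(A,B|s_3):=\Psi(A\times B|s_3)$. For $q$: $\mathbb{S}_1=\mathbb{X}_W$, $\mathbb{S}_2=\mathbb{X}_Y$, $\mathbb{S}_3=\mathbb{X}\times\mathbb{A}$. Inf-compactness: an $\overline{\mathbb{R}}$-valued function $f$ is inf-compact on $U$ if all level sets $\{y\in U:f(y)\le\lambda\}$, $\lambda\in\mathbb{R}$, are compact. A function $u:\mathbb{S}_1\times\mathbb{S}_2\to\overline{\mathbb{R}}$ is $\mathbb{K}$-inf-compact if it is inf-compact on $K\times\mathbb{S}_2$ for each nonempty compact $K\subset\mathbb{S}_1$. A Borel-measurable function $u:\mathbb{S}_1\times\mathbb{S}_2\times\mathbb{S}_3\to\overline{\mathbb{R}}$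 is $\mathbb{M}\mathbb{K}$-inf-compact if for each $s_2\in\mathbb{S}_2$ the function $(s_1,s_3)\mapsto u(s_1,s_2,s_3)$ is $\mathbb{K}$-inf-compact on $\mathbb{S}_1\times\mathbb{S}_3$. For $c$: $\mathbb{S}_1=\mathbb{X}_W$, $\mathbb{S}_2=\mathbb{X}_Y$, $\mathbb{S}_3=\mathbb{A}$. MDP: $(\mathbb{X},\mathbb{A},q,c)$ has state space $\mathbb{X}$, action space $\mathbb{A}$, transition kernel $q$ on $\mathbb{X}$ given $\mathbb{X}\times\mathbb{A}$, and one-step cost $c$. A policy $\pi=\{\pi_t\}_{t\ge0}$ consists of stochastic kernels $\pi_t$ on $\mathbb{A}$ given $\mathbb{H}_t:=(\mathbb{X}\times\mathbb{A})^t\times\mathbb{X}$; $\Pi$ is the set of all policies. $\mathbb{E}_x^\pi$ is the expectation for the process $(x_0,a_0,x_1,a_1,\ldots)$ with $x_0=x$, generated by $\pi$ and $q$. A policy is nonrandomized if each $\pi_t(\cdot|h_t)$ is concentrated at one point; a nonrandomized policy is Markov if decisions depend only on the current state and time (so it is given by Borel maps $\phi_t:\mathbb{X}\to\mathbb{A}$), and stationary if they depend only on the current state (a single Borel map $\phi:\mathbb{X}\to\mathbb{A}$). Costs: for $T=0,1,\ldots$, $v^\pi_{T,\alpha}(x):=\mathbb{E}^\pi_x\sum_{t=0}^{T-1}\alpha^tc(x_t,a_t)$, $v^\pi_{0,\alpha}:=0$; $v^\pi_\alpha(x)$ is the same with $T=\infty$; $v_{T,\alpha}(x):=\inf_{\pi\in\Pi}v^\pi_{T,\alpha}(x)$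 and $v_\alpha(x):=\inf_{\pi\in\Pi}v^\pi_\alpha(x)$. A policy $\pi$ is $T$-horizon (discount-)optimal if $v^\pi_{T,\alpha}(x)=v_{T,\alpha}(x)$ for all $x$, and discount-optimal if $v^\pi_\alpha(x)=v_\alpha(x)$ for all $x$. $LW(\mathbb{X})$ is the class of nonnegative Borel-measurable functions $\varphi:\mathbb{X}\to[0,+\infty]$ such that $w\mapsto\varphi(w,y)$ is lower semi-continuous on $\mathbb{X}_W$ for each $y\in\mathbb{X}_Y$. For $u\in LW(\mathbb{X})$, $\eta^\alpha_u(x,a):=c(x,a)+\alpha\int_{\mathbb{X}}u(\tilde x)q(d\tilde x|x,a)$, $(x,a)\in\mathbb{X}\times\mathbb{A}$. Conventions: $0^0=1$, $0\cdot\infty=0$. *)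

theory Defs
  imports "HOL-Probability.Probability"
begin

text \<open>
  Spaces are subsets of topological types. Stochastic kernels on \<open>S\<close> given \<open>S'\<close> are the measurable
  maps \<open>borel_on S' \<rightarrow>\<^sub>M prob_algebra (borel_on S)\<close>; their values outside \<open>S'\<close> are irrelevant.
\<close>

abbreviation borel_on :: "'a::topological_space set \<Rightarrow> 'a measure" where
  "borel_on S \<equiv> restrict_space borel S"

section \<open>Semi-uniform Feller kernels\<close>

definition slice_measure ::
    "'s1::topological_space set \<Rightarrow> ('s1 \<times> 's2) measure \<Rightarrow> 's2 set \<Rightarrow> 's1 measure" where
  "slice_measure S1 \<mu> B = measure_of S1 (sets (borel_on S1)) (\<lambda>A. emeasure \<mu> (A \<times> B))"

text \<open>The supremum is a supremum of reals; it is over a bounded set because \<open>f\<close> is bounded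
  on \<open>S1\<close> and \<open>\<Psi> s\<close> is a probability measure.\<close>

definition semi_uniform_Feller ::
    "'s1::topological_space set \<Rightarrow> 's2::topological_space set \<Rightarrow> 's3::topological_space set \<Rightarrow>
      ('s3 \<Rightarrow> ('s1 \<times> 's2) measure) \<Rightarrow> bool" where
  "semi_uniform_Feller S1 S2 S3 \<Psi> \<longleftrightarrow>
    \<Psi> \<in> borel_on S3 \<rightarrow>\<^sub>M prob_algebra (borel_on (S1 \<times> S2)) \<and>
    (\<forall>\<sigma> s. (\<forall>n. \<sigma> n \<in> S3) \<longrightarrow> s \<in> S3 \<longrightarrow> \<sigma> \<longlonglongrightarrow> s \<longrightarrow>
      (\<forall>f :: 's1 \<Rightarrow> real. continuous_on S1 f \<longrightarrow> bounded (f ` S1) \<longrightarrow>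
        (\<lambda>n. SUP B\<in>sets (borel_on S2).
               \<bar>(\<integral>s1. f s1 \<partial>slice_measure S1 (\<Psi> (\<sigma> n)) B) - (\<integral>s1. f s1 \<partial>slice_measure S1 (\<Psi> s) B)\<bar>)
          \<longlonglongrightarrow> 0))"

section \<open>Inf-compactness and lower semicontinuity\<close>

definition inf_compact_on :: "'s::topological_space set \<Rightarrow> ('s \<Rightarrow> ereal) \<Rightarrow> bool" where
  "inf_compact_on U f \<longleftrightarrow> (\<forall>l::real. compact {y \<in> U. f y \<le> ereal l})"

definition K_inf_compact ::
    "'s1::topological_space set \<Rightarrow> 's2::topological_space set \<Rightarrow> ('s1 \<times> 's2 \<Rightarrow> ereal) \<Rightarrow> bool" where
  "K_inf_compact S1 S2 u \<longleftrightarrow>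
    (\<forall>K. K \<subseteq> S1 \<longrightarrow> K \<noteq> {} \<longrightarrow> compact K \<longrightarrow> inf_compact_on (K \<times> S2) u)"

definition MK_inf_compact ::
    "'s1::topological_space set \<Rightarrow> 's2::topological_space set \<Rightarrow> 's3::topological_space set \<Rightarrow>
      ('s1 \<times> 's2 \<times> 's3 \<Rightarrow> ereal) \<Rightarrow> bool" where
  "MK_inf_compact S1 S2 S3 u \<longleftrightarrow>
    u \<in> borel_on (S1 \<times> S2 \<times> S3) \<rightarrow>\<^sub>M borel \<and>
    (\<forall>s2\<in>S2. K_inf_compact S1 S3 (\<lambda>(s1, s3). u (s1, s2, s3)))"

text \<open>At an isolated point of \<open>S\<close> the lower limit below is \<open>\<top>\<close> and the condition is void.\<close>

definition lsc_on :: "'s::topological_space set \<Rightarrow> ('s \<Rightarrow> ennreal) \<Rightarrow> bool" where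
  "lsc_on S f \<longleftrightarrow> (\<forall>s\<in>S. f s \<le> Liminf (at s within S) f)"

definition LW ::
    "'w::topological_space set \<Rightarrow> 'y::topological_space set \<Rightarrow> ('w \<times> 'y \<Rightarrow> ennreal) set" where
  "LW XW XY = {\<phi>. \<phi> \<in> borel_on (XW \<times> XY) \<rightarrow>\<^sub>M borel \<and> (\<forall>y\<in>XY. lsc_on XW (\<lambda>w. \<phi> (w, y)))}"

section \<open>Policies and the controlled process\<close>

text \<open>The history space \<open>(X \<times> A)\<^sup>t \<times> X\<close>: the pair \<open>(h, y)\<close> consists of the past state-action pairs
  \<open>h 0, \<dots>, h (t - 1)\<close> and the current state \<open>y\<close>.\<close>

definition history ::
    "'x::topological_space set \<Rightarrow> 'a::topological_space set \<Rightarrow> nat \<Rightarrow> ((nat \<Rightarrow> 'x \<times> 'a) \<times> 'x) measure" where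
  "history X A t = PiM {0..<t} (\<lambda>_. borel_on (X \<times> A)) \<Otimes>\<^sub>M borel_on X"

type_synonym ('x, 'a) policy = "nat \<Rightarrow> (nat \<Rightarrow> 'x \<times> 'a) \<times> 'x \<Rightarrow> 'a measure"

definition policies ::
    "'x::topological_space set \<Rightarrow> 'a::topological_space set \<Rightarrow> ('x, 'a) policy set" where
  "policies X A = {\<pi>. \<forall>t. \<pi> t \<in> history X A t \<rightarrow>\<^sub>M prob_algebra (borel_on A)}"

text \<open>Conditional law of the pair of the state and the action at time \<open>t\<close> given the earlier pairs,
  for the initial state \<open>x\<close>.\<close>

definition step_kernel ::
    "'x::topological_space set \<Rightarrow> 'a::topological_space set \<Rightarrow> ('x \<times> 'a \<Rightarrow> 'x measure) \<Rightarrow>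
      ('x, 'a) policy \<Rightarrow> 'x \<Rightarrow> nat \<Rightarrow> (nat \<Rightarrow> 'x \<times> 'a) \<Rightarrow> ('x \<times> 'a) measure" where
  "step_kernel X A q \<pi> x t h =
    (case t of 0 \<Rightarrow> return (borel_on X) x | Suc s \<Rightarrow> q (h s)) \<bind>
      (\<lambda>y. \<pi> t (h, y) \<bind> (\<lambda>a. return (borel_on (X \<times> A)) (y, a)))"

text \<open>The law of \<open>(x\<^sub>0, a\<^sub>0), (x\<^sub>1, a\<^sub>1), \<dots>\<close>, i.e. the measure that the Ionescu-Tulcea theorem
  associates with the step kernels. The constants belong to the locale \<open>Ionescu_Tulcea\<close>, whose
  assumptions hold when \<open>q\<close> is a stochastic kernel, \<open>\<pi>\<close> is a policy and \<open>x \<in> X\<close>.\<close>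

definition process_law ::
    "'x::topological_space set \<Rightarrow> 'a::topological_space set \<Rightarrow> ('x \<times> 'a \<Rightarrow> 'x measure) \<Rightarrow>
      ('x, 'a) policy \<Rightarrow> 'x \<Rightarrow> (nat \<Rightarrow> 'x \<times> 'a) measure" where
  "process_law X A q \<pi> x =
    projective_family.lim UNIV
      (Ionescu_Tulcea.CI (step_kernel X A q \<pi> x) (\<lambda>_. borel_on (X \<times> A)))
      (\<lambda>_. borel_on (X \<times> A))"

section \<open>Costs, values and optimality\<close>

definition horizon_cost ::
    "'x::topological_space set \<Rightarrow> 'a::topological_space set \<Rightarrow> ('x \<times> 'a \<Rightarrow> 'x measure) \<Rightarrow>
      ('x \<times> 'a \<Rightarrow> ennreal) \<Rightarrow> real \<Rightarrow> nat \<Rightarrow> ('x, 'a) policy \<Rightarrow> 'x \<Rightarrow> ennreal" where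
  "horizon_cost X A q c \<alpha> T \<pi> x =
    (\<integral>\<^sup>+\<omega>. (\<Sum>t<T. ennreal \<alpha> ^ t * c (\<omega> t)) \<partial>process_law X A q \<pi> x)"

definition discounted_cost ::
    "'x::topological_space set \<Rightarrow> 'a::topological_space set \<Rightarrow> ('x \<times> 'a \<Rightarrow> 'x measure) \<Rightarrow>
      ('x \<times> 'a \<Rightarrow> ennreal) \<Rightarrow> real \<Rightarrow> ('x, 'a) policy \<Rightarrow> 'x \<Rightarrow> ennreal" where
  "discounted_cost X A q c \<alpha> \<pi> x =
    (\<integral>\<^sup>+\<omega>. (\<Sum>t. ennreal \<alpha> ^ t * c (\<omega> t)) \<partial>process_law X A q \<pi> x)"

definition horizon_value ::
    "'x::topological_space set \<Rightarrow> 'a::topological_space set \<Rightarrow> ('x \<times> 'a \<Rightarrow> 'x measure) \<Rightarrow>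
      ('x \<times> 'a \<Rightarrow> ennreal) \<Rightarrow> real \<Rightarrow> nat \<Rightarrow> 'x \<Rightarrow> ennreal" where
  "horizon_value X A q c \<alpha> T x = (INF \<pi>\<in>policies X A. horizon_cost X A q c \<alpha> T \<pi> x)"

definition discounted_value ::
    "'x::topological_space set \<Rightarrow> 'a::topological_space set \<Rightarrow> ('x \<times> 'a \<Rightarrow> 'x measure) \<Rightarrow>
      ('x \<times> 'a \<Rightarrow> ennreal) \<Rightarrow> real \<Rightarrow> 'x \<Rightarrow> ennreal" where
  "discounted_value X A q c \<alpha> x = (INF \<pi>\<in>policies X A. discounted_cost X A q c \<alpha> \<pi> x)"

definition horizon_optimal ::
    "'x::topological_space set \<Rightarrow> 'a::topological_space set \<Rightarrow> ('x \<times> 'a \<Rightarrow> 'x measure) \<Rightarrow>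
      ('x \<times> 'a \<Rightarrow> ennreal) \<Rightarrow> real \<Rightarrow> nat \<Rightarrow> ('x, 'a) policy \<Rightarrow> bool" where
  "horizon_optimal X A q c \<alpha> T \<pi> \<longleftrightarrow>
    \<pi> \<in> policies X A \<and> (\<forall>x\<in>X. horizon_cost X A q c \<alpha> T \<pi> x = horizon_value X A q c \<alpha> T x)"

definition discount_optimal ::
    "'x::topological_space set \<Rightarrow> 'a::topological_space set \<Rightarrow> ('x \<times> 'a \<Rightarrow> 'x measure) \<Rightarrow>
      ('x \<times> 'a \<Rightarrow> ennreal) \<Rightarrow> real \<Rightarrow> ('x, 'a) policy \<Rightarrow> bool" where
  "discount_optimal X A q c \<alpha> \<pi> \<longleftrightarrow>
    \<pi> \<in> policies X A \<and> (\<forall>x\<in>X. discounted_cost X A q c \<alpha> \<pi> x = discounted_value X A q c \<alpha> x)"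

text \<open>The nonrandomized Markov policy with decision rules \<open>\<phi> 0, \<phi> 1, \<dots>\<close>. A \<open>T\<close>-horizon Markov policy
  \<open>(\<phi>\<^sub>0, \<dots>, \<phi>\<^sub>T\<^sub>-\<^sub>1)\<close> is represented by any infinite sequence of Borel decision rules extending it;
  the \<open>T\<close>-horizon cost does not depend on the decisions from time \<open>T\<close> on.\<close>

definition markov_policy ::
    "'a::topological_space set \<Rightarrow> (nat \<Rightarrow> 'x \<Rightarrow> 'a) \<Rightarrow> ('x, 'a) policy" where
  "markov_policy A \<phi> t = (\<lambda>(h, y). return (borel_on A) (\<phi> t y))"

definition stationary_policy ::
    "'a::topological_space set \<Rightarrow> ('x \<Rightarrow> 'a) \<Rightarrow> ('x, 'a) policy" where
  "stationary_policy A \<phi> = markov_policy A (\<lambda>_. \<phi>)"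

section \<open>Optimality equations\<close>

definition eta ::
    "('x \<times> 'a \<Rightarrow> 'x measure) \<Rightarrow> ('x \<times> 'a \<Rightarrow> ennreal) \<Rightarrow> real \<Rightarrow> ('x \<Rightarrow> ennreal) \<Rightarrow> 'x \<Rightarrow> 'a \<Rightarrow> ennreal" where
  "eta q c \<alpha> u x a = c (x, a) + ennreal \<alpha> * (\<integral>\<^sup>+z. u z \<partial>q (x, a))"

text \<open>\<open>m = min\<^bsub>a\<in>S\<^esub> f a\<close>, including that the minimum is attained.\<close>

definition is_minimum :: "'b::order \<Rightarrow> ('a \<Rightarrow> 'b) \<Rightarrow> 'a set \<Rightarrow> bool" where
  "is_minimum m f S \<longleftrightarrow> (\<exists>a. is_arg_min f (\<lambda>a. a \<in> S) a \<and> m = f a)"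

definition graph_on :: "'x set \<Rightarrow> ('x \<Rightarrow> 'a set) \<Rightarrow> ('x \<times> 'a) set" where
  "graph_on X F = {(x, a). x \<in> X \<and> a \<in> F x}"

end

(*
  Value iteration V 0 = 0, V (t + 1) x = min_a eta (V t) x a is carried out inside LW.

  Measurability.  A Borel set with compact sections has a Borel projection and a Borel uniformization;
  this gives measurable minima and measurable minimizers.  It rests on Novikov's separation theorem for
  sequences of analytic sets: a Borel set with open sections is a countable union of Borel-times-open
  rectangles, and the same theorem covers compact sections by Borel choices of finite nets.

  Semicontinuity.  Applied to the superlevel sets of a function in LW, the rectangle decomposition writes
  it as a supremum of products f(w) 1_Z(y) with f continuous.  A maximum of finitely many such products is
  a finite sum of products, for which the semi-uniform Feller property gives convergence of the integrals,
  so u -> int u dq is lower semicontinuous.  Hence eta u is inf-compact, and minimization preserves LW and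
  commutes with the increasing limit t -> infinity.

  Optimality.  Telescoping E[alpha^t u_t(x_t)] along the controlled process shows that V T bounds the cost
  of every history-dependent policy from below, with equality for greedy Markov policies.  The limit of
  V T is a fixed point of the optimality operator, so its greedy stationary policies attain it; conversely
  the cost of a stationary policy satisfies its own evaluation equation.
*)

theory Submission
  imports Defs
begin

section \<open>Analytic sets\<close>

text \<open>The cost is jointly Borel, but semicontinuous only for each fixed \<open>y\<close>.
  Measurable minimisers therefore cannot come from semicontinuity in the state, and the projection
  of a Borel subset of \<open>X \<times> A\<close> is in general only analytic. What is available is
  compactness in the action of the finite sublevel sets of \<open>eta\<close>; the descriptive set
  theory exists to exploit it. It works in the whole Polish types and reaches the subspaces by
  intersection.

  Semicontinuity in \<open>w\<close> must likewise be combined with bare measurability in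
  \<open>y\<close>. Rectangles with a Borel side in \<open>y\<close> and an open side in
  \<open>w\<close> separate the two demands, and products of a continuous function of
  \<open>w\<close> with an indicator in \<open>y\<close> are what the semi-uniform Feller condition
  speaks about.

  Costs may be infinite, so there is no contraction argument. The iteration starts from 0, the least
  function; monotone convergence does the work of contraction, and nonnegativity allows remainders
  of telescoped sums to be dropped.\<close>

text \<open>Domains are closed subsets of the Baire space rather than the whole of it: this covers
  the empty set, and equations between coded points cut out domains of the same kind.\<close>

definition analytic :: "'a::topological_space set \<Rightarrow> bool" where
  "analytic S \<longleftrightarrow> (\<exists>(C :: (nat \<Rightarrow> nat) set) f. closed C \<and> continuous_on C f \<and> S = f ` C)"

lemma analyticI: "closed C \<Longrightarrow> continuous_on C f \<Longrightarrow> S = f ` C \<Longrightarrow> analytic S"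
  for C :: "(nat \<Rightarrow> nat) set"
  unfolding analytic_def by blast

text \<open>A basic box constrains finitely many coordinates of a product of discrete spaces, so a
  long enough prefix decides membership. Continuity and closedness for coding maps are then checked
  on prefixes.\<close>

lemma open_baire_iff:
  "open (S :: (nat \<Rightarrow> nat) set) \<longleftrightarrow> (\<forall>z\<in>S. \<exists>k. \<forall>z'. (\<forall>i<k. z' i = z i) \<longrightarrow> z' \<in> S)"
proof safe
  fix z assume S: "open S" and z: "z \<in> S"
  from S have "openin (product_topology (\<lambda>i. euclidean) UNIV) S"
    by (simp add: open_fun_def)
  from product_topology_open_contains_basis[OF this z] obtain X where
    X: "z \<in> Pi\<^sub>E UNIV X" "finite {i. X i \<noteq> (UNIV :: nat set)}" "Pi\<^sub>E UNIV X \<subseteq> S"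
    by auto
  obtain k where k: "\<And>i. X i \<noteq> UNIV \<Longrightarrow> i < k"
    using finite_nat_bounded[OF X(2)] by auto
  have "z' \<in> S" if "\<forall>i<k. z' i = z i" for z'
  proof -
    have "z' i \<in> X i" for i
      using X(1) k[of i] that by (cases "X i = UNIV") (auto simp: PiE_iff)
    then show ?thesis using X(3) by (auto simp: PiE_iff)
  qed
  then show "\<exists>k. \<forall>z'. (\<forall>i<k. z' i = z i) \<longrightarrow> z' \<in> S" by blast
next
  assume *: "\<forall>z\<in>S. \<exists>k. \<forall>z'. (\<forall>i<k. z' i = z i) \<longrightarrow> z' \<in> S"
  have cyl: "open {z'. \<forall>i<k. z' i = z i}" for z :: "nat \<Rightarrow> nat" and k
  proof -
    have "open ((\<lambda>z'. z' i) -` {z i})" for i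
      by (rule open_vimage) (auto intro: discrete_topology_class.open_discrete)
    then have "open (\<Inter>i\<in>{..<k}. (\<lambda>z'. z' i) -` {z i})"
      by (intro open_INT) auto
    also have "(\<Inter>i\<in>{..<k}. (\<lambda>z'. z' i) -` {z i}) = {z'. \<forall>i<k. z' i = z i}"
      by auto
    finally show ?thesis .
  qed
  show "open S"
  proof (rule open_subopen[THEN iffD2], rule ballI)
    fix z assume "z \<in> S"
    with * obtain k where "\<And>z'. (\<forall>i<k. z' i = z i) \<Longrightarrow> z' \<in> S" by blast
    then show "\<exists>T. open T \<and> z \<in> T \<and> T \<subseteq> S"
      by (intro exI[of _ "{z'. \<forall>i<k. z' i = z i}"] conjI cyl) auto
  qed
qed

lemma continuous_on_baire:
  fixes C :: "(nat \<Rightarrow> nat) set"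
  assumes "continuous_on C f" "z \<in> C" "open U" "f z \<in> U"
  shows "\<exists>k. \<forall>z'\<in>C. (\<forall>i<k. z' i = z i) \<longrightarrow> f z' \<in> U"
proof -
  obtain W where W: "open W" "z \<in> W" "\<And>z'. z' \<in> C \<Longrightarrow> z' \<in> W \<Longrightarrow> f z' \<in> U"
    using assms unfolding continuous_on_topological by metis
  then obtain k where "\<And>z'. (\<forall>i<k. z' i = z i) \<Longrightarrow> z' \<in> W"
    unfolding open_baire_iff by blast
  with W(3) show ?thesis by blast
qed

lemma continuous_on_baireI:
  fixes C :: "(nat \<Rightarrow> nat) set"
  assumes "\<And>z U. z \<in> C \<Longrightarrow> open U \<Longrightarrow> f z \<in> U \<Longrightarrow>
    \<exists>k. \<forall>z'\<in>C. (\<forall>i<k. z' i = z i) \<longrightarrow> f z' \<in> U"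
  shows "continuous_on C f"
  unfolding continuous_on_topological
proof (intro ballI allI impI)
  fix z U assume "z \<in> C" "open U" "f z \<in> U"
  from assms[OF this] obtain k where k: "\<forall>z'\<in>C. (\<forall>i<k. z' i = z i) \<longrightarrow> f z' \<in> U" ..
  have "open {z'. \<forall>i<k. z' i = z i}"
    unfolding open_baire_iff by (auto intro!: exI[of _ k])
  with k show "\<exists>A. open A \<and> z \<in> A \<and> (\<forall>y\<in>C. y \<in> A \<longrightarrow> f y \<in> U)"
    by (intro exI[of _ "{z'. \<forall>i<k. z' i = z i}"]) auto
qed

lemma closed_baireD:
  assumes "closed (C :: (nat \<Rightarrow> nat) set)" "\<And>k. \<exists>z'\<in>C. \<forall>i<k. z' i = z i"
  shows "z \<in> C"
proof (rule ccontr)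
  assume "z \<notin> C"
  with assms(1) obtain k where "\<forall>z'. (\<forall>i<k. z' i = z i) \<longrightarrow> z' \<in> - C"
    unfolding closed_def open_baire_iff by blast
  with assms(2)[of k] show False by auto
qed

lemma closed_vimage_baire:
  fixes C :: "(nat \<Rightarrow> nat) set"
  assumes "closed C"
  shows "closed {z. (\<lambda>i. z (h i)) \<in> C}"
proof -
  have "continuous_on UNIV (\<lambda>(z :: 'a \<Rightarrow> nat) i. z (h i))"
    by (rule continuous_on_coordinatewise_then_product) (rule continuous_on_product_coordinates)
  from closed_vimage[OF assms this] show ?thesis by (simp add: vimage_def)
qed

lemma continuous_on_baire_subsequence:
  fixes C :: "(nat \<Rightarrow> nat) set"
  assumes "continuous_on C f" "\<And>z. z \<in> D \<Longrightarrow> (\<lambda>i. z (h i)) \<in> C"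
  shows "continuous_on D (\<lambda>z. f (\<lambda>i. z (h i)))"
proof (rule continuous_on_compose2[OF assms(1)])
  show "continuous_on D (\<lambda>z i. z (h i))"
    by (rule continuous_on_subset[of UNIV])
       (auto intro!: continuous_on_coordinatewise_then_product continuous_on_product_coordinates)
qed (use assms(2) in auto)

section \<open>Closure properties of analytic sets\<close>

lemma analytic_image:
  assumes "analytic S" "continuous_on S g"
  shows "analytic (g ` S)"
proof -
  from assms(1) obtain C f where *: "closed (C :: (nat \<Rightarrow> nat) set)" "continuous_on C f" "S = f ` C"
    unfolding analytic_def by metis
  then have "continuous_on C (g \<circ> f)" using assms(2) by (intro continuous_on_compose) auto
  with * show ?thesis by (intro analyticI[of C "g \<circ> f"]) (auto simp: image_comp)
qed

text \<open>The first digit of a code names the set, the tail is a code for a point of it.\<close>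

lemma analytic_UN:
  assumes "\<And>n::nat. analytic (S n)"
  shows "analytic (\<Union>n. S n)"
proof -
  from assms obtain C f where *: "\<And>n. closed (C n :: (nat \<Rightarrow> nat) set)"
      "\<And>n. continuous_on (C n) (f n)" "\<And>n. S n = f n ` C n"
    unfolding analytic_def by metis
  define D where "D = {z :: nat \<Rightarrow> nat. (\<lambda>i. z (Suc i)) \<in> C (z 0)}"
  define g where "g z = f (z 0) (\<lambda>i. z (Suc i))" for z
  \<comment> \<open>For every \<open>n\<close> either the tail lies in \<open>C n\<close> or the
    first digit differs from \<open>n\<close>; the second alternative is clopen.\<close>
  have "D = (\<Inter>n. {z. (\<lambda>i. z (Suc i)) \<in> C n} \<union> (\<lambda>z. z 0) -` (-{n}))"
    by (auto simp: D_def)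
  also have "closed \<dots>"
    using *(1) by (intro closed_INT ballI closed_Un closed_vimage_baire closed_vimage)
                  (auto simp: closed_def intro: discrete_topology_class.open_discrete)
  finally have "closed D" .
  moreover have "continuous_on D g"
  proof (rule continuous_on_baireI)
    fix z U assume z: "z \<in> D" "open U" "g z \<in> U"
    then obtain k where k: "\<And>z'. z' \<in> C (z 0) \<Longrightarrow>
        (\<forall>i<k. z' i = z (Suc i)) \<Longrightarrow> f (z 0) z' \<in> U"
      using continuous_on_baire[OF *(2)[of "z 0"], of "\<lambda>i. z (Suc i)" U]
      by (auto simp: D_def g_def)
    \<comment> \<open>One digit more than \<open>k\<close>: the first digit has to agree as well, so
      that \<open>f (z 0)\<close> stays the same map.\<close>
    show "\<exists>k. \<forall>z'\<in>D. (\<forall>i<k. z' i = z i) \<longrightarrow> g z' \<in> U"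
      by (rule exI[of _ "Suc k"]) (auto simp: g_def D_def All_less_Suc2 intro: k)
  qed
  moreover have "(\<Union>n. S n) = g ` D"
  proof safe
    fix x n assume "x \<in> S n"
    then obtain z where z: "z \<in> C n" "x = f n z" using *(3) by auto
    then show "x \<in> g ` D"
      by (intro image_eqI[of _ _ "case_nat n z"]) (auto simp: g_def D_def)
  qed (use *(3) in \<open>auto simp: g_def D_def\<close>)
  ultimately show ?thesis by (rule analyticI)
qed

text \<open>Fibre product: a single code carries codes for all the sets, spread out by
  \<open>prod_encode\<close>, and only those naming one common point are kept. Vanishing of the
  distance makes this a closed condition.\<close>

lemma analytic_INT:
  fixes S :: "nat \<Rightarrow> 'a::metric_space set"
  assumes "\<And>n. analytic (S n)"
  shows "analytic (\<Inter>n. S n)"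
proof -
  from assms obtain C f where *: "\<And>n. closed (C n :: (nat \<Rightarrow> nat) set)"
      "\<And>n. continuous_on (C n) (f n)" "\<And>n. S n = f n ` C n"
    unfolding analytic_def by metis
  define p where "p n z = (\<lambda>i. z (prod_encode (n, i)))" for n and z :: "nat \<Rightarrow> nat"
  define D where "D = (\<Inter>n. {z. p n z \<in> C n})"
  have D: "closed D"
    unfolding D_def p_def using *(1) by (intro closed_INT ballI closed_vimage_baire) auto
  have cont: "continuous_on D (\<lambda>z. f n (p n z))" for n
    unfolding p_def by (rule continuous_on_baire_subsequence[OF *(2)]) (auto simp: D_def p_def)
  define E where "E = (\<Inter>n. {z \<in> D. dist (f n (p n z)) (f 0 (p 0 z)) = 0})"
  have "closed E"
    unfolding E_def
    by (intro closed_INT ballI continuous_closed_preimage_constant continuous_on_dist cont D)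
  moreover have "continuous_on E (\<lambda>z. f 0 (p 0 z))"
    by (rule continuous_on_subset[OF cont]) (auto simp: E_def)
  moreover have "(\<Inter>n. S n) = (\<lambda>z. f 0 (p 0 z)) ` E"
  proof safe
    fix x assume "x \<in> (\<Inter>n. S n)"
    then have "\<forall>n. \<exists>z. z \<in> C n \<and> x = f n z" using *(3) by auto
    then obtain w where w: "\<And>n. w n \<in> C n" "\<And>n. x = f n (w n)" by metis
    define z where "z j = (case prod_decode j of (n, i) \<Rightarrow> w n i)" for j
    have "p n z = w n" for n by (auto simp: p_def z_def)
    with w show "x \<in> (\<lambda>z. f 0 (p 0 z)) ` E"
      by (intro image_eqI[of _ _ z]) (auto simp: E_def D_def simp flip: w(2))
  next
    fix z n assume "z \<in> E"
    then have "f n (p n z) = f 0 (p 0 z)" "p n z \<in> C n" by (auto simp: E_def D_def)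
    then show "f 0 (p 0 z) \<in> S n" using *(3) by (metis imageI)
  qed
  ultimately show ?thesis by (rule analyticI)
qed

lemma analytic_Un:
  assumes "analytic S" "analytic T"
  shows "analytic (S \<union> T)"
proof -
  have "analytic (\<Union>n::nat. if n = 0 then S else T)" using assms by (intro analytic_UN) auto
  also have "(\<Union>n::nat. if n = 0 then S else T) = S \<union> T"
    by (rule antisym) (auto split: if_splits intro: UN_I[of 0] UN_I[of 1])
  finally show ?thesis .
qed

lemma analytic_Int: "analytic S \<Longrightarrow> analytic T \<Longrightarrow> analytic (S \<inter> T)"
  for S :: "'a::metric_space set"
proof -
  assume "analytic S" "analytic T"
  then have "analytic (\<Inter>n::nat. if n = 0 then S else T)" by (intro analytic_INT) auto
  also have "(\<Inter>n::nat. if n = 0 then S else T) = S \<inter> T" by (auto split: if_splits)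
  finally show ?thesis .
qed

text \<open>Even digits code the first component and odd digits the second.\<close>

lemma analytic_Times:
  assumes "analytic S" "analytic T"
  shows "analytic (S \<times> T)"
proof -
  from assms obtain C f D g where *: "closed (C :: (nat \<Rightarrow> nat) set)" "continuous_on C f" "S = f ` C"
    "closed (D :: (nat \<Rightarrow> nat) set)" "continuous_on D g" "T = g ` D"
    unfolding analytic_def by metis
  define E where "E = {z. (\<lambda>i. z (2 * i)) \<in> C} \<inter> {z. (\<lambda>i. z (2 * i + 1)) \<in> D}"
  define h where "h z = (f (\<lambda>i. z (2 * i)), g (\<lambda>i. z (2 * i + 1)))" for z
  have "closed E"
    unfolding E_def using * by (intro closed_Int closed_vimage_baire)
  moreover have "continuous_on E h"
    unfolding h_def
    by (intro continuous_on_Pair continuous_on_baire_subsequence[OF *(2)]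
          continuous_on_baire_subsequence[OF *(5)]) (auto simp: E_def)
  moreover have "S \<times> T = h ` E"
  proof safe
    fix x y assume "x \<in> S" "y \<in> T"
    then obtain u v where "u \<in> C" "x = f u" "v \<in> D" "y = g v" using * by auto
    then show "(x, y) \<in> h ` E"
      by (intro image_eqI[of _ _ "\<lambda>j. if even j then u (j div 2) else v (j div 2)"])
         (auto simp: h_def E_def)
  qed (use * in \<open>auto simp: h_def E_def\<close>)
  ultimately show ?thesis by (rule analyticI)
qed

section \<open>Borel sets of Polish spaces are analytic\<close>

lemma dense_sequence:
  obtains d :: "nat \<Rightarrow> 'a::{metric_space, second_countable_topology}"
  where "\<And>x e. e > 0 \<Longrightarrow> \<exists>n. dist (d n) x < e"
proof -
  obtain D :: "'a set" where D: "countable D" "\<And>X. open X \<Longrightarrow> X \<noteq> {} \<Longrightarrow> \<exists>d\<in>D. d \<in> X"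
    using countable_dense_setE by metis
  from D(2)[of UNIV] have "D \<noteq> {}" by auto
  show thesis
  proof (rule that[of "from_nat_into D"])
    fix x :: 'a and e :: real assume "e > 0"
    then obtain y where "y \<in> D" "y \<in> ball x e"
      using D(2)[of "ball x e"] by auto
    then show "\<exists>n. dist (from_nat_into D n) x < e"
      using from_nat_into_surj[OF D(1)] by (metis dist_commute mem_ball)
  qed
qed

text \<open>The geometric tail from \<open>n\<close> on sums to \<open>2 * (1/2) ^ n\<close>. The
  rate does not depend on the sequence, which makes the limit a continuous function of the
  code.\<close>

lemma fast_cauchy_limit:
  fixes x :: "nat \<Rightarrow> 'a::complete_space"
  assumes "\<And>n. dist (x n) (x (Suc n)) \<le> (1/2) ^ n"
  shows "x \<longlonglongrightarrow> lim x" and "dist (x n) (lim x) \<le> 2 * (1/2) ^ n"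
proof -
  have *: "dist (x n) (x (n + m)) \<le> 2 * (1/2) ^ n - 2 * (1/2) ^ (n + m)" for n m
  proof (induction m)
    case (Suc m)
    have "dist (x n) (x (n + Suc m)) \<le> dist (x n) (x (n + m)) + dist (x (n + m)) (x (Suc (n + m)))"
      using dist_triangle by auto
    with Suc assms[of "n + m"] show ?case by simp
  qed simp
  have le: "dist (x n) (x m) \<le> 2 * (1/2) ^ n" if "n \<le> m" for n m
    using *[of n "m - n"] that by (auto intro: order_trans)
  have "Cauchy x"
  proof (rule metric_CauchyI)
    fix e :: real assume "e > 0"
    obtain N where N: "(1/2::real) ^ N < e / 4"
      using real_arch_pow_inv[of "e/4" "1/2"] \<open>e > 0\<close> by auto
    have "dist (x m) (x n) < e" if "m \<ge> N" "n \<ge> N" for m n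
    proof -
      have "dist (x m) (x n) \<le> dist (x N) (x m) + dist (x N) (x n)"
        using dist_triangle3 by auto
      also have "\<dots> < e" using le[OF that(1)] le[OF that(2)] N by simp
      finally show ?thesis .
    qed
    then show "\<exists>M. \<forall>m\<ge>M. \<forall>n\<ge>M. dist (x m) (x n) < e" by blast
  qed
  then show lim: "x \<longlonglongrightarrow> lim x"
    using Cauchy_convergent_iff convergent_LIMSEQ_iff by blast
  show "dist (x n) (lim x) \<le> 2 * (1/2) ^ n"
    by (rule Lim_bounded[OF tendsto_dist[OF tendsto_const lim]]) (use le in auto)
qed

text \<open>A code is a sequence of indices into a dense sequence whose successive terms come within
  \<open>(1/2) ^ n\<close>; it names the limit. Completeness gives the limit, density makes every
  point a limit, and a closed set has a closed set of codes.\<close>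

lemma closed_imp_analytic:
  fixes F :: "'a::{complete_space, second_countable_topology} set"
  assumes "closed F"
  shows "analytic F"
proof -
  obtain d :: "nat \<Rightarrow> 'a" where d: "\<And>x e. e > 0 \<Longrightarrow> \<exists>n. dist (d n) x < e"
    using dense_sequence by blast
  define C where "C = {z :: nat \<Rightarrow> nat. \<forall>n. dist (d (z n)) (d (z (Suc n))) \<le> (1/2) ^ n}"
  define f where "f z = lim (\<lambda>n. d (z n))" for z :: "nat \<Rightarrow> nat"
  have f: "(\<lambda>n. d (z n)) \<longlonglongrightarrow> f z" "dist (d (z n)) (f z) \<le> 2 * (1/2) ^ n" if "z \<in> C" for z n
    using that fast_cauchy_limit[of "\<lambda>n. d (z n)"] by (auto simp: C_def f_def)
  have C: "closed C"
    unfolding closed_def open_baire_iff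
  proof (intro ballI)
    fix z assume "z \<in> - C"
    then obtain n where "\<not> dist (d (z n)) (d (z (Suc n))) \<le> (1/2) ^ n" by (auto simp: C_def)
    \<comment> \<open>The violated inequality involves only the digits \<open>n\<close> and
      \<open>n + 1\<close>.\<close>
    then show "\<exists>k. \<forall>z'. (\<forall>i<k. z' i = z i) \<longrightarrow> z' \<in> - C"
      by (intro exI[of _ "n + 2"]) (auto simp: C_def intro!: exI[of _ n])
  qed
  have cont: "continuous_on C f"
  proof (rule continuous_on_baireI)
    fix z U assume z: "z \<in> C" "open U" "f z \<in> U"
    then obtain e where e: "e > 0" "\<And>y. dist y (f z) < e \<Longrightarrow> y \<in> U"
      by (auto simp: open_dist)
    obtain n where n: "(1/2::real) ^ n < e / 4"
      using real_arch_pow_inv[of "e/4" "1/2"] \<open>e > 0\<close> by auto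
    have "f z' \<in> U" if "z' \<in> C" "\<forall>i<Suc n. z' i = z i" for z'
    proof (rule e(2))
      have "dist (f z') (f z) \<le> dist (d (z n)) (f z') + dist (d (z n)) (f z)"
        by (rule dist_triangle3)
      also have "\<dots> < e" using f(2)[OF that(1), of n] f(2)[OF z(1), of n] that(2) n by simp
      finally show "dist (f z') (f z) < e" .
    qed
    then show "\<exists>k. \<forall>z'\<in>C. (\<forall>i<k. z' i = z i) \<longrightarrow> f z' \<in> U" by blast
  qed
  have surj: "\<exists>z\<in>C. f z = x" for x
  proof -
    \<comment> \<open>The margin pays for two consecutive errors:
      \<open>(1/2) ^ (n + 2) + (1/2) ^ (n + 3) \<le> (1/2) ^ n\<close>, so the chosen indices form a
      code.\<close>
    obtain z where z: "\<And>n. dist (d (z n)) x < (1/2) ^ (n + 2)"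
      using d[of "(1/2) ^ (n + 2)" x for n] by (metis zero_less_power half_gt_zero_iff zero_less_one)
    have "z \<in> C"
      unfolding C_def
    proof safe
      fix n
      have "dist (d (z n)) (d (z (Suc n))) \<le> dist (d (z n)) x + dist (d (z (Suc n))) x"
        by (rule dist_triangle2)
      also have "\<dots> \<le> (1/2) ^ (n + 2) + (1/2) ^ (Suc n + 2)"
        using z[of n] z[of "Suc n"] by simp
      also have "\<dots> \<le> (1/2) ^ n" by simp
      finally show "dist (d (z n)) (d (z (Suc n))) \<le> (1/2) ^ n" .
    qed
    moreover have "(\<lambda>n. d (z n)) \<longlonglongrightarrow> x"
    proof (rule metric_LIMSEQ_I)
      fix e :: real assume "e > 0"
      obtain N where N: "(1/2::real) ^ N < e"
        using real_arch_pow_inv[of "e" "1/2"] \<open>e > 0\<close> by auto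
      have "dist (d (z n)) x < e" if "n \<ge> N" for n
      proof -
        have "(1/2::real) ^ (n + 2) \<le> (1/2) ^ N" using that by (intro power_decreasing) auto
        with z[of n] N show ?thesis by linarith
      qed
      then show "\<exists>no. \<forall>n\<ge>no. dist (d (z n)) x < e" by blast
    qed
    ultimately show ?thesis using f(1) LIMSEQ_unique by blast
  qed
  have "F = f ` (C \<inter> f -` F)"
  proof safe
    fix x assume "x \<in> F"
    with surj[of x] show "x \<in> f ` (C \<inter> f -` F)" by auto
  qed
  moreover have "closed (C \<inter> f -` F)" by (rule continuous_closed_preimage[OF cont C assms])
  ultimately show ?thesis
    using continuous_on_subset[OF cont] by (intro analyticI[of "C \<inter> f -` F" f]) auto
qed

text \<open>Points at distance at least 1/(n+1) from the complement exhaust \<open>U\<close>. The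
  whole space is set apart because \<open>infdist\<close> to the empty set is 0.\<close>

lemma open_as_UN_closed:
  fixes U :: "'a::metric_space set"
  assumes "open U"
  obtains F :: "nat \<Rightarrow> 'a set" where "\<And>n. closed (F n)" "U = (\<Union>n. F n)"
proof (cases "U = UNIV")
  case True
  then show ?thesis using that[of "\<lambda>_. UNIV"] by auto
next
  case False
  show ?thesis
  proof (rule that[of "\<lambda>n. {x. 1 / Suc n \<le> infdist x (-U)}"])
    show "closed {x. 1 / Suc n \<le> infdist x (-U)}" for n
      by (intro closed_Collect_le continuous_intros)
    show "U = (\<Union>n. {x. 1 / Suc n \<le> infdist x (-U)})"
    proof safe
      fix x assume "x \<in> U"
      then have "infdist x (-U) \<noteq> 0"
        using False assms in_closed_iff_infdist_zero[of "-U" x] by (auto simp: closed_def)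
      then have "0 < infdist x (-U)" using infdist_nonneg[of x "-U"] by linarith
      then obtain n where "1 / Suc n < infdist x (-U)" using nat_approx_posE by blast
      then show "x \<in> (\<Union>n. {x. 1 / Suc n \<le> infdist x (-U)})" by (auto intro!: exI[of _ n])
    next
      fix x n assume *: "1 / Suc n \<le> infdist x (-U)"
      have "0 < (1::real) / Suc n" by simp
      with * have "infdist x (-U) \<noteq> 0" by linarith
      then show "x \<in> U" using infdist_zero[of x "-U"] by (metis ComplI)
    qed
  qed
qed

text \<open>Complements of analytic sets need not be analytic, so the induction carries a set
  together with its complement.\<close>

lemma borel_imp_analytic:
  fixes S :: "'a::{complete_space, second_countable_topology} set"
  assumes "S \<in> sets borel"
  shows "analytic S"
proof -
  have "S \<in> sigma_sets UNIV {S. closed S}"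
    using assms by (simp add: borel_eq_closed)
  then have "analytic S \<and> analytic (-S)"
  proof induction
    case (Basic F)
    then have F: "closed F" by simp
    then obtain G :: "nat \<Rightarrow> 'a set" where G: "\<And>n. closed (G n)" "-F = (\<Union>n. G n)"
      using open_as_UN_closed[of "-F"] by (metis open_Compl)
    then have "analytic (-F)"
      by (auto intro: analytic_UN closed_imp_analytic)
    with F show ?case by (auto intro: closed_imp_analytic)
  next
    case Empty
    then show ?case by (auto intro: closed_imp_analytic)
  next
    case (Compl S)
    then show ?case by (simp add: Compl_eq_Diff_UNIV[symmetric])
  next
    case (Union S)
    then show ?case by (auto intro!: analytic_UN analytic_INT)
  qed
  then show ?thesis ..
qed

section \<open>Separation of analytic sets\<close>

text \<open>Novikov's theorem. If separation fails, the digits of all codes \<open>z n\<close> can be fixed one at a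
  time, the one numbered \<open>prod_encode (n, i)\<close> being \<open>z n i\<close>, without the restricted images ever becoming
  separable; the codes found in the limit name a common point.\<close>

lemma analytic_separation:
  fixes S :: "nat \<Rightarrow> 'a::t2_space set"
  assumes "\<And>n. analytic (S n)" and disj: "(\<Inter>n. S n) = {}"
  shows "\<exists>B. (\<forall>n. B n \<in> sets borel \<and> S n \<subseteq> B n) \<and> (\<Inter>n. B n) = {}"
proof (rule ccontr)
  assume no: "\<not> ?thesis"
  define separable where
    "separable T \<longleftrightarrow> (\<exists>B. (\<forall>n. B n \<in> sets borel \<and> T n \<subseteq> B n) \<and> (\<Inter>n. B n) = {})"
    for T :: "nat \<Rightarrow> 'a set"
  from assms(1) obtain C f where *: "\<And>n. closed (C n :: (nat \<Rightarrow> nat) set)"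
      "\<And>n. continuous_on (C n) (f n)" "\<And>n. S n = f n ` C n"
    unfolding analytic_def by metis
  define T where "T w k n =
    f n ` {z \<in> C n. \<forall>i. prod_encode (n, i) < k \<longrightarrow> z i = w (prod_encode (n, i))}" for w k n
  have "T w 0 = S" for w
    unfolding T_def by (rule ext) (use *(3) in auto)
  with no have start: "\<not> separable (T w 0)" for w
    unfolding separable_def by simp
  have step: "\<exists>m. \<not> separable (T (w(k := m)) (Suc k))" if "\<not> separable (T w k)" for w k
  proof (rule ccontr)
    obtain n0 i0 where k: "k = prod_encode (n0, i0)" by (metis prod_decode_inverse surj_pair)
    assume "\<not> ?thesis"
    then obtain B where B: "\<And>m n. B m n \<in> sets borel" "\<And>m n. T (w(k := m)) (Suc k) n \<subseteq> B m n"
        "\<And>m. (\<Inter>n. B m n) = {}"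
      unfolding separable_def by metis
    \<comment> \<open>Digit \<open>k\<close> belongs to the code of \<open>n0\<close>. There the
      choices of \<open>m\<close> split the set, so the separators are united; at the other places
      the set is the same for all \<open>m\<close> and the separators may be intersected.\<close>
    define D where "D n = (if n = n0 then \<Union>m. B m n else \<Inter>m. B m n)" for n
    have "D n \<in> sets borel" for n
      using B(1) by (auto simp: D_def)
    moreover have "T w k n \<subseteq> D n" for n
    proof
      fix x assume "x \<in> T w k n"
      then obtain z where z: "z \<in> C n" "\<And>i. prod_encode (n, i) < k \<Longrightarrow> z i = w (prod_encode (n, i))"
          "x = f n z"
        by (auto simp: T_def)
      have "x \<in> B m n" if "n = n0 \<Longrightarrow> m = z i0" for m
        using B(2)[of m n] z that
        by (auto simp: T_def k less_Suc_eq intro!: subsetD[OF B(2)[of m n]] image_eqI[of _ _ z])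
      then show "x \<in> D n" by (auto simp: D_def)
    qed
    moreover have "(\<Inter>n. D n) = {}"
    proof -
      have False if x: "\<And>n. x \<in> D n" for x
      proof -
        from x[of n0] obtain m where "x \<in> B m n0" by (auto simp: D_def)
        moreover have "x \<in> B m n" if "n \<noteq> n0" for n using x[of n] that by (auto simp: D_def)
        ultimately have "x \<in> B m n" for n by (cases "n = n0") auto
        with B(3) show False by auto
      qed
      then show ?thesis by blast
    qed
    ultimately have "separable (T w k)" unfolding separable_def by blast
    with that show False ..
  qed
  have "\<exists>W. \<forall>k. \<not> separable (T (W k) k) \<and> (\<exists>m. W (Suc k) = (W k)(k := m))"
  proof (rule dependent_nat_choice[where P="\<lambda>k w. \<not> separable (T w k)" and
        Q="\<lambda>k w w'. \<exists>m. w' = w(k := m)"])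
    show "\<exists>w. \<not> separable (T w 0)" using start by blast
    show "\<exists>w'. \<not> separable (T w' (Suc k)) \<and> (\<exists>m. w' = w(k := m))"
      if "\<not> separable (T w k)" for w k
      using step[OF that] by blast
  qed
  then obtain W where W: "\<And>k. \<not> separable (T (W k) k)" "\<And>k. \<exists>m. W (Suc k) = (W k)(k := m)"
    by blast
  \<comment> \<open>Digit \<open>j\<close> is final after stage \<open>j\<close>, so the diagonal
    collects the limit code.\<close>
  define w where "w j = W (Suc j) j" for j
  have "W k j = w j" if "j < k" for j k
    using that
  proof (induction k)
    case (Suc k)
    from W(2)[of k] obtain m where "W (Suc k) = (W k)(k := m)" ..
    with Suc show ?case by (cases "j = k") (auto simp: w_def)
  qed simp
  then have "T (W k) k = T w k" for k by (auto simp: T_def fun_eq_iff)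
  with W(1) have w: "\<not> separable (T w k)" for k by metis
  define z where "z n = (\<lambda>i. w (prod_encode (n, i)))" for n
  have agree: "\<exists>k0. \<forall>k\<ge>k0. T w k n \<subseteq> f n ` {z' \<in> C n. \<forall>i<j. z' i = z n i}" for n j
  proof -
    obtain k0 where "\<And>i. i < j \<Longrightarrow> prod_encode (n, i) < k0"
      using finite_nat_bounded[of "(\<lambda>i. prod_encode (n, i)) ` {..<j}"] by auto
    then have "\<forall>k\<ge>k0. T w k n \<subseteq> f n ` {z' \<in> C n. \<forall>i<j. z' i = z n i}"
      unfolding T_def z_def by (intro allI impI image_mono) (auto intro: less_le_trans)
    then show ?thesis ..
  qed
  have zC: "z n \<in> C n" for n
  proof (rule closed_baireD[OF *(1)])
    fix j
    obtain k where k: "T w k n \<subseteq> f n ` {z' \<in> C n. \<forall>i<j. z' i = z n i}" using agree by blast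
    have "T w k n \<noteq> {}"
    proof
      assume "T w k n = {}"
      then have "separable (T w k)"
        unfolding separable_def
        by (intro exI[of _ "\<lambda>m. if m = n then {} else UNIV"]) (auto split: if_splits)
      with w show False by blast
    qed
    with k show "\<exists>z'\<in>C n. \<forall>i<j. z' i = z n i" by auto
  qed
  \<comment> \<open>Distinct limit values would have disjoint neighbourhoods, which contain the
    restricted images from some stage on and, with \<open>UNIV\<close> elsewhere, separate
    them.\<close>
  have "f a (z a) = f b (z b)" for a b
  proof (rule ccontr)
    assume ne: "f a (z a) \<noteq> f b (z b)"
    then obtain U V where UV: "open U" "open V" "f a (z a) \<in> U" "f b (z b) \<in> V" "U \<inter> V = {}"
      by (metis hausdorff)
    obtain i where i: "\<And>z'. z' \<in> C a \<Longrightarrow> \<forall>l<i. z' l = z a l \<Longrightarrow> f a z' \<in> U"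
      using continuous_on_baire[of "C a" "f a" "z a" U] *(2) zC UV by blast
    obtain j where j: "\<And>z'. z' \<in> C b \<Longrightarrow> \<forall>l<j. z' l = z b l \<Longrightarrow> f b z' \<in> V"
      using continuous_on_baire[of "C b" "f b" "z b" V] *(2) zC UV by blast
    obtain k1 k2 where "\<forall>k\<ge>k1. T w k a \<subseteq> f a ` {z' \<in> C a. \<forall>l<i. z' l = z a l}"
      "\<forall>k\<ge>k2. T w k b \<subseteq> f b ` {z' \<in> C b. \<forall>l<j. z' l = z b l}"
      using agree[of a i] agree[of b j] by blast
    then have sub: "T w (max k1 k2) a \<subseteq> f a ` {z' \<in> C a. \<forall>l<i. z' l = z a l}"
      "T w (max k1 k2) b \<subseteq> f b ` {z' \<in> C b. \<forall>l<j. z' l = z b l}" by simp_all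
    have subUV: "f a ` {z' \<in> C a. \<forall>l<i. z' l = z a l} \<subseteq> U"
      "f b ` {z' \<in> C b. \<forall>l<j. z' l = z b l} \<subseteq> V" using i j by auto
    have TUV: "T w (max k1 k2) a \<subseteq> U" "T w (max k1 k2) b \<subseteq> V"
      using order_trans[OF sub(1) subUV(1)] order_trans[OF sub(2) subUV(2)] by auto
    have "a \<noteq> b" using ne by auto
    with TUV have "separable (T w (max k1 k2))"
      unfolding separable_def using UV
      by (intro exI[of _ "\<lambda>m. if m = a then U else if m = b then V else UNIV"])
         (auto split: if_splits)
    with w show False by blast
  qed
  then have "f 0 (z 0) \<in> (\<Inter>n. S n)" using zC *(3) by (metis INT_I image_eqI)
  with disj show False by auto
qed

text \<open>Novikov's theorem for the sequence \<open>P, Q, Q, ...\<close>: the later separators all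
  contain \<open>Q\<close>, and their intersection misses \<open>B 0\<close>.\<close>

lemma lusin_separation:
  fixes P Q :: "'a::t2_space set"
  assumes "analytic P" "analytic Q" "P \<inter> Q = {}"
  shows "\<exists>B\<in>sets borel. P \<subseteq> B \<and> B \<inter> Q = {}"
proof -
  define S where "S = case_nat P (\<lambda>_. Q)"
  have S: "S 0 = P" "S (Suc n) = Q" for n by (auto simp: S_def)
  have "analytic (S n)" for n using assms(1,2) by (cases n) (auto simp: S)
  moreover have "(\<Inter>n. S n) = {}"
    using assms(3) S by blast
  ultimately obtain B where B: "\<And>n. B n \<in> sets borel" "\<And>n. S n \<subseteq> B n" "(\<Inter>n. B n) = {}"
    using analytic_separation[of S] by blast
  have PB: "P \<subseteq> B 0" "Q \<subseteq> B (Suc n)" for n using B(2)[of 0] B(2)[of "Suc n"] S by auto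
  show ?thesis
  proof (intro bexI conjI)
    show "B 0 - (\<Inter>n. B (Suc n)) \<in> sets borel" using B(1) by (intro sets.Diff) auto
    have "x \<in> B n" if "x \<in> B 0" "\<And>n. x \<in> B (Suc n)" for x n
      using that by (cases n) auto
    then have "B 0 \<inter> (\<Inter>n. B (Suc n)) \<subseteq> (\<Inter>n. B n)" by auto
    with B(3) PB(1) show "P \<subseteq> B 0 - (\<Inter>n. B (Suc n))" by auto
    show "(B 0 - (\<Inter>n. B (Suc n))) \<inter> Q = {}" using PB(2) by blast
  qed
qed

section \<open>Borel sets with open or compact sections\<close>

lemma analytic_fst: "analytic S \<Longrightarrow> analytic (fst ` S)"
  by (rule analytic_image) (auto intro: continuous_intros)

text \<open>Kunugui-Novikov. Taking for \<open>P\<close> the complement of \<open>G\<close> relative to a smaller product makes the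
  statement usable when the sections of \<open>G\<close> are only relatively open.\<close>

lemma open_sections_cover:
  fixes G P :: "('y::{complete_space, second_countable_topology} \<times>
    'a::{complete_space, second_countable_topology}) set"
  assumes G: "G \<in> sets borel" and P: "analytic P"
    and sections: "\<And>y a. (y, a) \<in> G \<Longrightarrow> \<exists>U. open U \<and> a \<in> U \<and> (\<forall>b\<in>U. (y, b) \<notin> P)"
  shows "\<exists>(Z :: nat \<Rightarrow> 'y set) (U :: nat \<Rightarrow> 'a set).
    (\<forall>n. Z n \<in> sets borel \<and> open (U n) \<and> (Z n \<times> U n) \<inter> P = {}) \<and> G \<subseteq> (\<Union>n. Z n \<times> U n)"
proof -
  obtain \<B> :: "'a set set" where \<B>: "countable \<B>" "topological_basis \<B>"
    using ex_countable_basis by blast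
  have "\<B> \<noteq> {}"
    using \<B>(2) unfolding topological_basis_def by (metis Sup_empty UNIV_not_empty open_UNIV subset_empty)
  define U where "U = from_nat_into \<B>"
  have U: "open (U n)" for n
    using \<B>(2) \<open>\<B> \<noteq> {}\<close> unfolding U_def by (metis from_nat_into topological_basis_open)
  have U_basis: "\<exists>n. a \<in> U n \<and> U n \<subseteq> V" if V: "open V" "a \<in> V" for a V
  proof -
    obtain b where "b \<in> \<B>" "a \<in> b" "b \<subseteq> V" using topological_basisE[OF \<B>(2) V] .
    then show ?thesis using from_nat_into_surj[OF \<B>(1)] unfolding U_def by metis
  qed
  \<comment> \<open>\<open>y \<notin> Q n\<close> says that the section of \<open>P\<close> over
    \<open>y\<close> misses \<open>U n\<close>, so that \<open>{y} \<times> U n\<close> is an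
    allowed piece.\<close>
  define Q where "Q n = fst ` (P \<inter> UNIV \<times> U n)" for n
  have aU: "analytic (UNIV \<times> U n :: ('y \<times> 'a) set)" "analytic (UNIV \<times> (- U n) :: ('y \<times> 'a) set)" for n
    using U[of n] by (auto intro!: analytic_Times intro: borel_imp_analytic)
  have Q: "analytic (Q n)" for n
    unfolding Q_def by (intro analytic_fst analytic_Int P aU)
  \<comment> \<open>The points of \<open>G\<close> that the basic set \<open>U n\<close> does not
    serve: it meets the section of \<open>P\<close> or misses the point. By openness of the sections
    each point is served by some \<open>n\<close>.\<close>
  define E where "E n = G \<inter> (Q n \<times> UNIV \<union> UNIV \<times> (- U n))" for n
  have "analytic (E n)" for n
    unfolding E_def
    by (intro analytic_Int analytic_Un analytic_Times Q aU borel_imp_analytic[OF G] borel_imp_analytic) auto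
  moreover have "(\<Inter>n. E n) = {}"
  proof -
    have False if *: "\<And>n. (y, a) \<in> E n" for y a
    proof -
      from *[of 0] have "(y, a) \<in> G" by (auto simp: E_def)
      then obtain V where V: "open V" "a \<in> V" "\<forall>b\<in>V. (y, b) \<notin> P"
        using sections[of y a] by auto
      with U_basis[of V a] obtain n where n: "a \<in> U n" "U n \<subseteq> V" by blast
      with V(3) have "y \<notin> Q n" by (auto simp: Q_def)
      with n(1) *[of n] show False by (auto simp: E_def)
    qed
    then show ?thesis by auto
  qed
  ultimately obtain B where B: "\<And>n. B n \<in> sets borel" "\<And>n. E n \<subseteq> B n" "(\<Inter>n. B n) = {}"
    using analytic_separation[of E] by blast
  \<comment> \<open>A point of \<open>G\<close> outside \<open>B n\<close> is outside
    \<open>E n\<close>, hence its base point is not in \<open>Q n\<close>. Two disjoint analytic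
    sets result, and a Borel set \<open>Z n\<close> separates them.\<close>
  define W where "W n = fst ` (G - B n)" for n
  have "analytic (W n)" for n
    unfolding W_def using G B(1)[of n] by (intro analytic_fst borel_imp_analytic) auto
  moreover have "W n \<inter> Q n = {}" for n
    using B(2)[of n] by (fastforce simp: W_def E_def)
  ultimately have "\<exists>Z. Z \<in> sets borel \<and> W n \<subseteq> Z \<and> Z \<inter> Q n = {}" for n
    using lusin_separation[of "W n" "Q n"] Q by blast
  then obtain Z where Z: "\<And>n. Z n \<in> sets borel" "\<And>n. W n \<subseteq> Z n" "\<And>n. Z n \<inter> Q n = {}"
    by metis
  show ?thesis
  proof (intro exI conjI allI)
    show "Z n \<in> sets borel" "open (U n)" for n by (fact Z(1) U)+
    show "G \<subseteq> (\<Union>n. Z n \<times> U n)"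
    proof
      fix p assume p: "p \<in> G"
      from B(3) obtain n where n: "p \<notin> B n" by auto
      with B(2)[of n] p have "snd p \<in> U n" by (cases p) (auto simp: E_def)
      moreover have "fst p \<in> Z n" using Z(2)[of n] n p by (auto simp: W_def)
      ultimately show "p \<in> (\<Union>n. Z n \<times> U n)" by (cases p) auto
    qed
    show "(Z n \<times> U n) \<inter> P = {}" for n
    proof -
      have "y \<in> Q n" if "(y, a) \<in> P" "a \<in> U n" for y a
        using that unfolding Q_def by (force intro!: image_eqI[of _ _ "(y, a)"])
      with Z(3)[of n] show ?thesis by auto
    qed
  qed
qed

text \<open>The early terms are added to the net to cover the whole range. Closed balls let the
  cover pass to the closure, and their smaller radius leaves room for open balls of radius
  \<open>e\<close>; the closure is complete and totally bounded, hence compact.\<close>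

lemma totally_bounded_sequence_convergent_subsequence:
  fixes x :: "nat \<Rightarrow> 'a::complete_space"
  assumes "\<And>m. \<exists>F. finite F \<and> (\<forall>k\<ge>m. \<exists>d\<in>F. dist d (x k) \<le> (1/2) ^ m)"
  shows "\<exists>l r. strict_mono r \<and> (x \<circ> r) \<longlonglongrightarrow> l"
proof -
  have "\<exists>F. finite F \<and> closure (range x) \<subseteq> (\<Union>d\<in>F. ball d e)" if "e > 0" for e :: real
  proof -
    obtain m where m: "(1/2::real) ^ m < e"
      using real_arch_pow_inv[of "e" "1/2"] \<open>e > 0\<close> by auto
    obtain F where F: "finite F" "\<And>k. k \<ge> m \<Longrightarrow> \<exists>d\<in>F. dist d (x k) \<le> (1/2) ^ m"
      using assms by blast
    define F' where "F' = F \<union> x ` {..<m}"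
    have "closed (\<Union>d\<in>F'. cball d ((1/2) ^ m))"
      using F(1) by (intro closed_UN) (auto simp: F'_def)
    moreover have "range x \<subseteq> (\<Union>d\<in>F'. cball d ((1/2) ^ m))"
    proof safe
      fix k show "x k \<in> (\<Union>d\<in>F'. cball d ((1/2) ^ m))"
      proof (cases "k < m")
        case True
        then have "x k \<in> F'" by (auto simp: F'_def)
        then show ?thesis by (rule UN_I) simp
      qed (use F(2)[of k] in \<open>auto simp: F'_def\<close>)
    qed
    ultimately have "closure (range x) \<subseteq> (\<Union>d\<in>F'. cball d ((1/2) ^ m))"
      by (intro closure_minimal)
    also have "\<dots> \<subseteq> (\<Union>d\<in>F'. ball d e)" using m by (intro UN_mono) auto
    finally show ?thesis using F(1) by (intro exI[of _ F']) (auto simp: F'_def)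
  qed
  then have "compact (closure (range x))"
    unfolding compact_eq_totally_bounded by (simp add: complete_eq_closed)
  then have "seq_compact (closure (range x))" by (simp add: compact_eq_seq_compact_metric)
  moreover have "\<forall>n. x n \<in> closure (range x)"
    using closure_subset[of "range x"] by auto
  ultimately show ?thesis
    unfolding seq_compact_def by blast
qed

text \<open>A section is empty iff finitely many of the constraints "lies in the first \<open>l ! m\<close> balls of radius
  \<open>(1/2) ^ m\<close>" and "avoids \<open>U n\<close>" are already contradictory: otherwise points satisfying more and more
  of them have a limit point, by total boundedness. Each constraint holds on a Borel set of \<open>y\<close>.\<close>

theorem borel_projection_compact_sections:
  fixes P :: "('y::{complete_space, second_countable_topology} \<times>
    'a::{complete_space, second_countable_topology}) set"
  assumes P: "P \<in> sets borel" and compact: "\<And>y. compact {a. (y, a) \<in> P}"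
  shows "fst ` P \<in> sets borel"
proof -
  have aP: "analytic P" by (rule borel_imp_analytic[OF P])
  obtain d :: "nat \<Rightarrow> 'a" where d: "\<And>x e. e > 0 \<Longrightarrow> \<exists>n. dist (d n) x < e"
    using dense_sequence by blast
  define N where "N m j = (\<Union>i<j. ball (d i) ((1/2) ^ m))" for m j :: nat
  have openN: "open (N m j)" for m j by (auto simp: N_def)
  define S where "S m j = fst ` (P \<inter> UNIV \<times> (- N m j))" for m j
  have S: "analytic (S m j)" for m j
    unfolding S_def using openN[of m j]
    by (intro analytic_fst analytic_Int aP analytic_Times borel_imp_analytic) auto
  have "(\<Inter>j. S m j) = {}" for m
  proof -
    have "\<exists>j. {a. (y, a) \<in> P} \<subseteq> N m j" for y
    proof -
      have "{a. (y, a) \<in> P} \<subseteq> \<Union> (range (\<lambda>i. ball (d i) ((1/2) ^ m)))"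
        using d[of "(1/2) ^ m"] by (auto simp: UNION_eq)
      then obtain I where I: "finite I" "{a. (y, a) \<in> P} \<subseteq> (\<Union>i\<in>I. ball (d i) ((1/2) ^ m))"
        using compactE_image[OF compact[of y], of UNIV "\<lambda>i. ball (d i) ((1/2) ^ m)"] by auto
      obtain j where "I \<subseteq> {..<j}" using finite_nat_bounded[OF I(1)] by auto
      with I(2) show ?thesis unfolding N_def by (intro exI[of _ j]) blast
    qed
    then show ?thesis by (fastforce simp: S_def)
  qed
  \<comment> \<open>\<open>S m j\<close> holds the \<open>y\<close> whose section the first
    \<open>j\<close> balls fail to cover and is only known to be analytic. Its Borel superset makes
    \<open>y \<notin> B m j\<close> a Borel certificate of covering, available at every
    \<open>y\<close> for some \<open>j\<close>.\<close>
  then have "\<exists>B. (\<forall>j. B j \<in> sets borel) \<and> (\<forall>j. S m j \<subseteq> B j) \<and> (\<Inter>j. B j) = {}" for m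
    using analytic_separation[of "S m"] S by blast
  then obtain B where B: "\<And>m j. B m j \<in> sets borel" "\<And>m j. S m j \<subseteq> B m j" "\<And>m. (\<Inter>j. B m j) = {}"
    by metis
  \<comment> \<open>The complement of \<open>P\<close> has open sections, so it is a union of
    rectangles; \<open>y \<in> Z n\<close> certifies that the section avoids
    \<open>U n\<close>.\<close>
  have "\<exists>V. open V \<and> a \<in> V \<and> (\<forall>b\<in>V. (y, b) \<notin> P)" if "(y, a) \<in> - P" for y a
    using compact[of y, THEN compact_imp_closed] that
    by (intro exI[of _ "- {a. (y, a) \<in> P}"]) auto
  then obtain Z :: "nat \<Rightarrow> 'y set" and U :: "nat \<Rightarrow> 'a set" where
    ZU: "\<And>n. Z n \<in> sets borel" "\<And>n. open (U n)" "- P \<subseteq> (\<Union>n. Z n \<times> U n)" "\<And>n. (Z n \<times> U n) \<inter> P = {}"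
    using open_sections_cover[OF borel_comp[OF P] aP] by blast
  \<comment> \<open>\<open>K l F\<close> does not mention \<open>y\<close>: its emptiness depends on
    two finite lists only, so the union below is countable.\<close>
  define K where "K l F = (\<Inter>m<length l. \<Union>i<l!m. cball (d i) ((1/2) ^ m)) - (\<Union>n\<in>set F. U n)"
    for l F :: "nat list"
  have "- (fst ` P) = (\<Union>(l, F)\<in>{(l, F). K l F = {}}.
      - (\<Union>m<length l. B m (l!m)) \<inter> - (\<Union>n\<in>set F. - Z n))" (is "_ = ?R")
  proof (intro equalityI subsetI)
    fix y assume "y \<in> - (fst ` P)"
    then have y: "(y, a) \<notin> P" for a by force
    from B(3) have "\<exists>j. y \<notin> B m j" for m by auto
    then obtain J where J: "\<And>m. y \<notin> B m (J m)" by metis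
    define l where "l k = map J [0..<k]" for k
    define F where "F k = filter (\<lambda>n. y \<in> Z n) [0..<k]" for k
    have "\<exists>k. K (l k) (F k) = {}"
    proof (rule ccontr)
      assume "\<not> ?thesis"
      then have "\<forall>k. \<exists>a. a \<in> K (l k) (F k)" by auto
      then obtain x where x: "\<And>k. x k \<in> K (l k) (F k)" by metis
      \<comment> \<open>The shift to \<open>Suc k\<close> puts constraint \<open>m\<close> among
        those imposed on the term as soon as \<open>m \<le> k\<close>.\<close>
      have "\<exists>D. finite D \<and> (\<forall>k\<ge>m. \<exists>d\<in>D. dist d (x (Suc k)) \<le> (1/2) ^ m)" for m
      proof (intro exI[of _ "d ` {..<J m}"] conjI allI impI)
        fix k assume "m \<le> k"
        with x[of "Suc k"] show "\<exists>d\<in>d ` {..<J m}. dist d (x (Suc k)) \<le> (1/2) ^ m"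
          by (auto simp: K_def l_def simp del: upt_Suc)
      qed simp
      then obtain a r where r: "strict_mono r" "((\<lambda>k. x (Suc k)) \<circ> r) \<longlonglongrightarrow> a"
        using totally_bounded_sequence_convergent_subsequence[of "\<lambda>k. x (Suc k)"] by blast
      obtain n where n: "y \<in> Z n" "a \<in> U n" using y[of a] ZU(3) by auto
      have "eventually (\<lambda>k. ((\<lambda>k. x (Suc k)) \<circ> r) k \<in> U n) sequentially"
        using topological_tendstoD[OF r(2) ZU(2) n(2)] .
      moreover have "eventually (\<lambda>k. k \<ge> n) sequentially" by (rule eventually_ge_at_top)
      ultimately have "eventually (\<lambda>k. False) sequentially"
      proof eventually_elim
        case (elim k)
        then have "n < Suc (r k)" using seq_suble[OF r(1), of k] by simp
        with elim n(1) x[of "Suc (r k)"] show False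
          by (auto simp: K_def F_def simp del: upt_Suc)
      qed
      then show False by simp
    qed
    then obtain k where k: "K (l k) (F k) = {}" ..
    have "y \<in> - (\<Union>m<length (l k). B m (l k!m)) \<inter> - (\<Union>n\<in>set (F k). - Z n)"
      using J by (auto simp: l_def F_def)
    with k show "y \<in> ?R" by blast
  next
    fix y assume "y \<in> ?R"
    then obtain l F where lF: "K l F = {}" "\<And>m. m < length l \<Longrightarrow> y \<notin> B m (l!m)"
      "\<And>n. n \<in> set F \<Longrightarrow> y \<in> Z n" by auto
    have "(y, a) \<notin> P" for a
    proof
      assume a: "(y, a) \<in> P"
      have "a \<in> N m (l!m)" if "m < length l" for m
        using lF(2)[OF that] B(2)[of m "l!m"] a by (force simp: S_def)
      then have "a \<in> (\<Inter>m<length l. \<Union>i<l!m. cball (d i) ((1/2) ^ m))"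
        unfolding N_def by (fastforce intro: less_imp_le)
      with lF(1) obtain n where "n \<in> set F" "a \<in> U n" unfolding K_def by blast
      with lF(3) ZU(4)[of n] a show False by auto
    qed
    then show "y \<in> - (fst ` P)" by auto
  qed
  also have "\<dots> \<in> sets borel"
  proof (intro sets.countable_UN'' countableI_type)
    have "- (\<Union>m<length l. B m (l!m)) \<inter> - (\<Union>n\<in>set F. - Z n) \<in> sets borel" for l F :: "nat list"
      using B(1) ZU(1) by (intro sets.Int borel_comp sets.finite_UN) auto
    then show "(case p of (l, F) \<Rightarrow> - (\<Union>m<length l. B m (l!m)) \<inter> - (\<Union>n\<in>set F. - Z n)) \<in> sets borel" for p
      by (simp only: split_beta)
  qed
  finally have "- (- fst ` P) \<in> sets borel" by (rule borel_comp)
  then show ?thesis by simp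
qed

subsection \<open>Uniformization\<close>

lemma borel_compact_sections_Times:
  fixes P :: "('y::{complete_space, second_countable_topology} \<times>
    'a::{complete_space, second_countable_topology}) set"
  assumes P: "P \<in> sets borel" "\<And>y. compact {a. (y, a) \<in> P}" and F: "closed F"
  shows "P \<inter> UNIV \<times> F \<in> sets borel" "compact {a. (y, a) \<in> P \<inter> UNIV \<times> F}"
proof -
  show "P \<inter> UNIV \<times> F \<in> sets borel"
    using P F by (intro sets.Int) (auto intro!: borel_Times)
  have "{a. (y, a) \<in> P \<inter> UNIV \<times> F} = {a. (y, a) \<in> P} \<inter> F" by auto
  then show "compact {a. (y, a) \<in> P \<inter> UNIV \<times> F}"
    using compact_Int_closed[OF P(2)[of y] F] by simp
qed

text \<open>Each section is cut down to the first closed ball, in an enumeration of dense centres,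
  that meets it. The projection theorem makes the index of that ball Borel in \<open>y\<close>, and
  closed balls preserve compactness.\<close>

lemma borel_compact_sections_refine:
  fixes P :: "('y::{complete_space, second_countable_topology} \<times>
    'a::{complete_space, second_countable_topology}) set"
  assumes P: "P \<in> sets borel" "\<And>y. compact {a. (y, a) \<in> P}" and e: "e > 0"
  shows "\<exists>P' f. P' \<in> sets borel \<and> (\<forall>y. compact {a. (y, a) \<in> P'}) \<and> P' \<subseteq> P \<and> fst ` P' = fst ` P \<and>
    f \<in> borel_measurable borel \<and> (\<forall>(y, a)\<in>P'. dist (f y) a \<le> e)"
proof -
  obtain d :: "nat \<Rightarrow> 'a" where d: "\<And>x e. e > 0 \<Longrightarrow> \<exists>n. dist (d n) x < e"
    using dense_sequence by blast
  define N where "N y = (LEAST n. y \<in> fst ` (P \<inter> UNIV \<times> cball (d n) e))" for y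
  have sets: "fst ` (P \<inter> UNIV \<times> cball (d n) e) \<in> sets borel" for n
    by (intro borel_projection_compact_sections borel_compact_sections_Times P) auto
  have N: "N \<in> borel \<rightarrow>\<^sub>M count_space UNIV"
    unfolding N_def using sets by (intro measurable_Least) (simp add: pred_def)
  define P' where "P' = (\<Union>n. P \<inter> ({y. N y = n} \<times> cball (d n) e))"
  have N_sets: "{y. N y = n} \<in> sets borel" for n
    using measurable_sets[OF N, of "{n}"] by (simp add: vimage_def)
  have "P' \<in> sets borel"
    unfolding P'_def using P(1) N_sets
    by (intro sets.countable_UN'' sets.Int borel_Times) auto
  moreover have "{a. (y, a) \<in> P'} = {a. (y, a) \<in> P} \<inter> cball (d (N y)) e" for y
    by (auto simp: P'_def)
  then have "\<forall>y. compact {a. (y, a) \<in> P'}"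
    using P(2) by (auto intro!: compact_Int_closed)
  moreover have "P' \<subseteq> P" by (auto simp: P'_def)
  moreover have "y \<in> fst ` P'" if "(y, a) \<in> P" for y a
  proof -
    obtain n where "dist (d n) a < e" using d[OF e] by blast
    with that have "y \<in> fst ` (P \<inter> UNIV \<times> cball (d n) e)"
      by (intro image_eqI[of _ _ "(y, a)"]) auto
    then have "y \<in> fst ` (P \<inter> UNIV \<times> cball (d (N y)) e)"
      unfolding N_def by (rule LeastI)
    then obtain b where "(y, b) \<in> P" "b \<in> cball (d (N y)) e" by auto
    then show ?thesis by (intro image_eqI[of _ _ "(y, b)"]) (auto simp: P'_def)
  qed
  ultimately have "P' \<in> sets borel \<and> (\<forall>y. compact {a. (y, a) \<in> P'}) \<and> P' \<subseteq> P \<and> fst ` P' = fst ` P \<and>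
    (\<lambda>y. d (N y)) \<in> borel_measurable borel \<and> (\<forall>(y, a)\<in>P'. dist (d (N y)) a \<le> e)"
    using measurable_compose[OF N, of d] by (auto simp: P'_def)
  then show ?thesis by blast
qed

text \<open>Refining with radius \<open>(1/2) ^ k\<close> at stage \<open>k\<close> shrinks the
  section over \<open>y\<close> towards a single point, which compactness keeps in all stages; the
  Borel centres converge to it.\<close>

theorem borel_uniformization_compact_sections:
  fixes P :: "('y::{complete_space, second_countable_topology} \<times>
    'a::{complete_space, second_countable_topology}) set"
  assumes P: "P \<in> sets borel" "\<And>y. compact {a. (y, a) \<in> P}"
  shows "\<exists>f\<in>borel_measurable borel. \<forall>y\<in>fst ` P. (y, f y) \<in> P"
proof -
  define good where "good Q \<longleftrightarrow> Q \<in> sets borel \<and> (\<forall>y. compact {a. (y, a) \<in> Q}) \<and> Q \<subseteq> P \<and> fst ` Q = fst ` P"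
    for Q :: "('y \<times> 'a) set"
  define refines where "refines k Q Q' \<longleftrightarrow> Q' \<subseteq> Q \<and>
    (\<exists>f\<in>borel_measurable borel. \<forall>(y, a)\<in>Q'. dist (f y) a \<le> (1/2) ^ k)"
    for k :: nat and Q Q' :: "('y \<times> 'a) set"
  have "\<exists>R. \<forall>k. good (R k) \<and> refines k (R k) (R (Suc k))"
  proof (rule dependent_nat_choice[where P="\<lambda>k. good" and Q=refines])
    show "\<exists>Q. good Q" using P by (auto simp: good_def intro!: exI[of _ P])
    show "\<exists>Q'. good Q' \<and> refines k Q Q'" if "good Q" for Q k
    proof -
      have "\<exists>Q' f. Q' \<in> sets borel \<and> (\<forall>y. compact {a. (y, a) \<in> Q'}) \<and> Q' \<subseteq> Q \<and> fst ` Q' = fst ` Q \<and>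
          f \<in> borel_measurable borel \<and> (\<forall>(y, a)\<in>Q'. dist (f y) a \<le> (1/2) ^ k)"
        using that by (intro borel_compact_sections_refine) (auto simp: good_def)
      then obtain Q' f where *: "Q' \<in> sets borel" "\<forall>y. compact {a. (y, a) \<in> Q'}" "Q' \<subseteq> Q"
          "fst ` Q' = fst ` Q" "f \<in> borel_measurable borel" "\<forall>(y, a)\<in>Q'. dist (f y) a \<le> (1/2) ^ k"
        by (elim exE conjE)
      then have "refines k Q Q'" unfolding refines_def by (intro conjI bexI[of _ f])
      moreover have "good Q'" using * that unfolding good_def by blast
      ultimately show ?thesis by blast
    qed
  qed
  then obtain R where R: "\<And>k. good (R k)" "\<And>k. refines k (R k) (R (Suc k))" by blast
  from R(2) have "\<forall>k. \<exists>f. f \<in> borel_measurable borel \<and> (\<forall>(y, a)\<in>R (Suc k). dist (f y) a \<le> (1/2) ^ k)"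
    unfolding refines_def by blast
  then obtain f where "\<forall>k. f k \<in> borel_measurable borel \<and> (\<forall>(y, a)\<in>R (Suc k). dist (f k y) a \<le> (1/2) ^ k)"
    unfolding choice_iff by (elim exE)
  then have f: "\<And>k. f k \<in> borel_measurable borel"
    "\<And>k y a. (y, a) \<in> R (Suc k) \<Longrightarrow> dist (f k y) a \<le> (1/2) ^ k"
    by auto
  have mono: "R l \<subseteq> R k" if "k \<le> l" for k l
    using R(2) unfolding refines_def by (intro lift_Suc_antimono_le[OF _ that]) blast
  have D: "fst ` P \<in> sets borel" by (rule borel_projection_compact_sections[OF P])
  have "\<exists>a. (\<lambda>k. f k y) \<longlonglongrightarrow> a \<and> (\<forall>k. (y, a) \<in> R k)" if y: "y \<in> fst ` P" for y
  proof -
    have "\<exists>a. (y, a) \<in> R k" for k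
    proof -
      have "y \<in> fst ` R k" using R(1)[of k] y by (simp add: good_def)
      then show ?thesis by auto
    qed
    then obtain a where a: "\<And>k. (y, a k) \<in> R k" by metis
    have "seq_compact {b. (y, b) \<in> R 0}"
      using R(1)[of 0] by (auto simp: good_def compact_eq_seq_compact_metric)
    moreover have "\<forall>k. a k \<in> {b. (y, b) \<in> R 0}" using a mono[of 0] by auto
    ultimately obtain b r where r: "strict_mono r" "(a \<circ> r) \<longlonglongrightarrow> b"
      unfolding seq_compact_def by blast
    have b: "(y, b) \<in> R k" for k
    proof -
      have "closed {b. (y, b) \<in> R k}" using R(1)[of k] by (auto simp: good_def compact_imp_closed)
      moreover have "\<forall>\<^sub>F i in sequentially. (a \<circ> r) i \<in> {b. (y, b) \<in> R k}"
        using eventually_ge_at_top[of k]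
      proof eventually_elim
        case (elim i)
        then have "k \<le> r i" using seq_suble[OF r(1), of i] by simp
        then show ?case using a[of "r i"] mono by auto
      qed
      ultimately have "b \<in> {b. (y, b) \<in> R k}"
        by (rule Lim_in_closed_set[OF _ _ sequentially_bot r(2)])
      then show ?thesis by simp
    qed
    have "(\<lambda>k. f k y) \<longlonglongrightarrow> b"
    proof (rule metric_LIMSEQ_I)
      fix e :: real assume "e > 0"
      obtain K where K: "(1/2::real) ^ K < e"
        using real_arch_pow_inv[of "e" "1/2"] \<open>e > 0\<close> by auto
      have "dist (f k y) b < e" if "k \<ge> K" for k
      proof -
        have "dist (f k y) b \<le> (1/2) ^ k" by (rule f(2)[OF b])
        also have "\<dots> \<le> (1/2::real) ^ K" using that by (intro power_decreasing) auto
        finally show ?thesis using K by simp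
      qed
      then show "\<exists>K. \<forall>k\<ge>K. dist (f k y) b < e" by blast
    qed
    with b show ?thesis by blast
  qed
  then obtain g where g: "\<And>y. y \<in> fst ` P \<Longrightarrow> (\<lambda>k. f k y) \<longlonglongrightarrow> g y"
    "\<And>y k. y \<in> fst ` P \<Longrightarrow> (y, g y) \<in> R k" by metis
  \<comment> \<open>Off the projection the centres are replaced by a constant, so that the sequence
    converges everywhere.\<close>
  define h where "h y = (if y \<in> fst ` P then g y else undefined)" for y
  have "h \<in> borel_measurable borel"
  proof (rule borel_measurable_LIMSEQ_metric)
    show "(\<lambda>y. if y \<in> fst ` P then f k y else undefined) \<in> borel_measurable borel" for k
      using D f(1) by (intro measurable_If_set) auto
    show "(\<lambda>k. if y \<in> fst ` P then f k y else undefined) \<longlonglongrightarrow> h y" for y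
      using g(1) by (auto simp: h_def)
  qed
  moreover have "R 0 \<subseteq> P" using R(1)[of 0] by (simp add: good_def)
  ultimately show ?thesis using g(2)[of _ 0] by (intro bexI[of _ h]) (auto simp: h_def)
qed

section \<open>Integrals with respect to semi-uniform Feller kernels\<close>

lemma sets_borel_on_iff:
  "S \<in> sets borel \<Longrightarrow> B \<in> sets (borel_on S) \<longleftrightarrow> B \<subseteq> S \<and> B \<in> sets borel"
  by (subst sets_restrict_space_iff) auto

lemma measurable_fst_borel_on:
  "fst \<in> borel_on (S \<times> T) \<rightarrow>\<^sub>M borel_on S"
  for S :: "'a::topological_space set" and T :: "'b::topological_space set"
  by (rule measurable_restrict_space3) (auto intro!: borel_measurable_continuous_onI continuous_on_fst continuous_on_snd continuous_on_id)

lemma measurable_snd_borel_on: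
  "snd \<in> borel_on (S \<times> T) \<rightarrow>\<^sub>M borel_on T"
  for S :: "'a::topological_space set" and T :: "'b::topological_space set"
  by (rule measurable_restrict_space3) (auto intro!: borel_measurable_continuous_onI continuous_on_fst continuous_on_snd continuous_on_id)

text \<open>The slice measure is the \<open>fst\<close>-image of \<open>\<mu>\<close> weighted by
  the indicator of \<open>B\<close> in the second coordinate: both set functions agree on the
  measurable sets, and \<open>measure_of\<close> sees nothing else.\<close>

lemma integral_slice_measure:
  fixes S1 :: "'w::topological_space set" and S2 :: "'y::topological_space set" and f :: "'w \<Rightarrow> real"
  assumes \<mu>: "sets \<mu> = sets (borel_on (S1 \<times> S2))"
    and B: "B \<in> sets (borel_on S2)" and f: "f \<in> borel_measurable (borel_on S1)"
  shows "(\<integral>w. f w \<partial>slice_measure S1 \<mu> B) = (\<integral>p. f (fst p) * indicator B (snd p) \<partial>\<mu>)"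
proof -
  note [measurable_cong] = \<mu>
  have [measurable]: "fst \<in> \<mu> \<rightarrow>\<^sub>M borel_on S1" "snd \<in> \<mu> \<rightarrow>\<^sub>M borel_on S2"
    using measurable_fst_borel_on[of S1 S2] measurable_snd_borel_on[of S1 S2] by simp_all
  note B[measurable] f[measurable]
  have space: "space \<mu> = S1 \<times> S2" using sets_eq_imp_space_eq[OF \<mu>] by (simp add: space_restrict_space)
  have B_sub: "B \<subseteq> S2" using sets.sets_into_space[OF B] by (simp add: space_restrict_space)
  define D where "D = distr (density \<mu> (\<lambda>p. ennreal (indicator B (snd p)))) (borel_on S1) fst"
  have "emeasure D C = emeasure \<mu> (C \<times> B)" if C[measurable]: "C \<in> sets (borel_on S1)" for C
  proof -
    have C_sub: "C \<subseteq> S1" using sets.sets_into_space[OF C] by (simp add: space_restrict_space)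
    have "emeasure D C = (\<integral>\<^sup>+p. ennreal (indicator B (snd p)) * indicator (fst -` C \<inter> space \<mu>) p \<partial>\<mu>)"
      unfolding D_def by (subst emeasure_distr) (auto intro!: emeasure_density)
    also have "\<dots> = (\<integral>\<^sup>+p. indicator ((fst -` C \<inter> space \<mu>) \<inter> (snd -` B \<inter> space \<mu>)) p \<partial>\<mu>)"
      by (intro nn_integral_cong) (auto split: split_indicator)
    also have "\<dots> = emeasure \<mu> ((fst -` C \<inter> space \<mu>) \<inter> (snd -` B \<inter> space \<mu>))"
      by (rule nn_integral_indicator) measurable
    also have "(fst -` C \<inter> space \<mu>) \<inter> (snd -` B \<inter> space \<mu>) = C \<times> B"
      using B_sub C_sub by (auto simp: space)
    finally show ?thesis .
  qed
  moreover have S1: "space (borel_on S1) = S1" by (simp add: space_restrict_space)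
  moreover have "sigma_sets S1 (sets (borel_on S1)) = sets (borel_on S1)" "sets (borel_on S1) \<subseteq> Pow S1"
    using sets.sigma_sets_eq[of "borel_on S1"] sets.space_closed[of "borel_on S1"] unfolding S1 by auto
  ultimately have "slice_measure S1 \<mu> B = measure_of S1 (sets (borel_on S1)) (emeasure D)"
    unfolding slice_measure_def by (intro measure_of_eq) auto
  also have "\<dots> = measure_of (space D) (sets D) (emeasure D)" by (simp add: D_def S1)
  also have "\<dots> = D" by (rule measure_of_of_measure)
  finally have "(\<integral>w. f w \<partial>slice_measure S1 \<mu> B) =
      (\<integral>p. f (fst p) \<partial>density \<mu> (\<lambda>p. ennreal (indicator B (snd p))))"
    unfolding D_def by (simp add: integral_distr)
  also have "\<dots> = (\<integral>p. indicator B (snd p) * f (fst p) \<partial>\<mu>)"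
    by (subst integral_density) auto
  finally show ?thesis by (simp add: mult.commute)
qed

lemma semi_uniform_Feller_kernelD:
  assumes "semi_uniform_Feller S1 S2 S3 \<Psi>" "s \<in> S3"
  shows "prob_space (\<Psi> s)" "sets (\<Psi> s) = sets (borel_on (S1 \<times> S2))"
proof -
  have "\<Psi> s \<in> space (prob_algebra (borel_on (S1 \<times> S2)))"
    using assms unfolding semi_uniform_Feller_def
    by (intro measurable_space[of \<Psi> "borel_on S3"]) (simp_all add: space_restrict_space)
  then show "prob_space (\<Psi> s)" "sets (\<Psi> s) = sets (borel_on (S1 \<times> S2))"
    by (auto simp: space_prob_algebra)
qed

text \<open>Each single \<open>B\<close> is dominated by the supremum in the Feller condition. Real
  and \<open>ennreal\<close> integrals can be exchanged because the integrand is bounded and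
  nonnegative.\<close>

lemma semi_uniform_Feller_tendsto_product:
  fixes S1 :: "'w::topological_space set" and S2 :: "'y::topological_space set" and f :: "'w \<Rightarrow> real"
  assumes \<Psi>: "semi_uniform_Feller S1 S2 S3 \<Psi>"
    and \<sigma>: "\<And>n. \<sigma> n \<in> S3" "s \<in> S3" "\<sigma> \<longlonglongrightarrow> s"
    and f: "continuous_on S1 f" "\<And>w. w \<in> S1 \<Longrightarrow> 0 \<le> f w" "\<And>w. w \<in> S1 \<Longrightarrow> f w \<le> M"
    and B: "B \<in> sets (borel_on S2)"
  shows "(\<lambda>n. \<integral>\<^sup>+p. ennreal (f (fst p)) * indicator B (snd p) \<partial>\<Psi> (\<sigma> n)) \<longlonglongrightarrow>
    (\<integral>\<^sup>+p. ennreal (f (fst p)) * indicator B (snd p) \<partial>\<Psi> s)"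
proof -
  have fm: "f \<in> borel_measurable (borel_on S1)"
    using f(1) by (rule borel_measurable_continuous_on_restrict)
  have nonneg: "0 \<le> f (fst p) * indicator C (snd p)" "f (fst p) * indicator C (snd p) \<le> max 0 M"
    if "p \<in> S1 \<times> S2" for p C
    using that f(2)[of "fst p"] f(3)[of "fst p"] by (auto split: split_indicator)
  define I where "I C t = (\<integral>p. f (fst p) * indicator C (snd p) \<partial>\<Psi> t)" for C t
  have *: "integrable (\<Psi> t) (\<lambda>p. f (fst p) * indicator C (snd p))"
       "0 \<le> I C t" "I C t \<le> max 0 M" "I C t = (\<integral>w. f w \<partial>slice_measure S1 (\<Psi> t) C)"
    if t: "t \<in> S3" and C: "C \<in> sets (borel_on S2)" for t C
  proof -
    note k = semi_uniform_Feller_kernelD[OF \<Psi> t]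
    interpret prob_space "\<Psi> t" by fact
    note [measurable_cong] = k(2)
    have [measurable]: "fst \<in> \<Psi> t \<rightarrow>\<^sub>M borel_on S1" "snd \<in> \<Psi> t \<rightarrow>\<^sub>M borel_on S2"
      using measurable_fst_borel_on[of S1 S2] measurable_snd_borel_on[of S1 S2] by simp_all
    note C[measurable] fm[measurable]
    have space: "space (\<Psi> t) = S1 \<times> S2"
      using sets_eq_imp_space_eq[OF k(2)] by (simp add: space_restrict_space)
    show int: "integrable (\<Psi> t) (\<lambda>p. f (fst p) * indicator C (snd p))"
    proof (rule integrable_const_bound[where B="max 0 M"])
      show "AE p in \<Psi> t. norm (f (fst p) * indicator C (snd p)) \<le> max 0 M"
        using nonneg[of _ C] by (intro AE_I2) (auto simp: space)
    qed measurable
    show "0 \<le> I C t" unfolding I_def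
      using nonneg(1) by (intro integral_nonneg_AE AE_I2) (auto simp: space)
    show "I C t \<le> max 0 M" unfolding I_def
      using int nonneg(2) by (intro integral_le_const AE_I2) (auto simp: space)
    show "I C t = (\<integral>w. f w \<partial>slice_measure S1 (\<Psi> t) C)"
      unfolding I_def by (rule integral_slice_measure[symmetric, OF k(2) C fm])
  qed
  have eq: "(\<integral>\<^sup>+p. ennreal (f (fst p)) * indicator B (snd p) \<partial>\<Psi> t) = ennreal (I B t)"
    if t: "t \<in> S3" for t
  proof -
    have space: "space (\<Psi> t) = S1 \<times> S2"
      using sets_eq_imp_space_eq[OF semi_uniform_Feller_kernelD(2)[OF \<Psi> t]]
      by (simp add: space_restrict_space)
    have "(\<integral>\<^sup>+p. ennreal (f (fst p)) * indicator B (snd p) \<partial>\<Psi> t) =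
        (\<integral>\<^sup>+p. ennreal (f (fst p) * indicator B (snd p)) \<partial>\<Psi> t)"
      by (intro nn_integral_cong) (auto split: split_indicator)
    also have "\<dots> = ennreal (I B t)"
      unfolding I_def using nonneg(1) by (intro nn_integral_eq_integral *(1) t B AE_I2) (auto simp: space)
    finally show ?thesis .
  qed
  define d where "d n C = \<bar>(\<integral>w. f w \<partial>slice_measure S1 (\<Psi> (\<sigma> n)) C) - (\<integral>w. f w \<partial>slice_measure S1 (\<Psi> s) C)\<bar>"
    for n C
  have "bounded (f ` S1)"
    unfolding bounded_iff using f(2,3) by (intro exI[of _ M]) auto
  with \<Psi> f(1) \<sigma> have lim: "(\<lambda>n. SUP C\<in>sets (borel_on S2). d n C) \<longlonglongrightarrow> 0"
    unfolding semi_uniform_Feller_def d_def by blast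
  have dI: "d n C = \<bar>I C (\<sigma> n) - I C s\<bar>" if "C \<in> sets (borel_on S2)" for n C
    unfolding d_def using *(4)[OF \<sigma>(1)[of n] that] *(4)[OF \<sigma>(2) that] by simp
  have le: "\<bar>I B (\<sigma> n) - I B s\<bar> \<le> (SUP C\<in>sets (borel_on S2). d n C)" for n
  proof -
    \<comment> \<open>A supremum of reals bounds its members only if the family is bounded
      above.\<close>
    have "d n C \<le> max 0 M" if "C \<in> sets (borel_on S2)" for C
      using *(2,3)[OF \<sigma>(1)[of n] that] *(2,3)[OF \<sigma>(2) that] dI[OF that, of n] by linarith
    then have "bdd_above (d n ` sets (borel_on S2))" by (auto intro!: bdd_aboveI)
    from cSUP_upper[OF B this] dI[OF B] show ?thesis by simp
  qed
  have "(\<lambda>n. I B (\<sigma> n) - I B s) \<longlonglongrightarrow> 0"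
    by (rule Lim_null_comparison[OF _ lim]) (use le in auto)
  then have "(\<lambda>n. I B (\<sigma> n)) \<longlonglongrightarrow> I B s" by (rule LIM_zero_cancel)
  then have "(\<lambda>n. ennreal (I B (\<sigma> n))) \<longlonglongrightarrow> ennreal (I B s)" by (rule tendsto_ennrealI)
  then show ?thesis using eq \<sigma>(1,2) by simp
qed

section \<open>Lower semicontinuity on a subset\<close>

text \<open>\<open>Liminf\<close> at \<open>s\<close> ignores the value at \<open>s\<close> itself;
  \<open>r < f s\<close> supplies it.\<close>

lemma lsc_on_superlevel_open:
  assumes "lsc_on S f" "s \<in> S" "r < f s"
  shows "\<exists>U. open U \<and> s \<in> U \<and> (\<forall>t\<in>U \<inter> S. r < f t)"
proof -
  have "eventually (\<lambda>t. r < f t) (at s within S)"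
    using assms unfolding lsc_on_def le_Liminf_iff by simp
  then obtain U where "open U" "s \<in> U" "\<forall>t\<in>U. t \<noteq> s \<longrightarrow> t \<in> S \<longrightarrow> r < f t"
    unfolding eventually_at_topological by blast
  with assms(3) show ?thesis by (intro exI[of _ U]) auto
qed

text \<open>A failure at \<open>s\<close> yields a sequence staying at or below some
  \<open>l < f s\<close>. Such an \<open>l\<close> is finite, so only finite levels have to be
  tested, the ones at which compactness of sublevel sets is available.\<close>

lemma lsc_onI_sequentially:
  fixes f :: "'a::first_countable_topology \<Rightarrow> ennreal"
  assumes "\<And>s \<sigma> l. s \<in> S \<Longrightarrow> (\<And>n. \<sigma> n \<in> S) \<Longrightarrow> \<sigma> \<longlonglongrightarrow> s \<Longrightarrow> l < \<infinity> \<Longrightarrow> (\<And>n. f (\<sigma> n) \<le> l) \<Longrightarrow> f s \<le> l"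
  shows "lsc_on S f"
  unfolding lsc_on_def le_Liminf_iff
proof (intro ballI allI impI sequentially_imp_eventually_within)
  fix s l \<sigma> assume s: "s \<in> S" and l: "l < f s" and \<sigma>: "(\<forall>n. \<sigma> n \<in> S \<and> \<sigma> n \<noteq> s) \<and> \<sigma> \<longlonglongrightarrow> s"
  show "\<forall>\<^sub>F n in sequentially. l < f (\<sigma> n)"
  proof (rule ccontr)
    assume "\<not> ?thesis"
    from not_eventually_sequentiallyD[OF this] obtain r :: "nat \<Rightarrow> nat" where
      "strict_mono r" "\<forall>n. \<not> l < f (\<sigma> (r n))" by (elim exE conjE)
    then have r: "strict_mono r" "\<And>n. f (\<sigma> (r n)) \<le> l" by (simp_all add: not_less)
    have "f s \<le> l"
    proof (rule assms[of s "\<sigma> \<circ> r"])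
      show "(\<sigma> \<circ> r) \<longlonglongrightarrow> s" using \<sigma> r(1) by (intro LIMSEQ_subseq_LIMSEQ) auto
      show "l < \<infinity>" using l by (metis infinity_ennreal_def less_le_trans order.strict_trans2 top_greatest)
    qed (use s \<sigma> r in auto)
    with l show False by simp
  qed
qed

section \<open>Approximation from below by products\<close>

text \<open>For open \<open>U\<close> these continuous functions increase with \<open>j\<close> to
  the indicator of \<open>U\<close> and reach 1 at every point of it. \<open>UNIV\<close> is
  separate because \<open>infdist\<close> to the empty set is 0.\<close>

definition open_approx :: "'a::metric_space set \<Rightarrow> nat \<Rightarrow> 'a \<Rightarrow> real" where
  "open_approx U j w = (if U = UNIV then 1 else min 1 (real j * infdist w (- U)))"

lemma continuous_open_approx: "continuous_on S (open_approx U j)"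
  unfolding open_approx_def by (cases "U = UNIV") (auto intro!: continuous_intros)

lemma open_approx_bounds: "0 \<le> open_approx U j w" "open_approx U j w \<le> 1"
  by (auto simp: open_approx_def infdist_nonneg)

lemma open_approx_outside: "w \<notin> U \<Longrightarrow> open_approx U j w = 0"
  by (auto simp: open_approx_def)

lemma open_approx_inside:
  assumes "open U" "w \<in> U"
  shows "\<exists>j. open_approx U j w = 1"
proof (cases "U = UNIV")
  case False
  then have "infdist w (- U) \<noteq> 0"
    using assms in_closed_iff_infdist_zero[of "- U" w] by (auto simp: closed_def)
  then have pos: "0 < infdist w (- U)" using infdist_nonneg[of w "- U"] by linarith
  obtain j where "1 / infdist w (- U) < real j" using reals_Archimedean2 by blast
  with pos have "1 \<le> real j * infdist w (- U)" by (simp add: field_simps)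
  then show ?thesis by (intro exI[of _ j]) (simp add: open_approx_def)
qed (simp add: open_approx_def)

text \<open>Approximating from below by Lipschitz functions in \<open>w\<close> would not do: the infimal convolution of a
  function in \<open>LW\<close> need not be Borel in \<open>y\<close>.\<close>

lemma LW_as_SUP_products:
  fixes XW :: "'w::{complete_space, second_countable_topology} set"
    and XY :: "'y::{complete_space, second_countable_topology} set"
  assumes XW: "XW \<in> sets borel" and XY: "XY \<in> sets borel" and u: "u \<in> LW XW XY"
  shows "\<exists>(f :: nat \<Rightarrow> 'w \<Rightarrow> real) M Z.
    (\<forall>m. continuous_on UNIV (f m) \<and> (\<forall>w. 0 \<le> f m w \<and> f m w \<le> M m) \<and> Z m \<in> sets borel) \<and>
    (\<forall>w\<in>XW. \<forall>y\<in>XY. u (w, y) = (SUP m. ennreal (f m w) * indicator (Z m) y))"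
proof -
  define r :: "nat \<Rightarrow> real" where "r i = max 0 (real_of_rat (from_nat i))" for i
  \<comment> \<open>The coordinates are swapped: \<open>y\<close> becomes the base variable and
    \<open>w\<close> the one with open sections.\<close>
  define G where "G i = {(y, w). (w, y) \<in> XW \<times> XY \<and> ennreal (r i) < u (w, y)}" for i
  have XYW: "XW \<times> XY \<in> sets borel" "XY \<times> XW \<in> sets borel" using XW XY by (auto intro: borel_Times)
  have swap: "(\<lambda>(y, w). (w, y)) \<in> borel_measurable (borel :: ('y \<times> 'w) measure)"
    unfolding split_beta by (intro borel_measurable_continuous_onI continuous_intros)
  have G_sets: "G i \<in> sets borel" for i
  proof -
    have "u \<in> borel_measurable (borel_on (XW \<times> XY))" using u by (simp add: LW_def)
    from measurable_sets[OF this, of "{ennreal (r i)<..}"]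
    have "u -` {ennreal (r i)<..} \<inter> (XW \<times> XY) \<in> sets (borel_on (XW \<times> XY))"
      by (simp add: space_restrict_space)
    then have "u -` {ennreal (r i)<..} \<inter> (XW \<times> XY) \<in> sets borel"
      by (simp add: sets_borel_on_iff[OF XYW(1)])
    from measurable_sets[OF swap this]
    have "(\<lambda>(y, w). (w, y)) -` (u -` {ennreal (r i)<..} \<inter> (XW \<times> XY)) \<in> sets (borel :: ('y \<times> 'w) measure)"
      by simp
    also have "(\<lambda>(y, w). (w, y)) -` (u -` {ennreal (r i)<..} \<inter> (XW \<times> XY)) = G i"
      by (auto simp: G_def)
    finally show ?thesis .
  qed
  \<comment> \<open>The sections are open relative to \<open>XW\<close> only, so rectangles have to
    avoid just the rest of \<open>XY \<times> XW\<close>; where they leave this product is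
    immaterial.\<close>
  define P where "P i = XY \<times> XW - G i" for i
  have "\<exists>(Z :: nat \<Rightarrow> 'y set) (U :: nat \<Rightarrow> 'w set).
    (\<forall>n. Z n \<in> sets borel \<and> open (U n) \<and> (Z n \<times> U n) \<inter> P i = {}) \<and> G i \<subseteq> (\<Union>n. Z n \<times> U n)" for i
  proof (rule open_sections_cover[OF G_sets])
    show "analytic (P i)" unfolding P_def by (intro borel_imp_analytic sets.Diff XYW G_sets)
    fix y w assume yw: "(y, w) \<in> G i"
    then have "lsc_on XW (\<lambda>w. u (w, y))" using u by (auto simp: LW_def G_def)
    with yw obtain U where "open U" "w \<in> U" "\<forall>t\<in>U \<inter> XW. ennreal (r i) < u (t, y)"
      using lsc_on_superlevel_open[of XW "\<lambda>w. u (w, y)" w "ennreal (r i)"] by (auto simp: G_def)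
    then show "\<exists>U. open U \<and> w \<in> U \<and> (\<forall>b\<in>U. (y, b) \<notin> P i)"
      by (intro exI[of _ U]) (auto simp: P_def G_def)
  qed
  then obtain Z where "\<forall>i. \<exists>(U :: nat \<Rightarrow> 'w set). (\<forall>n. Z i n \<in> sets borel \<and> open (U n) \<and>
      (Z i n \<times> U n) \<inter> P i = {}) \<and> G i \<subseteq> (\<Union>n. Z i n \<times> U n)"
    using choice[of "\<lambda>i (Z :: nat \<Rightarrow> 'y set). \<exists>(U :: nat \<Rightarrow> 'w set). (\<forall>n. Z n \<in> sets borel \<and> open (U n) \<and>
      (Z n \<times> U n) \<inter> P i = {}) \<and> G i \<subseteq> (\<Union>n. Z n \<times> U n)"] by blast
  from choice[OF this] obtain U where
      "\<forall>i. (\<forall>n. Z i n \<in> sets borel \<and> open (U i n :: 'w set) \<and> (Z i n \<times> U i n) \<inter> P i = {}) \<and>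
        G i \<subseteq> (\<Union>n. Z i n \<times> U i n)"
    by (elim exE)
  then have ZU: "\<And>i n. Z i n \<in> sets borel" "\<And>i n. open (U i n)"
      "\<And>i n. (Z i n \<times> U i n) \<inter> P i = {}" "\<And>i. G i \<subseteq> (\<Union>n. Z i n \<times> U i n)"
    by simp_all
  \<comment> \<open>One index for a triple: threshold, rectangle, and order of approximation of its
    open side.\<close>
  define code where "code m = (fst (prod_decode m), prod_decode (snd (prod_decode m)))" for m
  define f where "f m w = (case code m of (i, n, j) \<Rightarrow> r i * open_approx (U i n) j w)" for m w
  define Z' where "Z' m = (case code m of (i, n, j) \<Rightarrow> Z i n)" for m
  have code: "code (prod_encode (i, prod_encode (n, j))) = (i, n, j)" for i n j
    by (simp add: code_def)
  have r: "0 \<le> r i" for i by (simp add: r_def)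
  show ?thesis
  proof (intro exI conjI allI ballI)
    fix m
    obtain i n j where m: "code m = (i, n, j)" by (metis surj_pair)
    show "continuous_on UNIV (f m)"
      unfolding f_def m by (auto intro!: continuous_intros continuous_open_approx)
    show "Z' m \<in> sets borel" by (simp add: Z'_def m ZU)
    show "0 \<le> f m w" "f m w \<le> r (fst (code m))" for w
      using open_approx_bounds[of "U i n" j w] r[of i]
      by (auto simp: f_def m intro: mult_nonneg_nonneg mult_left_le)
  next
    fix w y assume wy: "w \<in> XW" "y \<in> XY"
    show "u (w, y) = (SUP m. ennreal (f m w) * indicator (Z' m) y)"
    proof (rule antisym)
      show "u (w, y) \<le> (SUP m. ennreal (f m w) * indicator (Z' m) y)"
      proof (rule dense_le)
        fix t assume "t < u (w, y)"
        then obtain q :: rat where q: "t < real_of_rat q" "real_of_rat q < u (w, y)"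
          using ennreal_rat_dense by blast
        define i where "i = to_nat q"
        have ri: "ennreal (r i) = ennreal (real_of_rat q)"
          by (simp add: r_def i_def max_def ennreal_neg)
        with q wy have "(y, w) \<in> G i" by (simp add: G_def)
        with ZU(4)[of i] have "(y, w) \<in> (\<Union>n. Z i n \<times> U i n)" by (rule subsetD)
        then obtain n where n: "y \<in> Z i n" "w \<in> U i n" by auto
        from open_approx_inside[OF ZU(2) this(2)] obtain j where j: "open_approx (U i n) j w = 1" ..
        have "t \<le> ennreal (r i)" using q(1) ri by simp
        also have "\<dots> = ennreal (f (prod_encode (i, prod_encode (n, j))) w) *
            indicator (Z' (prod_encode (i, prod_encode (n, j)))) y"
          using n j by (simp add: f_def Z'_def code)
        also have "\<dots> \<le> (SUP m. ennreal (f m w) * indicator (Z' m) y)" by (rule SUP_upper) simp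
        finally show "t \<le> (SUP m. ennreal (f m w) * indicator (Z' m) y)" .
      qed
      show "(SUP m. ennreal (f m w) * indicator (Z' m) y) \<le> u (w, y)"
      proof (rule SUP_least)
        fix m
        obtain i n j where m: "code m = (i, n, j)" by (metis surj_pair)
        show "ennreal (f m w) * indicator (Z' m) y \<le> u (w, y)"
        proof (cases "y \<in> Z i n \<and> w \<in> U i n")
          case True
          with ZU(3)[of i n] wy have "ennreal (r i) < u (w, y)" by (auto simp: P_def G_def)
          moreover have "ennreal (f m w) \<le> ennreal (r i)"
            using open_approx_bounds[of "U i n" j w] r[of i]
            by (intro ennreal_leI) (auto simp: f_def m intro: mult_left_le)
          ultimately show ?thesis using True by (simp add: Z'_def m)
        next
          case False
          then show ?thesis by (auto simp: f_def Z'_def m open_approx_outside)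
        qed
      qed
    qed
  qed
qed

text \<open>The arbitrary \<open>\<phi>\<close> and \<open>B\<close> make the induction work: on \<open>B \<inter> Z m\<close> the next function is absorbed
  into \<open>\<phi>\<close>, on \<open>B - Z m\<close> it vanishes.\<close>

lemma semi_uniform_Feller_tendsto_max:
  fixes S1 :: "'w::topological_space set" and S2 :: "'y::topological_space set"
    and f :: "nat \<Rightarrow> 'w \<Rightarrow> real"
  assumes \<Psi>: "semi_uniform_Feller S1 S2 S3 \<Psi>"
    and \<sigma>: "\<And>n. \<sigma> n \<in> S3" "s \<in> S3" "\<sigma> \<longlonglongrightarrow> s"
    and f: "\<And>m. continuous_on S1 (f m)" "\<And>m w. 0 \<le> f m w" "\<And>m w. f m w \<le> M m"
    and Z: "\<And>m. Z m \<inter> S2 \<in> sets (borel_on S2)"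
    and g0: "\<And>p. g 0 p = 0"
    and gSuc: "\<And>m p. g (Suc m) p = max (ennreal (f m (fst p)) * indicator (Z m) (snd p)) (g m p)"
    and \<phi>: "continuous_on S1 \<phi>" "\<And>w. 0 \<le> \<phi> w" "\<And>w. \<phi> w \<le> K"
    and B: "B \<in> sets (borel_on S2)"
  shows "(\<lambda>n. \<integral>\<^sup>+p. max (ennreal (\<phi> (fst p))) (g m p) * indicator B (snd p) \<partial>\<Psi> (\<sigma> n)) \<longlonglongrightarrow>
    (\<integral>\<^sup>+p. max (ennreal (\<phi> (fst p))) (g m p) * indicator B (snd p) \<partial>\<Psi> s)"
  using \<phi> B
proof (induction m arbitrary: \<phi> K B)
  case 0
  then show ?case
    using semi_uniform_Feller_tendsto_product[OF \<Psi> \<sigma>, of \<phi> K B] by (simp add: g0 max_absorb1)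
next
  case (Suc m)
  define \<psi> where "\<psi> w = max (\<phi> w) (f m w)" for w
  define B1 B2 where "B1 = B \<inter> Z m" and "B2 = B - Z m"
  have B_sub: "B \<subseteq> S2" using sets.sets_into_space[OF Suc.prems(4)] by (simp add: space_restrict_space)
  have "B1 = B \<inter> (Z m \<inter> S2)" "B2 = B - (Z m \<inter> S2)" using B_sub by (auto simp: B1_def B2_def)
  then have B12: "B1 \<in> sets (borel_on S2)" "B2 \<in> sets (borel_on S2)"
    using Suc.prems(4) Z[of m] by auto
  define F where "F p = max (ennreal (\<psi> (fst p))) (g m p) * indicator B1 (snd p)" for p
  define G where "G p = max (ennreal (\<phi> (fst p))) (g m p) * indicator B2 (snd p)" for p
  have "ennreal (\<psi> w) = max (ennreal (\<phi> w)) (ennreal (f m w))" for w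
    unfolding \<psi>_def by (rule max_of_mono[symmetric]) (auto intro: monoI ennreal_leI)
  then have split: "max (ennreal (\<phi> (fst p))) (g (Suc m) p) * indicator B (snd p) = F p + G p" for p
    by (cases "snd p \<in> Z m")
       (simp_all add: F_def G_def B1_def B2_def gSuc max.assoc max_absorb2 split: split_indicator)
  have meas: "F \<in> borel_measurable (\<Psi> t)" "G \<in> borel_measurable (\<Psi> t)" if t: "t \<in> S3" for t
  proof -
    note [measurable_cong] = semi_uniform_Feller_kernelD(2)[OF \<Psi> t]
    have [measurable]: "fst \<in> \<Psi> t \<rightarrow>\<^sub>M borel_on S1" "snd \<in> \<Psi> t \<rightarrow>\<^sub>M borel_on S2"
      using measurable_fst_borel_on[of S1 S2] measurable_snd_borel_on[of S1 S2] by simp_all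
    have space: "space (\<Psi> t) = S1 \<times> S2"
      using sets_eq_imp_space_eq[OF semi_uniform_Feller_kernelD(2)[OF \<Psi> t]]
      by (simp add: space_restrict_space)
    note B12[measurable]
    have [measurable]: "f k \<in> borel_measurable (borel_on S1)" "\<phi> \<in> borel_measurable (borel_on S1)" for k
      using f(1) Suc.prems(1) by (auto intro: borel_measurable_continuous_on_restrict)
    have [measurable]: "g k \<in> borel_measurable (\<Psi> t)" for k
    proof (induction k)
      case 0
      have "g 0 = (\<lambda>_. 0)" using g0 by auto
      then show ?case by simp
    next
      case (Suc k)
      \<comment> \<open>Only the trace of \<open>Z k\<close> on \<open>S2\<close> is known to be
        measurable; on the space of \<open>\<Psi> t\<close> its indicator is the same.\<close>
      have "(\<lambda>p. max (ennreal (f k (fst p)) * indicator (Z k \<inter> S2) (snd p)) (g k p)) \<in> borel_measurable (\<Psi> t)"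
        using Suc Z[of k] by measurable
      also have "?this \<longleftrightarrow> g (Suc k) \<in> borel_measurable (\<Psi> t)"
        by (intro measurable_cong) (auto simp: gSuc space split: split_indicator)
      finally show ?case .
    qed
    show "F \<in> borel_measurable (\<Psi> t)" "G \<in> borel_measurable (\<Psi> t)"
      unfolding F_def G_def \<psi>_def by measurable
  qed
  have "(\<lambda>n. (\<integral>\<^sup>+p. F p \<partial>\<Psi> (\<sigma> n)) + (\<integral>\<^sup>+p. G p \<partial>\<Psi> (\<sigma> n))) \<longlonglongrightarrow>
      (\<integral>\<^sup>+p. F p \<partial>\<Psi> s) + (\<integral>\<^sup>+p. G p \<partial>\<Psi> s)"
  proof (rule tendsto_add)
    show "(\<lambda>n. \<integral>\<^sup>+p. F p \<partial>\<Psi> (\<sigma> n)) \<longlonglongrightarrow> (\<integral>\<^sup>+p. F p \<partial>\<Psi> s)"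
      unfolding F_def
    proof (rule Suc.IH[where K = "max K (M m)"])
      show "continuous_on S1 \<psi>" unfolding \<psi>_def by (intro continuous_on_max Suc.prems f)
      show "0 \<le> \<psi> w" "\<psi> w \<le> max K (M m)" for w
        using Suc.prems(2,3)[of w] f(3)[of m w] by (auto simp: \<psi>_def)
    qed fact
    show "(\<lambda>n. \<integral>\<^sup>+p. G p \<partial>\<Psi> (\<sigma> n)) \<longlonglongrightarrow> (\<integral>\<^sup>+p. G p \<partial>\<Psi> s)"
      unfolding G_def using Suc.prems B12 by (intro Suc.IH[where K = K])
  qed
  then show ?case
    unfolding split using meas \<sigma>(1,2) by (simp add: nn_integral_add)
qed

text \<open>The running maxima \<open>g m\<close> increase to \<open>u\<close> and have convergent
  integrals. Each limit is below the lower limit for \<open>u\<close>, and monotone convergence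
  under the limiting kernel takes the supremum over \<open>m\<close>.\<close>

theorem semi_uniform_Feller_lsc_integral:
  fixes XW :: "'w::{complete_space, second_countable_topology} set"
    and XY :: "'y::{complete_space, second_countable_topology} set"
  assumes XW: "XW \<in> sets borel" and XY: "XY \<in> sets borel"
    and \<Psi>: "semi_uniform_Feller XW XY S3 \<Psi>" and u: "u \<in> LW XW XY"
    and \<sigma>: "\<And>n. \<sigma> n \<in> S3" "s \<in> S3" "\<sigma> \<longlonglongrightarrow> s"
  shows "(\<integral>\<^sup>+p. u p \<partial>\<Psi> s) \<le> liminf (\<lambda>n. \<integral>\<^sup>+p. u p \<partial>\<Psi> (\<sigma> n))"
proof -
  obtain f :: "nat \<Rightarrow> 'w \<Rightarrow> real" and M Z where
    fZ: "\<forall>m. continuous_on UNIV (f m) \<and> (\<forall>w. 0 \<le> f m w \<and> f m w \<le> M m) \<and> Z m \<in> sets borel"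
    and u_eq: "\<forall>w\<in>XW. \<forall>y\<in>XY. u (w, y) = (SUP m. ennreal (f m w) * indicator (Z m) y)"
    using LW_as_SUP_products[OF XW XY u] by blast
  define g :: "nat \<Rightarrow> 'w \<times> 'y \<Rightarrow> ennreal" where
    "g = rec_nat (\<lambda>_. 0) (\<lambda>m h p. max (ennreal (f m (fst p)) * indicator (Z m) (snd p)) (h p))"
  have g0: "g 0 p = 0"
    and gSuc: "g (Suc m) p = max (ennreal (f m (fst p)) * indicator (Z m) (snd p)) (g m p)" for m p
    by (auto simp: g_def)
  have inc: "incseq g"
    by (rule incseq_SucI) (simp add: le_fun_def gSuc)
  have space: "space (\<Psi> t) = XW \<times> XY" if "t \<in> S3" for t
    using sets_eq_imp_space_eq[OF semi_uniform_Feller_kernelD(2)[OF \<Psi> that]]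
    by (simp add: space_restrict_space)
  have u_SUP: "u p = (SUP m. g m p)" if "p \<in> XW \<times> XY" for p
  proof -
    obtain w y where wy: "p = (w, y)" by (cases p)
    with that have p: "p = (w, y)" "w \<in> XW" "y \<in> XY" by auto
    have "u p = (SUP m. ennreal (f m w) * indicator (Z m) y)" using u_eq p by auto
    also have "\<dots> = (SUP m. g m p)"
    proof (rule antisym)
      have "ennreal (f m w) * indicator (Z m) y \<le> g (Suc m) p" for m by (simp add: gSuc p)
      then show "(SUP m. ennreal (f m w) * indicator (Z m) y) \<le> (SUP m. g m p)"
        by (intro SUP_least) (blast intro: SUP_upper2)
      have "g m p \<le> (SUP m. ennreal (f m w) * indicator (Z m) y)" for m
      proof (induction m)
        case (Suc m)
        then show ?case by (auto simp: gSuc p intro: SUP_upper)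
      qed (simp add: g0)
      then show "(SUP m. g m p) \<le> (SUP m. ennreal (f m w) * indicator (Z m) y)"
        by (rule SUP_least)
    qed
    finally show ?thesis .
  qed
  have g_meas: "g m \<in> borel_measurable (\<Psi> s)" for m
  proof (induction m)
    case 0
    have "g 0 = (\<lambda>_. 0)" using g0 by auto
    then show ?case by simp
  next
    case (Suc m)
    have "sets (\<Psi> s) = sets (borel_on (XW \<times> XY))" by (rule semi_uniform_Feller_kernelD(2)[OF \<Psi> \<sigma>(2)])
    then have [measurable]: "fst \<in> \<Psi> s \<rightarrow>\<^sub>M borel" "snd \<in> \<Psi> s \<rightarrow>\<^sub>M borel"
      using measurable_fst_borel_on[of XW XY] measurable_snd_borel_on[of XW XY]
      by (simp_all add: measurable_restrict_space2_iff cong: measurable_cong_sets)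
    have [measurable]: "f m \<in> borel_measurable borel" "Z m \<in> sets borel"
      using fZ by (auto intro: borel_measurable_continuous_onI)
    have "g (Suc m) = (\<lambda>p. max (ennreal (f m (fst p)) * indicator (Z m) (snd p)) (g m p))"
      using gSuc by auto
    then show ?case using Suc by simp
  qed
  have lim: "(\<lambda>n. \<integral>\<^sup>+p. g m p \<partial>\<Psi> (\<sigma> n)) \<longlonglongrightarrow> (\<integral>\<^sup>+p. g m p \<partial>\<Psi> s)" for m
  proof -
    have "(\<lambda>n. \<integral>\<^sup>+p. max (ennreal ((\<lambda>_. 0) (fst p))) (g m p) * indicator XY (snd p) \<partial>\<Psi> (\<sigma> n)) \<longlonglongrightarrow>
      (\<integral>\<^sup>+p. max (ennreal ((\<lambda>_. 0) (fst p))) (g m p) * indicator XY (snd p) \<partial>\<Psi> s)"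
    proof (rule semi_uniform_Feller_tendsto_max[OF \<Psi> \<sigma>, where f=f and Z=Z and g=g and M=M and K=0])
      show "continuous_on XW (f m)" for m using fZ continuous_on_subset by blast
      show "Z m \<inter> XY \<in> sets (borel_on XY)" for m using fZ XY by (auto simp: sets_borel_on_iff)
      show "XY \<in> sets (borel_on XY)" using XY by (auto simp: sets_borel_on_iff)
    qed (use fZ g0 gSuc in auto)
    moreover have "(\<integral>\<^sup>+p. max (ennreal ((\<lambda>_. 0) (fst p))) (g m p) * indicator XY (snd p) \<partial>\<Psi> t) =
        (\<integral>\<^sup>+p. g m p \<partial>\<Psi> t)" if "t \<in> S3" for t
      by (intro nn_integral_cong) (auto simp: space[OF that])
    ultimately show ?thesis using \<sigma>(1,2) by simp
  qed
  have "(\<integral>\<^sup>+p. u p \<partial>\<Psi> s) = (\<integral>\<^sup>+p. (SUP m. g m p) \<partial>\<Psi> s)"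
    by (intro nn_integral_cong u_SUP) (simp add: space[OF \<sigma>(2)])
  also have "\<dots> = (SUP m. \<integral>\<^sup>+p. g m p \<partial>\<Psi> s)"
    by (intro nn_integral_monotone_convergence_SUP inc g_meas)
  also have "\<dots> \<le> liminf (\<lambda>n. \<integral>\<^sup>+p. u p \<partial>\<Psi> (\<sigma> n))"
  proof (rule SUP_least)
    fix m
    have "(\<integral>\<^sup>+p. g m p \<partial>\<Psi> s) = liminf (\<lambda>n. \<integral>\<^sup>+p. g m p \<partial>\<Psi> (\<sigma> n))"
      using lim_imp_Liminf[OF sequentially_bot lim] by simp
    also have "\<dots> \<le> liminf (\<lambda>n. \<integral>\<^sup>+p. u p \<partial>\<Psi> (\<sigma> n))"
      using u_SUP \<sigma>(1)
      by (intro Liminf_mono always_eventually allI nn_integral_mono)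
         (auto simp: space intro: SUP_upper)
    finally show "(\<integral>\<^sup>+p. g m p \<partial>\<Psi> s) \<le> liminf (\<lambda>n. \<integral>\<^sup>+p. u p \<partial>\<Psi> (\<sigma> n))" .
  qed
  finally show ?thesis .
qed

section \<open>The optimality operator\<close>

text \<open>The library has this only for Heine-Borel spaces.\<close>

lemma compact_convergent_sequence:
  assumes "\<sigma> \<longlonglongrightarrow> s"
  shows "compact (insert s (range \<sigma>))"
  unfolding compact_eq_Heine_Borel
proof (intro allI impI, elim conjE)
  fix C assume C: "\<forall>U\<in>C. open U" "insert s (range \<sigma>) \<subseteq> \<Union>C"
  then obtain U where U: "U \<in> C" "s \<in> U" by auto
  then have "eventually (\<lambda>n. \<sigma> n \<in> U) sequentially"
    using assms C(1) by (simp add: topological_tendstoD)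
  then obtain N where N: "\<And>n. n \<ge> N \<Longrightarrow> \<sigma> n \<in> U" by (auto simp: eventually_sequentially)
  have "\<forall>n. \<exists>T. T \<in> C \<and> \<sigma> n \<in> T" using C(2) by auto
  then obtain T where T: "\<And>n. T n \<in> C" "\<And>n. \<sigma> n \<in> T n" by metis
  have "\<sigma> n \<in> \<Union>(insert U (T ` {..<N}))" for n
    using N[of n] T(2)[of n] by (cases "n < N") auto
  then have "insert s (range \<sigma>) \<subseteq> \<Union>(insert U (T ` {..<N}))"
    using U(2) by auto
  then show "\<exists>C'\<subseteq>C. finite C' \<and> insert s (range \<sigma>) \<subseteq> \<Union>C'"
    using U(1) T(1) by (intro exI[of _ "insert U (T ` {..<N})"] conjI) auto
qed

lemma lsc_on_closed:
  assumes "lsc_on S f" "s \<in> S" "\<And>n::nat. \<sigma> n \<in> S" "\<sigma> \<longlonglongrightarrow> s" "\<And>n. f (\<sigma> n) \<le> l"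
  shows "f s \<le> l"
proof (rule ccontr)
  assume "\<not> f s \<le> l"
  then have "l < f s" by simp
  from lsc_on_superlevel_open[OF assms(1,2) this]
  obtain U where U: "open U" "s \<in> U" "\<forall>t\<in>U \<inter> S. l < f t" by blast
  then have "eventually (\<lambda>n. \<sigma> n \<in> U) sequentially" using assms(4) by (simp add: topological_tendstoD)
  then obtain n where "\<sigma> n \<in> U" by (auto simp: eventually_sequentially)
  with U(3) assms(3)[of n] have "l < f (\<sigma> n)" by simp
  with assms(5)[of n] show False by simp
qed

lemma LW_SUP:
  fixes u :: "nat \<Rightarrow> 'w::first_countable_topology \<times> 'y::topological_space \<Rightarrow> ennreal"
  assumes "\<And>t. u t \<in> LW XW XY"
  shows "(\<lambda>x. SUP t. u t x) \<in> LW XW XY"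
proof -
  have "(\<lambda>x. SUP t. u t x) \<in> borel_measurable (borel_on (XW \<times> XY))"
    using assms by (intro borel_measurable_SUP) (auto simp: LW_def)
  moreover have "lsc_on XW (\<lambda>w. SUP t. u t (w, y))" if y: "y \<in> XY" for y
  proof (rule lsc_onI_sequentially)
    fix w \<sigma> l assume *: "w \<in> XW" "\<And>n. \<sigma> n \<in> XW" "\<sigma> \<longlonglongrightarrow> w" "\<And>n. (SUP t. u t (\<sigma> n, y)) \<le> l"
    show "(SUP t. u t (w, y)) \<le> l"
    proof (rule SUP_least)
      fix t
      have "lsc_on XW (\<lambda>w. u t (w, y))" using assms y by (auto simp: LW_def)
      moreover have "u t (\<sigma> n, y) \<le> l" for n using *(4)[of n] by (simp add: SUP_le_iff)
      ultimately show "u t (w, y) \<le> l" using lsc_on_closed[of XW "\<lambda>w. u t (w, y)" w \<sigma> l] *(1-3) by blast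
    qed
  qed
  ultimately show ?thesis by (simp add: LW_def)
qed

definition minval ::
    "'a::topological_space set \<Rightarrow> ('x \<times> 'a \<Rightarrow> 'x measure) \<Rightarrow> ('x \<times> 'a \<Rightarrow> ennreal) \<Rightarrow> real \<Rightarrow> ('x \<Rightarrow> ennreal) \<Rightarrow> 'x \<Rightarrow> ennreal" where
  "minval A q c \<alpha> u x = (INF a\<in>A. eta q c \<alpha> u x a)"

primrec value_iteration ::
    "'a::topological_space set \<Rightarrow> ('x \<times> 'a \<Rightarrow> 'x measure) \<Rightarrow> ('x \<times> 'a \<Rightarrow> ennreal) \<Rightarrow> real \<Rightarrow> nat \<Rightarrow> 'x \<Rightarrow> ennreal" where
  "value_iteration A q c \<alpha> 0 = (\<lambda>_. 0)"
| "value_iteration A q c \<alpha> (Suc t) = minval A q c \<alpha> (value_iteration A q c \<alpha> t)"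

lemma enn2ereal_le_ereal_iff: "0 \<le> l \<Longrightarrow> enn2ereal x \<le> ereal l \<longleftrightarrow> x \<le> ennreal l"
  by (metis enn2ereal_ennreal less_eq_ennreal.rep_eq)

locale semi_uniform_Feller_mdp =
  fixes XW :: "'w::polish_space set" and XY :: "'y::polish_space set" and A :: "'a::polish_space set"
    and q :: "('w \<times> 'y) \<times> 'a \<Rightarrow> ('w \<times> 'y) measure" and c :: "('w \<times> 'y) \<times> 'a \<Rightarrow> ennreal" and \<alpha> :: real
  assumes XW: "XW \<in> sets borel" and XY: "XY \<in> sets borel" and A: "A \<in> sets borel" "A \<noteq> {}"
    and q: "semi_uniform_Feller XW XY ((XW \<times> XY) \<times> A) q"
    and c: "MK_inf_compact XW XY A (\<lambda>(w, y, a). enn2ereal (c ((w, y), a)))"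
begin

abbreviation "X \<equiv> XW \<times> XY"
abbreviation "\<eta> \<equiv> eta q c \<alpha>"
abbreviation "\<nu> \<equiv> minval A q c \<alpha>"
abbreviation "V \<equiv> value_iteration A q c \<alpha>"

section \<open>Measurability and monotone limits of the one-step cost\<close>

lemma X_sets: "X \<in> sets borel" and XA_sets: "X \<times> A \<in> sets borel"
  using XW XY A by (auto intro: borel_Times)

lemma space_q: "p \<in> X \<times> A \<Longrightarrow> space (q p) = X"
  using sets_eq_imp_space_eq[OF semi_uniform_Feller_kernelD(2)[OF q]] by (simp add: space_restrict_space)

lemma q_measurable: "q \<in> borel_on (X \<times> A) \<rightarrow>\<^sub>M prob_algebra (borel_on X)"
  using q by (simp add: semi_uniform_Feller_def)

lemma c_measurable: "c \<in> borel_measurable (borel_on (X \<times> A))"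
proof -
  have swap: "(\<lambda>((w, y), a). (w, y, a)) \<in> borel_on (X \<times> A) \<rightarrow>\<^sub>M borel_on (XW \<times> XY \<times> A)"
    unfolding split_beta
    by (rule measurable_restrict_space3)
       (auto intro!: borel_measurable_continuous_onI continuous_intros)
  have "(\<lambda>(w, y, a). enn2ereal (c ((w, y), a))) \<in> borel_measurable (borel_on (XW \<times> XY \<times> A))"
    using c by (simp add: MK_inf_compact_def)
  from measurable_compose[OF measurable_compose[OF swap this] measurable_e2ennreal]
  show ?thesis by (simp add: split_beta)
qed

lemma integral_measurable:
  "u \<in> borel_measurable (borel_on X) \<Longrightarrow> (\<lambda>p. \<integral>\<^sup>+z. u z \<partial>q p) \<in> borel_measurable (borel_on (X \<times> A))"
  by (rule measurable_compose[OF measurable_prob_algebraD[OF q_measurable]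
        nn_integral_measurable_subprob_algebra])

lemma eta_measurable:
  assumes "u \<in> borel_measurable (borel_on X)"
  shows "(\<lambda>p. \<eta> u (fst p) (snd p)) \<in> borel_measurable (borel_on (X \<times> A))"
  unfolding eta_def using c_measurable integral_measurable[OF assms] by simp

lemma eta_mono:
  assumes "x \<in> X" "a \<in> A" "\<And>z. z \<in> X \<Longrightarrow> u z \<le> u' z"
  shows "\<eta> u x a \<le> \<eta> u' x a"
  unfolding eta_def using assms
  by (intro add_left_mono mult_left_mono nn_integral_mono) (auto simp: space_q)

lemma eta_SUP:
  assumes "x \<in> X" "a \<in> A" "\<And>t. u t \<in> borel_measurable (borel_on X)"
    and inc: "\<And>z t. z \<in> X \<Longrightarrow> u t z \<le> u (Suc t) z"
  shows "\<eta> (\<lambda>z. SUP t. u t z) x a = (SUP t. \<eta> (u t) x a)"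
proof -
  have xa: "(x, a) \<in> X \<times> A" using assms by auto
  have "(\<integral>\<^sup>+z. (SUP t. u t z) \<partial>q (x, a)) = (SUP t. \<integral>\<^sup>+z. u t z \<partial>q (x, a))"
    using assms(3) inc semi_uniform_Feller_kernelD(2)[OF q xa]
    by (intro nn_integral_monotone_convergence_SUP_AE AE_I2)
       (auto simp: space_q[OF xa] cong: measurable_cong_sets)
  then show ?thesis
    unfolding eta_def by (simp add: SUP_mult_left_ennreal ennreal_SUP_add_right)
qed

section \<open>Compactness and semicontinuity in state and action\<close>

text \<open>The states together with their limit form a compact set, to which inf-compactness of the
  cost applies. Bounded costs therefore force the actions to accumulate, and the limit pair stays in
  the compact level set.\<close>

lemma c_inf_compact:
  assumes y: "y \<in> XY" and w: "\<And>n. \<sigma> n \<in> XW" "w \<in> XW" "\<sigma> \<longlonglongrightarrow> w"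
    and a: "\<And>n. a n \<in> A" and l: "l < \<infinity>" "\<And>n. c ((\<sigma> n, y), a n) \<le> l"
  shows "\<exists>b\<in>A. \<exists>r. strict_mono r \<and> (a \<circ> r) \<longlonglongrightarrow> b \<and> c ((w, y), b) \<le> l"
proof -
  define K where "K = insert w (range \<sigma>)"
  have K: "K \<subseteq> XW" "K \<noteq> {}" "compact K"
    using w compact_convergent_sequence[OF w(3)] by (auto simp: K_def)
  obtain l' where l': "l = ennreal l'" "0 \<le> l'" using l(1) by (cases l) auto
  define L where "L = {p \<in> K \<times> A. enn2ereal (c ((fst p, y), snd p)) \<le> ereal l'}"
  have "compact {p \<in> K \<times> A. (case p of (s1, s3) \<Rightarrow> case (s1, y, s3) of (w, y, a) \<Rightarrow> enn2ereal (c ((w, y), a))) \<le> ereal l'}"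
    using c y K unfolding MK_inf_compact_def K_inf_compact_def inf_compact_on_def by blast
  then have "compact L" by (simp add: L_def split_beta)
  then have "seq_compact L" by (simp add: compact_eq_seq_compact_metric)
  moreover have "\<forall>n. (\<sigma> n, a n) \<in> L"
    using a l(2) by (auto simp: L_def K_def enn2ereal_le_ereal_iff l')
  ultimately obtain p r where p: "p \<in> L" "strict_mono r" "((\<lambda>n. (\<sigma> n, a n)) \<circ> r) \<longlonglongrightarrow> p"
    using seq_compactE[of L "\<lambda>n. (\<sigma> n, a n)"] by blast
  from tendsto_fst[OF p(3)] tendsto_snd[OF p(3)]
  have lim: "(\<sigma> \<circ> r) \<longlonglongrightarrow> fst p" "(a \<circ> r) \<longlonglongrightarrow> snd p" by (simp_all add: o_def)
  have "fst p = w"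
    using LIMSEQ_unique[OF lim(1) LIMSEQ_subseq_LIMSEQ[OF w(3) p(2)]] .
  with p(1) have "snd p \<in> A" "c ((w, y), snd p) \<le> l"
    by (auto simp: L_def enn2ereal_le_ereal_iff l')
  with lim(2) p(2) show ?thesis by blast
qed

text \<open>Semicontinuity comes out of compactness: if the costs stay at or below \<open>l\<close>
  along a subsequence, a limit action with cost at most \<open>l\<close> exists, and it can only be
  \<open>b\<close>.\<close>

lemma c_lsc:
  assumes y: "y \<in> XY" and w: "\<And>n. \<sigma> n \<in> XW" "w \<in> XW" "\<sigma> \<longlonglongrightarrow> w"
    and a: "\<And>n. a n \<in> A" "b \<in> A" "a \<longlonglongrightarrow> b"
  shows "c ((w, y), b) \<le> liminf (\<lambda>n. c ((\<sigma> n, y), a n))"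
  unfolding le_Liminf_iff
proof (intro allI impI)
  fix l assume l: "l < c ((w, y), b)"
  show "\<forall>\<^sub>F n in sequentially. l < c ((\<sigma> n, y), a n)"
  proof (rule ccontr)
    assume "\<not> ?thesis"
    from not_eventually_sequentiallyD[OF this] obtain r :: "nat \<Rightarrow> nat" where
      "strict_mono r" "\<forall>n. \<not> l < c ((\<sigma> (r n), y), a (r n))" by (elim exE conjE)
    then have r: "strict_mono r" "\<And>n. c ((\<sigma> (r n), y), a (r n)) \<le> l" by (simp_all add: not_less)
    have "\<exists>b'\<in>A. \<exists>s. strict_mono s \<and> ((a \<circ> r) \<circ> s) \<longlonglongrightarrow> b' \<and> c ((w, y), b') \<le> l"
    proof (rule c_inf_compact[OF y])
      show "(\<sigma> \<circ> r) \<longlonglongrightarrow> w" by (rule LIMSEQ_subseq_LIMSEQ[OF w(3) r(1)])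
      show "l < \<infinity>" using l by (metis infinity_ennreal_def less_le_trans top_greatest)
    qed (use w a r in auto)
    then obtain b' s where s: "strict_mono s" "((a \<circ> r) \<circ> s) \<longlonglongrightarrow> b'" "c ((w, y), b') \<le> l" by blast
    have "((a \<circ> r) \<circ> s) \<longlonglongrightarrow> b" by (intro LIMSEQ_subseq_LIMSEQ a(3) r(1) s(1))
    with s(2) have "b' = b" by (rule LIMSEQ_unique)
    with s(3) l show False by simp
  qed
qed

text \<open>Lower limits are superadditive. The form with a fixed bound \<open>l\<close> is the one
  needed along subsequences of near-minimisers.\<close>

lemma eta_lsc:
  assumes u: "u \<in> LW XW XY"
    and y: "y \<in> XY" and w: "\<And>n. \<sigma> n \<in> XW" "w \<in> XW" "\<sigma> \<longlonglongrightarrow> w"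
    and a: "\<And>n. a n \<in> A" "b \<in> A" "a \<longlonglongrightarrow> b" and l: "\<And>n. \<eta> u (\<sigma> n, y) (a n) \<le> l"
  shows "\<eta> u (w, y) b \<le> l"
proof -
  let ?c = "\<lambda>n. c ((\<sigma> n, y), a n)" and ?I = "\<lambda>n. \<integral>\<^sup>+z. u z \<partial>q ((\<sigma> n, y), a n)"
  have "(\<integral>\<^sup>+z. u z \<partial>q ((w, y), b)) \<le> liminf ?I"
    by (rule semi_uniform_Feller_lsc_integral[OF XW XY q u])
       (use w a y in \<open>auto intro!: tendsto_Pair\<close>)
  moreover have "c ((w, y), b) \<le> liminf ?c" by (rule c_lsc[OF y w a])
  ultimately have "\<eta> u (w, y) b \<le> liminf ?c + ennreal \<alpha> * liminf ?I"
    unfolding eta_def by (intro add_mono mult_left_mono) auto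
  \<comment> \<open>Tail infima increase, so their suprema can be scaled and added termwise in
    \<open>ennreal\<close>.\<close>
  also have "\<dots> = (SUP n. INF m\<in>{n..}. ?c m) + (SUP n. ennreal \<alpha> * (INF m\<in>{n..}. ?I m))"
    by (simp add: liminf_SUP_INF SUP_mult_left_ennreal)
  also have "\<dots> = (SUP n. (INF m\<in>{n..}. ?c m) + ennreal \<alpha> * (INF m\<in>{n..}. ?I m))"
    by (intro ennreal_SUP_add[symmetric] incseq_SucI mult_left_mono INF_superset_mono) auto
  also have "\<dots> \<le> l"
  proof (rule SUP_least)
    fix n
    have "(INF m\<in>{n..}. ?c m) + ennreal \<alpha> * (INF m\<in>{n..}. ?I m) \<le> \<eta> u (\<sigma> n, y) (a n)"
      unfolding eta_def by (intro add_mono mult_left_mono INF_lower) auto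
    with l[of n] show "(INF m\<in>{n..}. ?c m) + ennreal \<alpha> * (INF m\<in>{n..}. ?I m) \<le> l" by (rule order_trans[rotated])
  qed
  finally show ?thesis .
qed

text \<open>The cost alone is below the bound, which already yields a convergent subsequence of
  actions; semicontinuity then takes care of the integral term.\<close>

lemma eta_inf_compact:
  assumes u: "u \<in> LW XW XY"
    and y: "y \<in> XY" and w: "\<And>n. \<sigma> n \<in> XW" "w \<in> XW" "\<sigma> \<longlonglongrightarrow> w"
    and a: "\<And>n. a n \<in> A" and l: "l < \<infinity>" "\<And>n. \<eta> u (\<sigma> n, y) (a n) \<le> l"
  shows "\<exists>b\<in>A. \<exists>r. strict_mono r \<and> (a \<circ> r) \<longlonglongrightarrow> b \<and> \<eta> u (w, y) b \<le> l"
proof -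
  have "c ((\<sigma> n, y), a n) \<le> l" for n
    using l(2)[of n] unfolding eta_def by (rule order_trans[rotated]) simp
  from c_inf_compact[OF y w a l(1) this] obtain b r where
    b: "b \<in> A" "strict_mono r" "(a \<circ> r) \<longlonglongrightarrow> b" by blast
  have "\<eta> u (w, y) b \<le> l"
  proof (rule eta_lsc[OF u y])
    show "(\<sigma> \<circ> r) \<longlonglongrightarrow> w" by (rule LIMSEQ_subseq_LIMSEQ[OF w(3) b(2)])
    show "(a \<circ> r) \<longlonglongrightarrow> b" by fact
  qed (use w a b l in auto)
  with b show ?thesis by blast
qed

lemma compact_eta_sublevel:
  assumes u: "u \<in> LW XW XY" and x: "x \<in> X" and l: "l < \<infinity>"
  shows "compact {a \<in> A. \<eta> u x a \<le> l}"
  unfolding compact_eq_seq_compact_metric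
proof (rule seq_compactI)
  fix a :: "nat \<Rightarrow> 'a" assume a: "\<forall>n. a n \<in> {a \<in> A. \<eta> u x a \<le> l}"
  obtain w y where wy: "x = (w, y)" by (cases x)
  have "\<exists>b\<in>A. \<exists>r. strict_mono r \<and> (a \<circ> r) \<longlonglongrightarrow> b \<and> \<eta> u (w, y) b \<le> l"
    using a x by (intro eta_inf_compact[OF u, of y "\<lambda>_. w"] l) (auto simp: wy)
  then show "\<exists>b\<in>{a \<in> A. \<eta> u x a \<le> l}. \<exists>r. strict_mono r \<and> (a \<circ> r) \<longlonglongrightarrow> b"
    by (auto simp: wy)
qed

section \<open>Minimisation over actions\<close>

lemma minval_lower: "a \<in> A \<Longrightarrow> \<nu> u x \<le> \<eta> u x a"
  unfolding minval_def by (rule INF_lower)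

text \<open>Near-minimisers with error 1/(n+1) accumulate as long as the infimum is finite;
  otherwise every action attains it.\<close>

lemma minval_attained:
  assumes u: "u \<in> LW XW XY" and x: "x \<in> X"
  shows "\<exists>a\<in>A. \<eta> u x a = \<nu> u x"
proof (cases "\<nu> u x = \<infinity>")
  case True
  obtain a where "a \<in> A" using A by blast
  with minval_lower[OF this, of u x] True show ?thesis by (intro bexI[of _ a]) (auto simp: top_unique)
next
  case False
  obtain w y where wy: "x = (w, y)" "w \<in> XW" "y \<in> XY" using x by (cases x) auto
  have "\<exists>a\<in>A. \<eta> u x a < \<nu> u x + ennreal (1 / Suc n)" for n
  proof -
    have "\<nu> u x + 0 < \<nu> u x + ennreal (1 / Suc n)"
      using False by (subst ennreal_add_left_cancel_less) (auto simp: top.not_eq_extremum)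
    then show ?thesis unfolding minval_def by (simp add: INF_less_iff)
  qed
  then obtain a where a: "\<And>n. a n \<in> A" "\<And>n. \<eta> u x (a n) < \<nu> u x + ennreal (1 / Suc n)" by metis
  have bound: "\<eta> u x (a n) \<le> \<nu> u x + ennreal (1 / Suc m)" if "m \<le> n" for m n
  proof -
    have "ennreal (1 / Suc n) \<le> ennreal (1 / Suc m)"
      using that by (intro ennreal_leI) (simp add: frac_le)
    then have "\<nu> u x + ennreal (1 / Suc n) \<le> \<nu> u x + ennreal (1 / Suc m)" by (rule add_left_mono)
    with less_imp_le[OF a(2)[of n]] show ?thesis by (rule order_trans)
  qed
  have "\<exists>b\<in>A. \<exists>r. strict_mono r \<and> (a \<circ> r) \<longlonglongrightarrow> b \<and> \<eta> u (w, y) b \<le> \<nu> u x + ennreal (1 / Suc 0)"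
    using bound[of 0] a(1) wy False
    by (intro eta_inf_compact[OF u, of y "\<lambda>_. w"]) (auto simp: ennreal_add_eq_top less_top[symmetric])
  then obtain b r where b: "b \<in> A" "strict_mono r" "(a \<circ> r) \<longlonglongrightarrow> b" by blast
  have "\<eta> u x b \<le> \<nu> u x + ennreal (1 / Suc m)" for m
    unfolding wy(1)
  proof (rule eta_lsc[OF u wy(3), where \<sigma>="\<lambda>_. w"])
    \<comment> \<open>The first \<open>m\<close> terms are skipped because the error bound 1/(m+1)
      is available from index \<open>m\<close> on.\<close>
    show "(\<lambda>n. (a \<circ> r) (n + m)) \<longlonglongrightarrow> b" using b(3) by (rule LIMSEQ_ignore_initial_segment)
    show "\<eta> u (w, y) ((a \<circ> r) (n + m)) \<le> \<nu> u (w, y) + ennreal (1 / Suc m)" for n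
    proof -
      have "m \<le> r (n + m)" using seq_suble[OF b(2), of "n + m"] by simp
      from bound[OF this] show ?thesis by (simp add: wy)
    qed
  qed (use wy a b in auto)
  then have "\<eta> u x b \<le> \<nu> u x + ennreal e" if e: "0 < e" for e
  proof -
    obtain m where "1 / Suc m < e" using nat_approx_posE[OF e] .
    then have "\<nu> u x + ennreal (1 / Suc m) \<le> \<nu> u x + ennreal e"
      by (intro add_left_mono ennreal_leI) simp
    with \<open>\<And>m. \<eta> u x b \<le> \<nu> u x + ennreal (1 / Suc m)\<close>[of m] show ?thesis by (rule order_trans)
  qed
  then have "\<eta> u x b \<le> \<nu> u x" by (rule ennreal_le_epsilon)
  then have "\<eta> u x b = \<nu> u x" by (rule antisym[OF _ minval_lower[OF b(1)]])
  with b(1) show ?thesis by blast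
qed

lemma minval_le_iff:
  assumes "u \<in> LW XW XY" "x \<in> X"
  shows "\<nu> u x \<le> l \<longleftrightarrow> (\<exists>a\<in>A. \<eta> u x a \<le> l)"
proof
  show "\<exists>a\<in>A. \<eta> u x a \<le> l" if "\<nu> u x \<le> l"
    using minval_attained[OF assms] that by metis
  show "\<nu> u x \<le> l" if "\<exists>a\<in>A. \<eta> u x a \<le> l"
    using that minval_lower[of _ u x] by (blast intro: order_trans)
qed

text \<open>Since the minimum is attained, the sublevel set is the exact projection of a Borel set
  with compact sections. Level \<infinity> is set apart: the sections there are all of
  \<open>A\<close>, which need not be compact.\<close>

lemma minval_measurable:
  assumes u: "u \<in> LW XW XY"
  shows "\<nu> u \<in> borel_measurable (borel_on X)"
proof (rule borel_measurableI_le)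
  fix l :: ennreal
  have um: "u \<in> borel_measurable (borel_on X)" using u by (simp add: LW_def)
  have "{x \<in> X. \<nu> u x \<le> l} \<in> sets borel"
  proof (cases "l = \<infinity>")
    case True
    then show ?thesis using X_sets by simp
  next
    case False
    define P where "P = {p \<in> X \<times> A. \<eta> u (fst p) (snd p) \<le> l}"
    have "P \<in> sets (borel_on (X \<times> A))"
      using borel_measurable_le[OF eta_measurable[OF um], of "\<lambda>_. l"]
      by (simp add: P_def space_restrict_space)
    then have "P \<in> sets borel" by (simp add: sets_borel_on_iff[OF XA_sets])
    moreover have "compact {a. (x, a) \<in> P}" for x
    proof (cases "x \<in> X")
      case True
      with compact_eta_sublevel[OF u True, of l] False show ?thesis
        by (simp add: P_def top.not_eq_extremum mem_Times_iff)
    next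
      case False
      then have "{a. (x, a) \<in> P} = {}" by (auto simp: P_def)
      then show ?thesis by simp
    qed
    ultimately have "fst ` P \<in> sets borel" by (rule borel_projection_compact_sections)
    also have "fst ` P = {x \<in> X. \<nu> u x \<le> l}"
      using minval_le_iff[OF u] by (force simp: P_def image_iff)
    finally show ?thesis .
  qed
  then show "{x \<in> space (borel_on X). \<nu> u x \<le> l} \<in> sets (borel_on X)"
    by (simp add: space_restrict_space sets_borel_on_iff[OF X_sets])
qed

text \<open>Minimising actions along a convergent sequence of states accumulate, so a bound on the
  minima survives in the limit.\<close>

lemma minval_LW:
  assumes u: "u \<in> LW XW XY"
  shows "\<nu> u \<in> LW XW XY"
proof -
  have "lsc_on XW (\<lambda>w. \<nu> u (w, y))" if y: "y \<in> XY" for y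
  proof (rule lsc_onI_sequentially)
    fix w \<sigma> l assume *: "w \<in> XW" "\<And>n. \<sigma> n \<in> XW" "\<sigma> \<longlonglongrightarrow> w" "l < \<infinity>" "\<And>n. \<nu> u (\<sigma> n, y) \<le> l"
    have "\<forall>n. \<exists>a\<in>A. \<eta> u (\<sigma> n, y) a \<le> l"
      using *(2,5) y minval_le_iff[OF u] by auto
    then obtain a where a: "\<And>n. a n \<in> A" "\<And>n. \<eta> u (\<sigma> n, y) (a n) \<le> l" by metis
    from eta_inf_compact[OF u y *(2,1,3) a(1) *(4) a(2)]
    show "\<nu> u (w, y) \<le> l" using minval_le_iff[OF u, of "(w, y)"] *(1) y by auto
  qed
  with minval_measurable[OF u] show ?thesis by (simp add: LW_def)
qed

lemma graph_argmin_sets: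
  assumes u: "u \<in> LW XW XY" and v: "v \<in> borel_measurable (borel_on X)"
  shows "graph_on X (\<lambda>x. {a \<in> A. v x = \<eta> u x a}) \<in> sets (borel_on (X \<times> A))"
proof -
  have "u \<in> borel_measurable (borel_on X)" using u by (simp add: LW_def)
  from borel_measurable_eq[OF measurable_compose[OF measurable_fst_borel_on v] eta_measurable[OF this]]
  have "{p \<in> X \<times> A. v (fst p) = \<eta> u (fst p) (snd p)} \<in> sets (borel_on (X \<times> A))"
    by (simp add: space_restrict_space)
  also have "{p \<in> X \<times> A. v (fst p) = \<eta> u (fst p) (snd p)} = graph_on X (\<lambda>x. {a \<in> A. v x = \<eta> u x a})"
    by (auto simp: graph_on_def)
  finally show ?thesis .
qed

lemma compact_argmin:
  assumes u: "u \<in> LW XW XY" and x: "x \<in> X" and fin: "\<nu> u x < \<infinity>"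
  shows "compact {a \<in> A. \<nu> u x = \<eta> u x a}"
proof -
  have "{a \<in> A. \<nu> u x = \<eta> u x a} = {a \<in> A. \<eta> u x a \<le> \<nu> u x}"
    using minval_lower[of _ u x] by (metis order_antisym order_refl)
  then show ?thesis using compact_eta_sublevel[OF u x fin] by simp
qed

text \<open>Where the minimum is finite, the minimisers form compact sections and uniformization
  applies; where it is infinite, every action is a minimiser and the constant \<open>a0\<close>
  serves.\<close>

lemma argmin_selector:
  assumes u: "u \<in> LW XW XY"
  shows "\<exists>\<phi>\<in>borel_on X \<rightarrow>\<^sub>M borel_on A. \<forall>x\<in>X. \<eta> u x (\<phi> x) = \<nu> u x"
proof -
  define P where "P = graph_on X (\<lambda>x. {a \<in> A. \<nu> u x = \<eta> u x a}) \<inter> {x \<in> X. \<nu> u x < \<infinity>} \<times> UNIV"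
  have "{x \<in> space (borel_on X). \<nu> u x < \<infinity>} \<in> sets (borel_on X)"
    by (rule borel_measurable_less[OF minval_measurable[OF u]]) simp
  then have fin: "{x \<in> X. \<nu> u x < \<infinity>} \<in> sets borel"
    by (simp add: space_restrict_space sets_borel_on_iff[OF X_sets])
  moreover have "graph_on X (\<lambda>x. {a \<in> A. \<nu> u x = \<eta> u x a}) \<in> sets borel"
    using graph_argmin_sets[OF u minval_measurable[OF u]] by (simp add: sets_borel_on_iff[OF XA_sets])
  ultimately have P_sets: "P \<in> sets borel"
    unfolding P_def by (intro sets.Int borel_Times) auto
  have P_compact: "compact {a. (x, a) \<in> P}" for x
  proof (cases "x \<in> X \<and> \<nu> u x < \<infinity>")
    case True
    then have "{a. (x, a) \<in> P} = {a \<in> A. \<nu> u x = \<eta> u x a}" by (auto simp: P_def graph_on_def)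
    with compact_argmin[OF u] True show ?thesis by simp
  next
    case False
    then have "{a. (x, a) \<in> P} = {}" by (auto simp: P_def)
    then show ?thesis by simp
  qed
  obtain f where f: "f \<in> borel_measurable borel" "\<And>x. x \<in> fst ` P \<Longrightarrow> (x, f x) \<in> P"
    using borel_uniformization_compact_sections[OF P_sets P_compact] by blast
  have D: "fst ` P \<in> sets borel" by (rule borel_projection_compact_sections[OF P_sets P_compact])
  obtain a0 where a0: "a0 \<in> A" using A by blast
  define \<phi> where "\<phi> x = (if x \<in> fst ` P then f x else a0)" for x
  have "\<phi> \<in> borel_measurable borel"
    unfolding \<phi>_def using D f(1) by (intro measurable_If_set) auto
  moreover have \<phi>A: "\<phi> x \<in> A" for x
    using f(2)[of x] a0 by (auto simp: \<phi>_def P_def graph_on_def)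
  ultimately have "\<phi> \<in> borel_on X \<rightarrow>\<^sub>M borel_on A"
    by (intro measurable_restrict_space3) auto
  moreover have "\<eta> u x (\<phi> x) = \<nu> u x" if x: "x \<in> X" for x
  proof (cases "\<nu> u x < \<infinity>")
    case True
    obtain a where "a \<in> A" "\<eta> u x a = \<nu> u x" using minval_attained[OF u x] by blast
    then have "(x, a) \<in> P" using True x by (auto simp: P_def graph_on_def)
    then have "x \<in> fst ` P" by force
    with f(2)[OF this] show ?thesis by (auto simp: \<phi>_def P_def graph_on_def)
  next
    case False
    then show ?thesis using minval_lower[OF \<phi>A, of u x x] by (auto simp: not_less top_unique)
  qed
  ultimately show ?thesis by blast
qed

section \<open>The increasing limit of value iteration\<close>

lemma V_LW: "V t \<in> LW XW XY"
proof (induction t)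
  case (Suc t)
  then show ?case by (simp add: minval_LW)
qed (simp add: LW_def lsc_on_def)

lemma V_measurable: "V t \<in> borel_measurable (borel_on X)"
  using V_LW[of t] by (simp add: LW_def)

lemma V_Suc_le: "x \<in> X \<Longrightarrow> V t x \<le> V (Suc t) x"
proof (induction t arbitrary: x)
  case (Suc t)
  then have "\<nu> (V t) x \<le> \<nu> (V (Suc t)) x"
    unfolding minval_def by (intro INF_mono) (use eta_mono in blast)
  then show ?case by simp
qed simp

lemma V_mono: "x \<in> X \<Longrightarrow> incseq (\<lambda>t. V t x)"
  using V_Suc_le by (intro incseq_SucI)

definition Vinf :: "'w \<times> 'y \<Rightarrow> ennreal" where
  "Vinf x = (SUP t. V t x)"

lemma Vinf_LW: "Vinf \<in> LW XW XY"
  unfolding Vinf_def[abs_def] by (intro LW_SUP V_LW)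

text \<open>Minimum and increasing limit commute by compactness. The minimisers \<open>a t\<close>
  for \<open>V t\<close> accumulate at some \<open>b\<close>; each fixed \<open>m\<close> then
  satisfies \<open>\<eta> (V m) x b \<le> Vinf x\<close>, and the supremum over \<open>m\<close>
  gives the bound for \<open>Vinf\<close>.\<close>

lemma Vinf_fixed_point:
  assumes x: "x \<in> X"
  shows "\<nu> Vinf x = Vinf x"
proof (rule antisym)
  have eta_Vinf: "\<eta> Vinf x a = (SUP t. \<eta> (V t) x a)" if "a \<in> A" for a
    unfolding Vinf_def[abs_def] using x that V_measurable V_Suc_le by (rule eta_SUP)
  have eta_inc: "\<eta> (V m) x a \<le> \<eta> (V n) x a" if "m \<le> n" "a \<in> A" for m n a
    using x that V_mono by (intro eta_mono) (auto simp: incseq_def)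
  show "Vinf x \<le> \<nu> Vinf x"
    unfolding Vinf_def minval_def
  proof (intro SUP_least INF_greatest)
    fix t a assume a: "a \<in> A"
    have "V t x \<le> V (Suc t) x" by (rule V_Suc_le[OF x])
    also have "\<dots> \<le> \<eta> (V t) x a" using minval_lower[OF a] by simp
    also have "\<dots> \<le> \<eta> Vinf x a" unfolding eta_Vinf[OF a] by (rule SUP_upper) simp
    finally show "V t x \<le> \<eta> (\<lambda>x. SUP t. V t x) x a" unfolding Vinf_def[abs_def] .
  qed
  show "\<nu> Vinf x \<le> Vinf x"
  proof (cases "Vinf x = \<infinity>")
    case False
    obtain w y where wy: "x = (w, y)" "w \<in> XW" "y \<in> XY" using x by (cases x) auto
    have "\<forall>t. \<exists>a\<in>A. \<eta> (V t) x a = V (Suc t) x" using minval_attained[OF V_LW x] by simp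
    then obtain a where a: "\<And>t. a t \<in> A" "\<And>t. \<eta> (V t) x (a t) = V (Suc t) x" by metis
    have bound: "\<eta> (V m) x (a n) \<le> Vinf x" if "m \<le> n" for m n
    proof -
      have "\<eta> (V m) x (a n) \<le> \<eta> (V n) x (a n)" using that a(1) by (rule eta_inc)
      also have "\<dots> = V (Suc n) x" by (rule a(2))
      also have "\<dots> \<le> Vinf x" unfolding Vinf_def by (rule SUP_upper) simp
      finally show ?thesis .
    qed
    \<comment> \<open>\<open>V 0\<close> is 0, so this level set is one of the cost alone, and it
      contains all the minimisers.\<close>
    have "\<exists>b\<in>A. \<exists>r. strict_mono r \<and> (a \<circ> r) \<longlonglongrightarrow> b \<and> \<eta> (V 0) (w, y) b \<le> Vinf x"
      using bound[of 0] a(1) wy False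
      by (intro eta_inf_compact[OF V_LW, of y "\<lambda>_. w"]) (auto simp: top.not_eq_extremum simp del: value_iteration.simps)
    then obtain b r where b: "b \<in> A" "strict_mono r" "(a \<circ> r) \<longlonglongrightarrow> b" by blast
    have "\<eta> (V m) x b \<le> Vinf x" for m
      unfolding wy(1)
    proof (rule eta_lsc[OF V_LW wy(3), where \<sigma>="\<lambda>_. w"])
      show "(\<lambda>n. (a \<circ> r) (n + m)) \<longlonglongrightarrow> b" using b(3) by (rule LIMSEQ_ignore_initial_segment)
      show "\<eta> (V m) (w, y) ((a \<circ> r) (n + m)) \<le> Vinf (w, y)" for n
      proof -
        have "m \<le> r (n + m)" using seq_suble[OF b(2), of "n + m"] by simp
        from bound[OF this] show ?thesis by (simp add: wy)
      qed
    qed (use wy a b in auto)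
    then have "\<eta> Vinf x b \<le> Vinf x" unfolding eta_Vinf[OF b(1)] by (rule SUP_least)
    with minval_lower[OF b(1), of Vinf x] show ?thesis by (rule order_trans)
  qed simp
qed

end

section \<open>Integrals along the controlled process\<close>

locale controlled_process =
  fixes X :: "'x::second_countable_topology set" and A :: "'a::second_countable_topology set"
    and q :: "'x \<times> 'a \<Rightarrow> 'x measure"
  assumes q_kernel: "q \<in> borel_on (X \<times> A) \<rightarrow>\<^sub>M prob_algebra (borel_on X)"
begin

abbreviation "M \<equiv> borel_on (X \<times> A)"

text \<open>First half of a step: the law of the new state, before the action is drawn. Keeping it
  apart lets functions of the state be integrated without reference to the policy.\<close>

definition state_kernel :: "'x \<Rightarrow> nat \<Rightarrow> (nat \<Rightarrow> 'x \<times> 'a) \<Rightarrow> 'x measure" where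
  "state_kernel x t h = (case t of 0 \<Rightarrow> return (borel_on X) x | Suc s \<Rightarrow> q (h s))"

definition action_kernel :: "('x, 'a) policy \<Rightarrow> nat \<Rightarrow> (nat \<Rightarrow> 'x \<times> 'a) \<Rightarrow> 'x \<Rightarrow> ('x \<times> 'a) measure" where
  "action_kernel \<pi> t h y = \<pi> t (h, y) \<bind> (\<lambda>a. return M (y, a))"

lemma step_kernel_eq: "step_kernel X A q \<pi> x t h = state_kernel x t h \<bind> action_kernel \<pi> t h"
  by (simp add: step_kernel_def state_kernel_def action_kernel_def[abs_def])

lemma space_M: "space M = X \<times> A" by (simp add: space_restrict_space)

lemma Pair_measurable:
  assumes "f \<in> N \<rightarrow>\<^sub>M borel_on X" "g \<in> N \<rightarrow>\<^sub>M borel_on A"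
  shows "(\<lambda>z. (f z, g z)) \<in> N \<rightarrow>\<^sub>M M"
  using assms by (auto simp: measurable_restrict_space2_iff intro!: borel_measurable_Pair)

lemma state_kernel_measurable:
  assumes "x \<in> X"
  shows "state_kernel x t \<in> PiM {0..<t} (\<lambda>_. M) \<rightarrow>\<^sub>M prob_algebra (borel_on X)"
proof (cases t)
  case 0
  have "return (borel_on X) x \<in> space (prob_algebra (borel_on X))"
    using assms by (simp add: space_prob_algebra prob_space_return space_restrict_space)
  then show ?thesis using 0 by (simp add: state_kernel_def[abs_def])
next
  case (Suc s)
  have "(\<lambda>h. h s) \<in> PiM {0..<Suc s} (\<lambda>_. M) \<rightarrow>\<^sub>M M" by (rule measurable_component_singleton) simp
  from measurable_compose[OF this q_kernel] show ?thesis by (simp add: Suc state_kernel_def[abs_def])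
qed

lemma action_kernel_measurable:
  assumes "\<pi> \<in> policies X A"
  shows "(\<lambda>(h, y). action_kernel \<pi> t h y) \<in> PiM {0..<t} (\<lambda>_. M) \<Otimes>\<^sub>M borel_on X \<rightarrow>\<^sub>M prob_algebra M"
proof -
  have "\<pi> t \<in> PiM {0..<t} (\<lambda>_. M) \<Otimes>\<^sub>M borel_on X \<rightarrow>\<^sub>M prob_algebra (borel_on A)"
    using assms by (simp add: policies_def history_def)
  moreover have "(\<lambda>(p, a). return M (snd p, a)) \<in>
      (PiM {0..<t} (\<lambda>_. M) \<Otimes>\<^sub>M borel_on X) \<Otimes>\<^sub>M borel_on A \<rightarrow>\<^sub>M prob_algebra M"
    unfolding split_beta
    by (rule measurable_compose[OF Pair_measurable measurable_return_prob_space]) measurable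
  ultimately have "(\<lambda>p. \<pi> t p \<bind> (\<lambda>a. return M (snd p, a))) \<in>
      PiM {0..<t} (\<lambda>_. M) \<Otimes>\<^sub>M borel_on X \<rightarrow>\<^sub>M prob_algebra M"
    by (rule measurable_bind_prob_space2)
  then show ?thesis by (simp add: action_kernel_def split_beta')
qed

lemma step_kernel_measurable:
  assumes "x \<in> X" "\<pi> \<in> policies X A"
  shows "step_kernel X A q \<pi> x t \<in> PiM {0..<t} (\<lambda>_. M) \<rightarrow>\<^sub>M prob_algebra M"
  unfolding step_kernel_eq[abs_def]
  by (rule measurable_bind_prob_space2[OF state_kernel_measurable action_kernel_measurable]) fact+

lemma Ionescu_Tulcea_step_kernel:
  assumes "x \<in> X" "\<pi> \<in> policies X A"
  shows "Ionescu_Tulcea (step_kernel X A q \<pi> x) (\<lambda>_. M)"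
proof (rule Ionescu_Tulcea.intro)
  show "step_kernel X A q \<pi> x t \<in> PiM {0..<t} (\<lambda>_. M) \<rightarrow>\<^sub>M subprob_algebra M"
    for t by (rule measurable_prob_algebraD[OF step_kernel_measurable]) fact+
  show "prob_space (step_kernel X A q \<pi> x t h)" if "h \<in> space (PiM {0..<t} (\<lambda>_. M))" for t h
    using measurable_space[OF step_kernel_measurable[OF assms] that] by (simp add: space_prob_algebra)
qed

lemma nn_integral_step_kernel:
  assumes x: "x \<in> X" and \<pi>: "\<pi> \<in> policies X A" and h: "h \<in> space (PiM {0..<t} (\<lambda>_. M))"
    and g: "g \<in> borel_measurable M"
  shows "(\<integral>\<^sup>+p. g p \<partial>step_kernel X A q \<pi> x t h) =
    (\<integral>\<^sup>+y. (\<integral>\<^sup>+a. g (y, a) \<partial>\<pi> t (h, y)) \<partial>state_kernel x t h)"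
proof -
  have sk: "state_kernel x t h \<in> space (prob_algebra (borel_on X))"
    by (rule measurable_space[OF state_kernel_measurable[OF x] h])
  then have sets_sk: "sets (state_kernel x t h) = sets (borel_on X)" by (simp add: space_prob_algebra)
  then have space_sk: "space (state_kernel x t h) = X"
    by (simp add: sets_eq_imp_space_eq space_restrict_space)
  have "(\<lambda>y. (\<lambda>(h, y). action_kernel \<pi> t h y) (h, y)) \<in> borel_on X \<rightarrow>\<^sub>M prob_algebra M"
    using h by (intro measurable_compose[OF measurable_Pair1' action_kernel_measurable[OF \<pi>]])
  then have "action_kernel \<pi> t h \<in> state_kernel x t h \<rightarrow>\<^sub>M subprob_algebra M"
    by (simp add: measurable_prob_algebraD measurable_cong_sets[OF sets_sk refl])
  then have "(\<integral>\<^sup>+p. g p \<partial>step_kernel X A q \<pi> x t h) =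
      (\<integral>\<^sup>+y. (\<integral>\<^sup>+p. g p \<partial>action_kernel \<pi> t h y) \<partial>state_kernel x t h)"
    unfolding step_kernel_eq using g by (rule nn_integral_bind[rotated])
  also have "\<dots> = (\<integral>\<^sup>+y. (\<integral>\<^sup>+a. g (y, a) \<partial>\<pi> t (h, y)) \<partial>state_kernel x t h)"
  proof (rule nn_integral_cong)
    fix y assume "y \<in> space (state_kernel x t h)"
    then have y: "y \<in> X" by (simp add: space_sk)
    have "(h, y) \<in> space (history X A t)"
      using h y by (simp add: history_def space_pair_measure space_restrict_space)
    with \<pi> have "\<pi> t (h, y) \<in> space (prob_algebra (borel_on A))"
      unfolding policies_def by (auto intro: measurable_space)
    then have sets_\<pi>: "sets (\<pi> t (h, y)) = sets (borel_on A)" by (simp add: space_prob_algebra)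
    have pair: "Pair y \<in> borel_on A \<rightarrow>\<^sub>M M"
      using y by (intro Pair_measurable) (auto simp: space_restrict_space)
    then have "(\<lambda>a. return M (y, a)) \<in> \<pi> t (h, y) \<rightarrow>\<^sub>M subprob_algebra M"
      by (simp add: measurable_cong_sets[OF sets_\<pi> refl] measurable_compose[OF _ return_measurable])
    then have "(\<integral>\<^sup>+p. g p \<partial>action_kernel \<pi> t h y) = (\<integral>\<^sup>+a. (\<integral>\<^sup>+p. g p \<partial>return M (y, a)) \<partial>\<pi> t (h, y))"
      unfolding action_kernel_def using g by (rule nn_integral_bind[rotated])
    also have "\<dots> = (\<integral>\<^sup>+a. g (y, a) \<partial>\<pi> t (h, y))"
      using y g sets_eq_imp_space_eq[OF sets_\<pi>]
      by (intro nn_integral_cong nn_integral_return) (auto simp: space_restrict_space)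
    finally show "(\<integral>\<^sup>+p. g p \<partial>action_kernel \<pi> t h y) = (\<integral>\<^sup>+a. g (y, a) \<partial>\<pi> t (h, y))" .
  qed
  finally show ?thesis .
qed

text \<open>The action is drawn from a probability measure, so it integrates out.\<close>

lemma nn_integral_step_kernel_state:
  assumes x: "x \<in> X" and \<pi>: "\<pi> \<in> policies X A" and h: "h \<in> space (PiM {0..<t} (\<lambda>_. M))"
    and g: "g \<in> borel_measurable (borel_on X)"
  shows "(\<integral>\<^sup>+p. g (fst p) \<partial>step_kernel X A q \<pi> x t h) = (\<integral>\<^sup>+y. g y \<partial>state_kernel x t h)"
proof -
  have "(\<integral>\<^sup>+p. g (fst p) \<partial>step_kernel X A q \<pi> x t h) =
      (\<integral>\<^sup>+y. (\<integral>\<^sup>+a. g (fst (y, a)) \<partial>\<pi> t (h, y)) \<partial>state_kernel x t h)"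
    by (rule nn_integral_step_kernel[OF x \<pi> h measurable_compose[OF measurable_fst_borel_on g]])
  also have "\<dots> = (\<integral>\<^sup>+y. g y \<partial>state_kernel x t h)"
  proof (rule nn_integral_cong)
    fix y assume y: "y \<in> space (state_kernel x t h)"
    have "state_kernel x t h \<in> space (prob_algebra (borel_on X))"
      by (rule measurable_space[OF state_kernel_measurable[OF x] h])
    then have "space (state_kernel x t h) = X"
      by (auto simp: space_prob_algebra space_restrict_space dest: sets_eq_imp_space_eq)
    with y h have "(h, y) \<in> space (history X A t)"
      by (simp add: history_def space_pair_measure space_restrict_space)
    with \<pi> have "\<pi> t (h, y) \<in> space (prob_algebra (borel_on A))"
      unfolding policies_def by (auto intro: measurable_space)
    then have "prob_space (\<pi> t (h, y))" by (simp add: space_prob_algebra)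
    then show "(\<integral>\<^sup>+a. g (fst (y, a)) \<partial>\<pi> t (h, y)) = g y"
      by (simp add: prob_space.emeasure_space_1)
  qed
  finally show ?thesis .
qed

section \<open>Expectations of single coordinates of the process\<close>

lemma sets_process_law: "x \<in> X \<Longrightarrow> \<pi> \<in> policies X A \<Longrightarrow>
    sets (process_law X A q \<pi> x) = sets (PiM UNIV (\<lambda>_. M))"
proof -
  assume "x \<in> X" "\<pi> \<in> policies X A"
  then interpret Ionescu_Tulcea "step_kernel X A q \<pi> x" "\<lambda>_. M" by (rule Ionescu_Tulcea_step_kernel)
  show ?thesis unfolding process_law_def by (rule PF.sets_lim)
qed

lemma process_component_measurable:
  assumes "x \<in> X" "\<pi> \<in> policies X A" "g \<in> borel_measurable M"
  shows "(\<lambda>\<omega>. g (\<omega> t)) \<in> borel_measurable (process_law X A q \<pi> x)"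
proof -
  have "(\<lambda>\<omega>. \<omega> t) \<in> process_law X A q \<pi> x \<rightarrow>\<^sub>M M"
    unfolding measurable_cong_sets[OF sets_process_law[OF assms(1,2)] refl]
    by (rule measurable_component_singleton) simp
  from measurable_compose[OF this assms(3)] show ?thesis .
qed

lemma process_component_space:
  assumes "x \<in> X" "\<pi> \<in> policies X A" "\<omega> \<in> space (process_law X A q \<pi> x)"
  shows "\<omega> t \<in> X \<times> A"
  using assms(3) sets_eq_imp_space_eq[OF sets_process_law[OF assms(1,2)]]
  by (auto simp: space_PiM PiE_iff space_restrict_space)

text \<open>The projective limit has the finite kernels \<open>C 0 n\<close> as marginals, and
  \<open>C 0 (Suc t)\<close> is \<open>C 0 t\<close> followed by one step kernel. Step kernels read
  an extensional past, hence \<open>restrict\<close>; at time 0 the only past is the undefined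
  function.\<close>

lemma nn_integral_process_component:
  assumes x: "x \<in> X" and \<pi>: "\<pi> \<in> policies X A" and g: "g \<in> borel_measurable M"
  shows "(\<integral>\<^sup>+\<omega>. g (\<omega> t) \<partial>process_law X A q \<pi> x) =
    (\<integral>\<^sup>+\<omega>. (\<integral>\<^sup>+p. g p \<partial>step_kernel X A q \<pi> x t (restrict \<omega> {0..<t})) \<partial>process_law X A q \<pi> x)"
    and "(\<integral>\<^sup>+\<omega>. g (\<omega> 0) \<partial>process_law X A q \<pi> x) = (\<integral>\<^sup>+p. g p \<partial>step_kernel X A q \<pi> x 0 (\<lambda>_. undefined))"
proof -
  interpret Ionescu_Tulcea "step_kernel X A q \<pi> x" "\<lambda>_. M" by (rule Ionescu_Tulcea_step_kernel) fact+
  let ?P = "\<lambda>n. PiM {0..<n} (\<lambda>_. M)" and ?u = "\<lambda>_::nat. undefined :: 'x \<times> 'a"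
  have u: "?u \<in> space (?P 0)" by (simp add: space_PiM)
  \<comment> \<open>\<open>CI\<close> goes through the shortest initial segment containing its index
    set; here the index set is one already.\<close>
  have up_to: "up_to {0..<n} = n" for n
  proof (rule antisym)
    show "up_to {0..<n} \<le> n" by (subst up_to_iff) auto
    show "n \<le> up_to {0..<n}" using up_to_less[of "{0..<n}" "n - 1"] by (cases n) auto
  qed
  have lim: "(\<integral>\<^sup>+\<omega>. F (restrict \<omega> {0..<n}) \<partial>process_law X A q \<pi> x) = (\<integral>\<^sup>+\<omega>. F \<omega> \<partial>C 0 n ?u)"
    if F: "F \<in> borel_measurable (?P n)" for F n
  proof -
    have "distr (process_law X A q \<pi> x) (?P n) (\<lambda>\<omega>. restrict \<omega> {0..<n}) = CI {0..<n}"
      unfolding process_law_def by (rule distr_lim) simp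
    also have "\<dots> = C 0 n ?u"
      unfolding CI_def up_to using distr_C[OF order_refl u, of n] by simp
    finally have "(\<integral>\<^sup>+\<omega>. F \<omega> \<partial>C 0 n ?u) =
        (\<integral>\<^sup>+\<omega>. F \<omega> \<partial>distr (process_law X A q \<pi> x) (?P n) (\<lambda>\<omega>. restrict \<omega> {0..<n}))" by simp
    also have "\<dots> = (\<integral>\<^sup>+\<omega>. F (restrict \<omega> {0..<n}) \<partial>process_law X A q \<pi> x)"
    proof (rule nn_integral_distr)
      show "(\<lambda>\<omega>. restrict \<omega> {0..<n}) \<in> process_law X A q \<pi> x \<rightarrow>\<^sub>M ?P n"
        unfolding measurable_cong_sets[OF sets_process_law[OF x \<pi>] refl]
        by (rule measurable_restrict_subset) simp
    qed (use F in simp)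
    finally show ?thesis by simp
  qed
  have g_last: "(\<lambda>\<omega>. g (\<omega> n)) \<in> borel_measurable (?P (Suc n))" for n
  proof -
    have "(\<lambda>\<omega>. \<omega> n) \<in> ?P (Suc n) \<rightarrow>\<^sub>M M" by (rule measurable_component_singleton) simp
    from measurable_compose[OF this g] show ?thesis .
  qed
  have F: "(\<lambda>\<omega>. \<integral>\<^sup>+p. g p \<partial>step_kernel X A q \<pi> x n \<omega>) \<in> borel_measurable (?P n)" for n
    by (rule measurable_compose[OF P nn_integral_measurable_subprob_algebra[OF g]])
  have C: "(\<integral>\<^sup>+\<omega>. g (\<omega> n) \<partial>C 0 (Suc n) ?u) = (\<integral>\<^sup>+\<omega>. (\<integral>\<^sup>+p. g p \<partial>step_kernel X A q \<pi> x n \<omega>) \<partial>C 0 n ?u)" for n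
  proof -
    have "eP n \<in> C 0 n ?u \<rightarrow>\<^sub>M subprob_algebra (?P (Suc n))"
      using measurable_eP[of n] sets_C[OF u, of n] by (simp cong: measurable_cong_sets)
    then have "(\<integral>\<^sup>+\<omega>. g (\<omega> n) \<partial>C 0 (Suc n) ?u) = (\<integral>\<^sup>+\<omega>. (\<integral>\<^sup>+\<omega>'. g (\<omega>' n) \<partial>eP n \<omega>) \<partial>C 0 n ?u)"
      using g_last[of n] by (simp add: nn_integral_bind)
    also have "\<dots> = (\<integral>\<^sup>+\<omega>. (\<integral>\<^sup>+p. g p \<partial>step_kernel X A q \<pi> x n \<omega>) \<partial>C 0 n ?u)"
      using space_C[OF u, of n] by (intro nn_integral_cong) (simp add: nn_integral_eP[OF _ g_last])
    finally show ?thesis .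
  qed
  have split: "(\<integral>\<^sup>+\<omega>. g (\<omega> n) \<partial>process_law X A q \<pi> x) =
      (\<integral>\<^sup>+\<omega>. (\<integral>\<^sup>+p. g p \<partial>step_kernel X A q \<pi> x n \<omega>) \<partial>C 0 n ?u)" for n
    using lim[OF g_last[of n]] unfolding C by simp
  show "(\<integral>\<^sup>+\<omega>. g (\<omega> t) \<partial>process_law X A q \<pi> x) =
    (\<integral>\<^sup>+\<omega>. (\<integral>\<^sup>+p. g p \<partial>step_kernel X A q \<pi> x t (restrict \<omega> {0..<t})) \<partial>process_law X A q \<pi> x)"
    unfolding split lim[OF F] ..
  show "(\<integral>\<^sup>+\<omega>. g (\<omega> 0) \<partial>process_law X A q \<pi> x) = (\<integral>\<^sup>+p. g p \<partial>step_kernel X A q \<pi> x 0 ?u)"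
    unfolding split using F[of 0] u by (simp add: nn_integral_return)
qed

lemma restrict_space_PiM:
  assumes "x \<in> X" "\<pi> \<in> policies X A" "\<omega> \<in> space (process_law X A q \<pi> x)"
  shows "restrict \<omega> {0..<t} \<in> space (PiM {0..<t} (\<lambda>_. M))"
  using process_component_space[OF assms] by (simp add: space_PiM space_M)

lemma nn_integral_initial_state:
  assumes x: "x \<in> X" and \<pi>: "\<pi> \<in> policies X A" and g: "g \<in> borel_measurable (borel_on X)"
  shows "(\<integral>\<^sup>+\<omega>. g (fst (\<omega> 0)) \<partial>process_law X A q \<pi> x) = g x"
proof -
  have "(\<integral>\<^sup>+\<omega>. g (fst (\<omega> 0)) \<partial>process_law X A q \<pi> x) =
      (\<integral>\<^sup>+p. g (fst p) \<partial>step_kernel X A q \<pi> x 0 (\<lambda>_. undefined))"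
    by (rule nn_integral_process_component(2)[OF x \<pi> measurable_compose[OF measurable_fst_borel_on g]])
  also have "\<dots> = (\<integral>\<^sup>+y. g y \<partial>state_kernel x 0 (\<lambda>_. undefined))"
    by (rule nn_integral_step_kernel_state[OF x \<pi> _ g]) (simp add: space_PiM)
  also have "\<dots> = g x"
    using x g by (simp add: state_kernel_def nn_integral_return space_restrict_space)
  finally show ?thesis .
qed

lemma nn_integral_next_state:
  assumes x: "x \<in> X" and \<pi>: "\<pi> \<in> policies X A" and g: "g \<in> borel_measurable (borel_on X)"
  shows "(\<integral>\<^sup>+\<omega>. g (fst (\<omega> (Suc t))) \<partial>process_law X A q \<pi> x) =
    (\<integral>\<^sup>+\<omega>. (\<integral>\<^sup>+z. g z \<partial>q (\<omega> t)) \<partial>process_law X A q \<pi> x)"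
proof -
  have "(\<integral>\<^sup>+\<omega>. g (fst (\<omega> (Suc t))) \<partial>process_law X A q \<pi> x) =
    (\<integral>\<^sup>+\<omega>. (\<integral>\<^sup>+p. g (fst p) \<partial>step_kernel X A q \<pi> x (Suc t) (restrict \<omega> {0..<Suc t})) \<partial>process_law X A q \<pi> x)"
    by (rule nn_integral_process_component(1)[OF x \<pi> measurable_compose[OF measurable_fst_borel_on g]])
  also have "\<dots> = (\<integral>\<^sup>+\<omega>. (\<integral>\<^sup>+z. g z \<partial>q (\<omega> t)) \<partial>process_law X A q \<pi> x)"
    by (intro nn_integral_cong)
       (simp add: nn_integral_step_kernel_state[OF x \<pi> restrict_space_PiM[OF x \<pi>] g] state_kernel_def)
  finally show ?thesis .
qed

lemma markov_policy_in_policies: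
  assumes "\<And>t. \<phi> t \<in> borel_on X \<rightarrow>\<^sub>M borel_on A"
  shows "markov_policy A \<phi> \<in> policies X A"
  unfolding policies_def history_def markov_policy_def split_beta
  by (intro CollectI allI measurable_compose[OF _ measurable_return_prob_space]
        measurable_compose[OF measurable_snd assms])

text \<open>The action law is a point mass at the decision rule. The two integrands are compared
  inside the step kernel for each fixed past, which avoids an almost sure statement about the
  process.\<close>

lemma nn_integral_markov_action:
  assumes x: "x \<in> X" and \<phi>: "\<And>t. \<phi> t \<in> borel_on X \<rightarrow>\<^sub>M borel_on A" and g: "g \<in> borel_measurable M"
  shows "(\<integral>\<^sup>+\<omega>. g (\<omega> t) \<partial>process_law X A q (markov_policy A \<phi>) x) =
    (\<integral>\<^sup>+\<omega>. g (fst (\<omega> t), \<phi> t (fst (\<omega> t))) \<partial>process_law X A q (markov_policy A \<phi>) x)"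
proof -
  let ?\<pi> = "markov_policy A \<phi>"
  have \<pi>: "?\<pi> \<in> policies X A" by (rule markov_policy_in_policies[OF \<phi>])
  have g\<phi>: "(\<lambda>y. g (y, \<phi> t y)) \<in> borel_measurable (borel_on X)"
    by (rule measurable_compose[OF Pair_measurable g]) (use \<phi> in auto)
  have eq: "(\<integral>\<^sup>+p. g p \<partial>step_kernel X A q ?\<pi> x t h) =
      (\<integral>\<^sup>+p. g (fst p, \<phi> t (fst p)) \<partial>step_kernel X A q ?\<pi> x t h)"
    if h: "h \<in> space (PiM {0..<t} (\<lambda>_. M))" for h
  proof -
    have "state_kernel x t h \<in> space (prob_algebra (borel_on X))"
      by (rule measurable_space[OF state_kernel_measurable[OF x] h])
    then have space: "space (state_kernel x t h) = X"
      by (auto simp: space_prob_algebra space_restrict_space dest: sets_eq_imp_space_eq)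
    have "(\<integral>\<^sup>+p. g p \<partial>step_kernel X A q ?\<pi> x t h) =
        (\<integral>\<^sup>+y. (\<integral>\<^sup>+a. g (y, a) \<partial>return (borel_on A) (\<phi> t y)) \<partial>state_kernel x t h)"
      by (simp add: nn_integral_step_kernel[OF x \<pi> h g] markov_policy_def)
    also have "\<dots> = (\<integral>\<^sup>+y. g (y, \<phi> t y) \<partial>state_kernel x t h)"
    proof (rule nn_integral_cong)
      fix y assume "y \<in> space (state_kernel x t h)"
      then have y: "y \<in> X" by (simp add: space)
      have "Pair y \<in> borel_on A \<rightarrow>\<^sub>M M"
        using y by (intro Pair_measurable) (auto simp: space_restrict_space)
      from measurable_compose[OF this g]
      show "(\<integral>\<^sup>+a. g (y, a) \<partial>return (borel_on A) (\<phi> t y)) = g (y, \<phi> t y)"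
        using measurable_space[OF \<phi>[of t], of y] y by (intro nn_integral_return) (auto simp: space_restrict_space)
    qed
    also have "\<dots> = (\<integral>\<^sup>+p. g (fst p, \<phi> t (fst p)) \<partial>step_kernel X A q ?\<pi> x t h)"
      by (rule nn_integral_step_kernel_state[OF x \<pi> h g\<phi>, symmetric])
    finally show ?thesis .
  qed
  have "(\<integral>\<^sup>+\<omega>. g (\<omega> t) \<partial>process_law X A q ?\<pi> x) =
      (\<integral>\<^sup>+\<omega>. (\<integral>\<^sup>+p. g p \<partial>step_kernel X A q ?\<pi> x t (restrict \<omega> {0..<t})) \<partial>process_law X A q ?\<pi> x)"
    by (rule nn_integral_process_component(1)[OF x \<pi> g])
  also have "\<dots> = (\<integral>\<^sup>+\<omega>. (\<integral>\<^sup>+p. g (fst p, \<phi> t (fst p)) \<partial>step_kernel X A q ?\<pi> x t (restrict \<omega> {0..<t})) \<partial>process_law X A q ?\<pi> x)"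
    by (intro nn_integral_cong eq restrict_space_PiM[OF x \<pi>])
  also have "\<dots> = (\<integral>\<^sup>+\<omega>. g (fst (\<omega> t), \<phi> t (fst (\<omega> t))) \<partial>process_law X A q ?\<pi> x)"
    by (rule nn_integral_process_component(1)[OF x \<pi> measurable_compose[OF measurable_fst_borel_on g\<phi>], symmetric])
  finally show ?thesis .
qed

section \<open>Expected costs along the process\<close>

context
  fixes c :: "'x \<times> 'a \<Rightarrow> ennreal" and \<alpha> :: real
  assumes c: "c \<in> borel_measurable M"
begin

lemma horizon_cost_Suc:
  assumes "x \<in> X" "\<pi> \<in> policies X A"
  shows "horizon_cost X A q c \<alpha> (Suc T) \<pi> x =
    horizon_cost X A q c \<alpha> T \<pi> x + ennreal \<alpha> ^ T * (\<integral>\<^sup>+\<omega>. c (\<omega> T) \<partial>process_law X A q \<pi> x)"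
proof -
  note [measurable] = process_component_measurable[OF assms c]
  show ?thesis unfolding horizon_cost_def by (simp add: nn_integral_add nn_integral_cmult)
qed

lemma discounted_cost_SUP:
  assumes "x \<in> X" "\<pi> \<in> policies X A"
  shows "discounted_cost X A q c \<alpha> \<pi> x = (SUP T. horizon_cost X A q c \<alpha> T \<pi> x)"
proof -
  note [measurable] = process_component_measurable[OF assms c]
  show ?thesis
    unfolding horizon_cost_def discounted_cost_def suminf_eq_SUP
    by (intro nn_integral_monotone_convergence_SUP) (auto intro!: incseq_SucI le_funI)
qed

text \<open>One step of the telescoping: the inner integral over \<open>q\<close> becomes the
  expectation at the next time.\<close>

lemma eta_process:
  assumes x: "x \<in> X" and \<pi>: "\<pi> \<in> policies X A" and u: "u \<in> borel_measurable (borel_on X)"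
  shows "(\<integral>\<^sup>+\<omega>. eta q c \<alpha> u (fst (\<omega> t)) (snd (\<omega> t)) \<partial>process_law X A q \<pi> x) =
    (\<integral>\<^sup>+\<omega>. c (\<omega> t) \<partial>process_law X A q \<pi> x) + ennreal \<alpha> * (\<integral>\<^sup>+\<omega>. u (fst (\<omega> (Suc t))) \<partial>process_law X A q \<pi> x)"
proof -
  have I: "(\<lambda>p. \<integral>\<^sup>+z. u z \<partial>q p) \<in> borel_measurable M"
    by (rule measurable_compose[OF measurable_prob_algebraD[OF q_kernel]
          nn_integral_measurable_subprob_algebra[OF u]])
  note [measurable] = process_component_measurable[OF x \<pi> c] process_component_measurable[OF x \<pi> I]
  show ?thesis
    unfolding eta_def nn_integral_next_state[OF x \<pi> u] by (simp add: nn_integral_add nn_integral_cmult)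
qed

text \<open>Both lemmas telescope the expectations of \<open>\<alpha> ^ t * u t (x\<^sub>t)\<close>.\<close>

lemma horizon_cost_lower:
  assumes x: "x \<in> X" and \<pi>: "\<pi> \<in> policies X A" and u: "\<And>t. u t \<in> borel_measurable (borel_on X)"
    and le: "\<And>t y a. t < T \<Longrightarrow> y \<in> X \<Longrightarrow> a \<in> A \<Longrightarrow> u t y \<le> eta q c \<alpha> (u (Suc t)) y a"
  shows "u 0 x \<le> horizon_cost X A q c \<alpha> T \<pi> x +
    ennreal \<alpha> ^ T * (\<integral>\<^sup>+\<omega>. u T (fst (\<omega> T)) \<partial>process_law X A q \<pi> x)"
  using le
proof (induction T)
  case 0
  then show ?case by (simp add: nn_integral_initial_state[OF x \<pi> u])
next
  case (Suc T)
  have "u 0 x \<le> horizon_cost X A q c \<alpha> T \<pi> x +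
      ennreal \<alpha> ^ T * (\<integral>\<^sup>+\<omega>. u T (fst (\<omega> T)) \<partial>process_law X A q \<pi> x)"
    using Suc by simp
  also have "\<dots> \<le> horizon_cost X A q c \<alpha> T \<pi> x + ennreal \<alpha> ^ T *
      (\<integral>\<^sup>+\<omega>. eta q c \<alpha> (u (Suc T)) (fst (\<omega> T)) (snd (\<omega> T)) \<partial>process_law X A q \<pi> x)"
    using process_component_space[OF x \<pi>, of _ T]
    by (intro add_left_mono mult_left_mono nn_integral_mono Suc.prems) (auto simp: mem_Times_iff)
  also have "\<dots> = horizon_cost X A q c \<alpha> (Suc T) \<pi> x +
      ennreal \<alpha> ^ Suc T * (\<integral>\<^sup>+\<omega>. u (Suc T) (fst (\<omega> (Suc T))) \<partial>process_law X A q \<pi> x)"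
    unfolding eta_process[OF x \<pi> u] horizon_cost_Suc[OF x \<pi>]
    by (simp add: distrib_left mult_ac add_ac)
  finally show ?case .
qed

lemma horizon_cost_markov:
  assumes x: "x \<in> X" and \<phi>: "\<And>t. \<phi> t \<in> borel_on X \<rightarrow>\<^sub>M borel_on A"
    and u: "\<And>t. u t \<in> borel_measurable (borel_on X)"
    and eq: "\<And>t y. t < T \<Longrightarrow> y \<in> X \<Longrightarrow> u t y = eta q c \<alpha> (u (Suc t)) y (\<phi> t y)"
  shows "u 0 x = horizon_cost X A q c \<alpha> T (markov_policy A \<phi>) x +
    ennreal \<alpha> ^ T * (\<integral>\<^sup>+\<omega>. u T (fst (\<omega> T)) \<partial>process_law X A q (markov_policy A \<phi>) x)"
  using eq
proof (induction T)
  case 0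
  then show ?case by (simp add: horizon_cost_def nn_integral_initial_state[OF x markov_policy_in_policies[OF \<phi>] u])
next
  case (Suc T)
  let ?\<pi> = "markov_policy A \<phi>"
  have \<pi>: "?\<pi> \<in> policies X A" by (rule markov_policy_in_policies[OF \<phi>])
  have I: "(\<lambda>p. \<integral>\<^sup>+z. u (Suc T) z \<partial>q p) \<in> borel_measurable M"
    by (rule measurable_compose[OF measurable_prob_algebraD[OF q_kernel]
          nn_integral_measurable_subprob_algebra[OF u]])
  have eta_M: "(\<lambda>p. eta q c \<alpha> (u (Suc T)) (fst p) (snd p)) \<in> borel_measurable M"
    unfolding eta_def using c I by simp
  have "u 0 x = horizon_cost X A q c \<alpha> T ?\<pi> x +
      ennreal \<alpha> ^ T * (\<integral>\<^sup>+\<omega>. u T (fst (\<omega> T)) \<partial>process_law X A q ?\<pi> x)"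
    using Suc by simp
  also have "(\<integral>\<^sup>+\<omega>. u T (fst (\<omega> T)) \<partial>process_law X A q ?\<pi> x) =
      (\<integral>\<^sup>+\<omega>. eta q c \<alpha> (u (Suc T)) (fst (\<omega> T)) (\<phi> T (fst (\<omega> T))) \<partial>process_law X A q ?\<pi> x)"
    using process_component_space[OF x \<pi>, of _ T]
    by (intro nn_integral_cong Suc.prems) (auto simp: mem_Times_iff)
  \<comment> \<open>The policy plays the rule, so the rule may be replaced by the action coordinate,
    the form that \<open>eta_process\<close> needs.\<close>
  also have "\<dots> = (\<integral>\<^sup>+\<omega>. eta q c \<alpha> (u (Suc T)) (fst (\<omega> T)) (snd (\<omega> T)) \<partial>process_law X A q ?\<pi> x)"
    using nn_integral_markov_action[where \<phi>=\<phi>, OF x \<phi> eta_M, of T] by simp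
  also have "horizon_cost X A q c \<alpha> T ?\<pi> x + ennreal \<alpha> ^ T * \<dots> = horizon_cost X A q c \<alpha> (Suc T) ?\<pi> x +
      ennreal \<alpha> ^ Suc T * (\<integral>\<^sup>+\<omega>. u (Suc T) (fst (\<omega> (Suc T))) \<partial>process_law X A q ?\<pi> x)"
    unfolding eta_process[OF x \<pi> u] horizon_cost_Suc[OF x \<pi>]
    by (simp add: distrib_left mult_ac add_ac)
  finally show ?case .
qed

end

end

section \<open>Value iteration and optimal policies\<close>

text \<open>Value functions and iterates are compared on the product only, so membership in
  \<open>LW\<close> must not see values elsewhere.\<close>

lemma LW_cong:
  assumes "\<And>w y. w \<in> XW \<Longrightarrow> y \<in> XY \<Longrightarrow> u (w, y) = u' (w, y)"
  shows "u \<in> LW XW XY \<longleftrightarrow> u' \<in> LW XW XY"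
proof -
  have "u \<in> borel_measurable (borel_on (XW \<times> XY)) \<longleftrightarrow> u' \<in> borel_measurable (borel_on (XW \<times> XY))"
    using assms by (intro measurable_cong) (auto simp: space_restrict_space)
  moreover have "lsc_on XW (\<lambda>w. u (w, y)) \<longleftrightarrow> lsc_on XW (\<lambda>w. u' (w, y))" if y: "y \<in> XY" for y
  proof -
    have "Liminf (at w within XW) (\<lambda>w. u (w, y)) = Liminf (at w within XW) (\<lambda>w. u' (w, y))" for w
      using assms y by (intro Liminf_eq) (auto simp: eventually_at_topological)
    with assms y show ?thesis by (simp add: lsc_on_def)
  qed
  ultimately show ?thesis by (simp add: LW_def)
qed

context semi_uniform_Feller_mdp
begin

sublocale controlled_process X A q
  by unfold_locales (rule q_measurable)

abbreviation "policy_cost T \<pi> \<equiv> horizon_cost X A q c \<alpha> T \<pi>"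

section \<open>Optimality over a finite horizon\<close>

lemma V_le_horizon_cost:
  assumes x: "x \<in> X" and \<pi>: "\<pi> \<in> policies X A"
  shows "V T x \<le> policy_cost T \<pi> x"
proof -
  \<comment> \<open>Time runs against the iteration index: \<open>T - t\<close> steps remain at time
    \<open>t\<close>. The terminal function \<open>V 0\<close> is 0, which removes the
    remainder.\<close>
  have "V (T - 0) x \<le> policy_cost T \<pi> x +
      ennreal \<alpha> ^ T * (\<integral>\<^sup>+\<omega>. V (T - T) (fst (\<omega> T)) \<partial>process_law X A q \<pi> x)"
  proof (rule horizon_cost_lower[OF c_measurable x \<pi>, where u="\<lambda>t. V (T - t)"])
    fix t y a assume "t < T" "a \<in> A"
    then have "V (T - t) = \<nu> (V (T - Suc t))" by (metis Suc_diff_Suc value_iteration.simps(2))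
    with \<open>a \<in> A\<close> show "V (T - t) y \<le> \<eta> (V (T - Suc t)) y a" by (simp add: minval_lower)
  qed (rule V_measurable)
  then show ?thesis by simp
qed

lemma horizon_cost_greedy:
  assumes x: "x \<in> X" and \<phi>: "\<And>t. \<phi> t \<in> borel_on X \<rightarrow>\<^sub>M borel_on A"
    and greedy: "\<And>t y. t < T \<Longrightarrow> y \<in> X \<Longrightarrow> V (Suc t) y = \<eta> (V t) y (\<phi> (T - 1 - t) y)"
  shows "policy_cost T (markov_policy A \<phi>) x = V T x"
proof -
  have "V (T - 0) x = policy_cost T (markov_policy A \<phi>) x +
      ennreal \<alpha> ^ T * (\<integral>\<^sup>+\<omega>. V (T - T) (fst (\<omega> T)) \<partial>process_law X A q (markov_policy A \<phi>) x)"
  proof (rule horizon_cost_markov[where \<phi>=\<phi> and u="\<lambda>t. V (T - t)", OF c_measurable x \<phi>])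
    fix t y assume t: "t < T" and y: "y \<in> X"
    \<comment> \<open>Stage \<open>T - Suc t\<close> of the iteration is the one that uses the rule
      at time \<open>t\<close>.\<close>
    then have "T - t = Suc (T - Suc t)" "T - 1 - (T - Suc t) = t" by auto
    with greedy[of "T - Suc t" y] t y show "V (T - t) y = \<eta> (V (T - Suc t)) y (\<phi> t y)" by simp
  qed (rule V_measurable)
  then show ?thesis by simp
qed

text \<open>The rule at time \<open>k\<close> minimises with \<open>V (T - 1 - k)\<close>, the value
  of what remains after this decision. From time \<open>T\<close> on truncated subtraction gives 0
  and merely pads the sequence.\<close>

lemma greedy_rules_exist:
  "\<exists>\<phi>. (\<forall>t. \<phi> t \<in> borel_on X \<rightarrow>\<^sub>M borel_on A) \<and>
    (\<forall>t<T. \<forall>y\<in>X. V (Suc t) y = \<eta> (V t) y (\<phi> (T - 1 - t) y))"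
proof -
  have "\<forall>t. \<exists>f\<in>borel_on X \<rightarrow>\<^sub>M borel_on A. \<forall>y\<in>X. \<eta> (V t) y (f y) = V (Suc t) y"
    using argmin_selector[OF V_LW] by simp
  then obtain f where f: "\<And>t. f t \<in> borel_on X \<rightarrow>\<^sub>M borel_on A"
    "\<And>t y. y \<in> X \<Longrightarrow> \<eta> (V t) y (f t y) = V (Suc t) y" by metis
  show ?thesis
  proof (intro exI[of _ "\<lambda>k. f (T - 1 - k)"] conjI allI impI ballI)
    fix t y assume "t < T" "y \<in> X"
    moreover from this have "T - 1 - (T - 1 - t) = t" by simp
    ultimately show "V (Suc t) y = \<eta> (V t) y (f (T - 1 - (T - 1 - t)) y)" using f(2) by simp
  qed (rule f)
qed

lemma horizon_value_eq: "x \<in> X \<Longrightarrow> horizon_value X A q c \<alpha> T x = V T x"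
proof -
  assume x: "x \<in> X"
  obtain \<phi> where \<phi>: "\<And>t. \<phi> t \<in> borel_on X \<rightarrow>\<^sub>M borel_on A"
    "\<And>t y. t < T \<Longrightarrow> y \<in> X \<Longrightarrow> V (Suc t) y = \<eta> (V t) y (\<phi> (T - 1 - t) y)"
    using greedy_rules_exist[of T] by blast
  show ?thesis
    unfolding horizon_value_def
  proof (rule antisym)
    show "(INF \<pi>\<in>policies X A. policy_cost T \<pi> x) \<le> V T x"
      using horizon_cost_greedy[OF x \<phi>] markov_policy_in_policies[of \<phi>, OF \<phi>(1)]
      by (intro INF_lower2) auto
    show "V T x \<le> (INF \<pi>\<in>policies X A. policy_cost T \<pi> x)"
      by (intro INF_greatest V_le_horizon_cost x)
  qed
qed

section \<open>Discounted costs over an infinite horizon\<close>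

lemma Vinf_le_discounted_cost:
  assumes x: "x \<in> X" and \<pi>: "\<pi> \<in> policies X A"
  shows "Vinf x \<le> discounted_cost X A q c \<alpha> \<pi> x"
  unfolding Vinf_def discounted_cost_SUP[OF c_measurable x \<pi>]
  by (intro SUP_mono) (use V_le_horizon_cost[OF x \<pi>] in blast)

lemma stationary_policy_in_policies:
  "\<phi> \<in> borel_on X \<rightarrow>\<^sub>M borel_on A \<Longrightarrow> stationary_policy A \<phi> \<in> policies X A"
  unfolding stationary_policy_def by (rule markov_policy_in_policies)

text \<open>The same function \<open>Vinf\<close> is used at all times. The remainder is nonnegative
  and is dropped instead of being shown to vanish, so infinite values cause no trouble; the opposite
  bound holds for every policy.\<close>

lemma discounted_cost_greedy:
  assumes x: "x \<in> X" and \<phi>: "\<phi> \<in> borel_on X \<rightarrow>\<^sub>M borel_on A"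
    and greedy: "\<And>y. y \<in> X \<Longrightarrow> Vinf y = \<eta> Vinf y (\<phi> y)"
  shows "discounted_cost X A q c \<alpha> (stationary_policy A \<phi>) x = Vinf x"
proof (rule antisym)
  have Vinf: "Vinf \<in> borel_measurable (borel_on X)" using Vinf_LW by (simp add: LW_def)
  have "policy_cost T (stationary_policy A \<phi>) x \<le> Vinf x" for T
  proof -
    have "Vinf x = policy_cost T (markov_policy A (\<lambda>_. \<phi>)) x + ennreal \<alpha> ^ T *
        (\<integral>\<^sup>+\<omega>. Vinf (fst (\<omega> T)) \<partial>process_law X A q (markov_policy A (\<lambda>_. \<phi>)) x)"
      using greedy by (intro horizon_cost_markov[where u="\<lambda>_. Vinf"] c_measurable x \<phi> Vinf)
    then show ?thesis by (simp add: stationary_policy_def)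
  qed
  then show "discounted_cost X A q c \<alpha> (stationary_policy A \<phi>) x \<le> Vinf x"
    unfolding discounted_cost_SUP[OF c_measurable x stationary_policy_in_policies[OF \<phi>]]
    by (rule SUP_least)
  show "Vinf x \<le> discounted_cost X A q c \<alpha> (stationary_policy A \<phi>) x"
    by (rule Vinf_le_discounted_cost[OF x stationary_policy_in_policies[OF \<phi>]])
qed

lemma discounted_value_eq: "x \<in> X \<Longrightarrow> discounted_value X A q c \<alpha> x = Vinf x"
proof -
  assume x: "x \<in> X"
  obtain \<phi> where \<phi>: "\<phi> \<in> borel_on X \<rightarrow>\<^sub>M borel_on A" "\<And>y. y \<in> X \<Longrightarrow> Vinf y = \<eta> Vinf y (\<phi> y)"
    using argmin_selector[OF Vinf_LW] Vinf_fixed_point by metis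
  show ?thesis
    unfolding discounted_value_def
  proof (rule antisym)
    show "(INF \<pi>\<in>policies X A. discounted_cost X A q c \<alpha> \<pi> x) \<le> Vinf x"
      using discounted_cost_greedy[OF x \<phi>] stationary_policy_in_policies[OF \<phi>(1)]
      by (intro INF_lower2) auto
    show "Vinf x \<le> (INF \<pi>\<in>policies X A. discounted_cost X A q c \<alpha> \<pi> x)"
      by (intro INF_greatest Vinf_le_discounted_cost x)
  qed
qed

text \<open>The horizon costs of a stationary policy are the iterates \<open>R\<close> of its own
  evaluation operator, started at 0. They increase, so monotone convergence carries the recursion to
  the limit. This serves the necessity half of the optimality criterion.\<close>

lemma stationary_policy_evaluation:
  assumes x: "x \<in> X" and \<phi>: "\<phi> \<in> borel_on X \<rightarrow>\<^sub>M borel_on A"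
  shows "discounted_cost X A q c \<alpha> (stationary_policy A \<phi>) x =
    \<eta> (discounted_cost X A q c \<alpha> (stationary_policy A \<phi>)) x (\<phi> x)"
proof -
  define R where "R = rec_nat (\<lambda>_. 0) (\<lambda>_ u y. \<eta> u y (\<phi> y))"
  have R: "R 0 = (\<lambda>_. 0)" "R (Suc t) = (\<lambda>y. \<eta> (R t) y (\<phi> y))" for t by (simp_all add: R_def)
  have \<phi>A: "\<phi> y \<in> A" if "y \<in> X" for y
    using measurable_space[OF \<phi>, of y] that by (simp add: space_restrict_space)
  have R_meas: "R t \<in> borel_measurable (borel_on X)" for t
  proof (induction t)
    case (Suc t)
    have "(\<lambda>y. (y, \<phi> y)) \<in> borel_on X \<rightarrow>\<^sub>M borel_on (X \<times> A)"
      using \<phi> by (intro Pair_measurable) auto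
    from measurable_compose[OF this eta_measurable[OF Suc]] show ?case by (simp add: R)
  qed (simp add: R)
  have R_inc: "R t y \<le> R (Suc t) y" if "y \<in> X" for t y
    using that
  proof (induction t arbitrary: y)
    case (Suc t)
    then show ?case unfolding R(2) using \<phi>A by (intro eta_mono) (auto simp flip: R(2))
  qed (simp add: R)
  have cost: "policy_cost T (stationary_policy A \<phi>) y = R T y" if y: "y \<in> X" for T y
  proof -
    have "R (T - 0) y = policy_cost T (markov_policy A (\<lambda>_. \<phi>)) y + ennreal \<alpha> ^ T *
        (\<integral>\<^sup>+\<omega>. R (T - T) (fst (\<omega> T)) \<partial>process_law X A q (markov_policy A (\<lambda>_. \<phi>)) y)"
    proof (rule horizon_cost_markov[where u="\<lambda>t. R (T - t)", OF c_measurable y \<phi> R_meas])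
      fix t z assume "t < T"
      then have "T - t = Suc (T - Suc t)" by auto
      then show "R (T - t) z = \<eta> (R (T - Suc t)) z (\<phi> z)" by (simp add: R)
    qed
    then show ?thesis by (simp add: R stationary_policy_def)
  qed
  have disc: "discounted_cost X A q c \<alpha> (stationary_policy A \<phi>) y = (SUP t. R t y)" if y: "y \<in> X" for y
    unfolding discounted_cost_SUP[OF c_measurable y stationary_policy_in_policies[OF \<phi>]] cost[OF y] ..
  \<comment> \<open>The iterates increase, so dropping the first one does not change the
    supremum.\<close>
  have "(SUP t. R t x) = (SUP t. R (Suc t) x)"
  proof (rule antisym)
    show "(SUP t. R t x) \<le> (SUP t. R (Suc t) x)" using R_inc[OF x] by (intro SUP_mono) blast
    show "(SUP t. R (Suc t) x) \<le> (SUP t. R t x)" by (intro SUP_mono) blast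
  qed
  also have "\<dots> = (SUP t. \<eta> (R t) x (\<phi> x))" by (simp add: R)
  also have "\<dots> = \<eta> (\<lambda>z. SUP t. R t z) x (\<phi> x)"
    by (rule eta_SUP[where u=R, OF x \<phi>A[OF x] R_meas R_inc, symmetric])
  also have "\<dots> = \<eta> (discounted_cost X A q c \<alpha> (stationary_policy A \<phi>)) x (\<phi> x)"
    using x \<phi>A[OF x] disc by (intro antisym eta_mono) auto
  finally show ?thesis unfolding disc[OF x] .
qed

section \<open>Sets of minimisers and the optimality criterion\<close>

lemma eta_cong:
  assumes "x \<in> X" "a \<in> A" "\<And>z. z \<in> X \<Longrightarrow> u z = u' z"
  shows "\<eta> u x a = \<eta> u' x a"
  using assms by (intro antisym eta_mono) auto

text \<open>Functions that agree only on \<open>X\<close> are allowed, since \<open>q\<close>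
  charges only \<open>X\<close> and nothing is known about the value functions elsewhere. It is
  applied to each stage of the iteration and to the limit.\<close>

lemma argmin_properties:
  assumes u: "u \<in> LW XW XY" and u': "\<And>z. z \<in> X \<Longrightarrow> u' z = u z"
    and v: "\<And>z. z \<in> X \<Longrightarrow> v z = \<nu> u z"
  shows "(\<forall>x\<in>X. is_minimum (v x) (\<eta> u' x) A) \<and>
    (\<forall>x\<in>X. {a \<in> A. v x = \<eta> u' x a} \<noteq> {}) \<and>
    graph_on X (\<lambda>x. {a \<in> A. v x = \<eta> u' x a}) \<in> sets (borel_on (X \<times> A)) \<and>
    (\<forall>x\<in>X. (v x = \<infinity> \<longrightarrow> {a \<in> A. v x = \<eta> u' x a} = A) \<and>
      (v x < \<infinity> \<longrightarrow> compact {a \<in> A. v x = \<eta> u' x a}))"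
proof (intro conjI ballI impI)
  have eq: "{a \<in> A. v x = \<eta> u' x a} = {a \<in> A. \<nu> u x = \<eta> u x a}" if "x \<in> X" for x
    using v[OF that] eta_cong[OF that _ u'] by auto
  have "graph_on X (\<lambda>x. {a \<in> A. v x = \<eta> u' x a}) = graph_on X (\<lambda>x. {a \<in> A. \<nu> u x = \<eta> u x a})"
    using eq by (auto simp: graph_on_def)
  then show "graph_on X (\<lambda>x. {a \<in> A. v x = \<eta> u' x a}) \<in> sets (borel_on (X \<times> A))"
    using graph_argmin_sets[OF u minval_measurable[OF u]] by simp
  fix x assume x: "x \<in> X"
  obtain a where a: "a \<in> A" "\<eta> u x a = \<nu> u x" using minval_attained[OF u x] by blast
  show "{a \<in> A. v x = \<eta> u' x a} \<noteq> {}" unfolding eq[OF x] using a by auto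
  show "is_minimum (v x) (\<eta> u' x) A"
    unfolding is_minimum_def is_arg_min_linorder
    using a minval_lower[of _ u x] eta_cong[OF x _ u'] v[OF x] by (intro exI[of _ a]) auto
  show "{a \<in> A. v x = \<eta> u' x a} = A" if "v x = \<infinity>"
    unfolding eq[OF x] using that minval_lower[of _ u x] v[OF x] by (auto simp: top_unique)
  show "compact {a \<in> A. v x = \<eta> u' x a}" if "v x < \<infinity>"
    unfolding eq[OF x] using that v[OF x] by (intro compact_argmin u x) simp
qed

lemma horizon_optimal_greedy:
  assumes \<phi>: "\<And>t. \<phi> t \<in> borel_on X \<rightarrow>\<^sub>M borel_on A"
    and "\<And>t y. t < T \<Longrightarrow> y \<in> X \<Longrightarrow> V (Suc t) y = \<eta> (V t) y (\<phi> (T - 1 - t) y)"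
  shows "horizon_optimal X A q c \<alpha> T (markov_policy A \<phi>)"
  unfolding horizon_optimal_def
  using horizon_cost_greedy[where \<phi>=\<phi>, OF _ assms] markov_policy_in_policies[of \<phi>, OF \<phi>] horizon_value_eq by auto

text \<open>If the policy is optimal, its cost is \<open>Vinf\<close>, and its evaluation equation
  turns into the greedy equation. Conversely a greedy rule has cost \<open>Vinf\<close>.\<close>

lemma discount_optimal_iff_greedy:
  assumes \<phi>: "\<phi> \<in> borel_on X \<rightarrow>\<^sub>M borel_on A"
  shows "discount_optimal X A q c \<alpha> (stationary_policy A \<phi>) \<longleftrightarrow> (\<forall>x\<in>X. Vinf x = \<eta> Vinf x (\<phi> x))"
proof
  have \<phi>A: "\<phi> y \<in> A" if "y \<in> X" for y
    using measurable_space[OF \<phi>, of y] that by (simp add: space_restrict_space)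
  assume "discount_optimal X A q c \<alpha> (stationary_policy A \<phi>)"
  then have "discounted_cost X A q c \<alpha> (stationary_policy A \<phi>) x = Vinf x" if "x \<in> X" for x
    using that discounted_value_eq[OF that] unfolding discount_optimal_def by metis
  with stationary_policy_evaluation[OF _ \<phi>] eta_cong \<phi>A
  show "\<forall>x\<in>X. Vinf x = \<eta> Vinf x (\<phi> x)" by (metis (no_types, lifting))
next
  assume "\<forall>x\<in>X. Vinf x = \<eta> Vinf x (\<phi> x)"
  then show "discount_optimal X A q c \<alpha> (stationary_policy A \<phi>)"
    unfolding discount_optimal_def
    using discounted_cost_greedy[OF _ \<phi>] discounted_value_eq stationary_policy_in_policies[OF \<phi>] by auto
qed

end

theorem theorem6p3:
  fixes XW :: "'w::polish_space set" and XY :: "'y::polish_space set" and X :: "('w \<times> 'y) set"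
    and A :: "'a::polish_space set"
    and q :: "('w \<times> 'y) \<times> 'a \<Rightarrow> ('w \<times> 'y) measure"
    and c :: "('w \<times> 'y) \<times> 'a \<Rightarrow> ennreal"
    and \<alpha> :: real
    and v :: "nat \<Rightarrow> 'w \<times> 'y \<Rightarrow> ennreal" and vinf :: "'w \<times> 'y \<Rightarrow> ennreal"
    and Aopt :: "nat \<Rightarrow> 'w \<times> 'y \<Rightarrow> 'a set" and Ainf :: "'w \<times> 'y \<Rightarrow> 'a set"
  assumes XW: "XW \<in> sets borel" "XW \<noteq> {}"
    and XY: "XY \<in> sets borel" "XY \<noteq> {}"
    and A: "A \<in> sets borel" "A \<noteq> {}"
    and X: "X = XW \<times> XY"
    and q: "semi_uniform_Feller XW XY (X \<times> A) q"
    and c: "MK_inf_compact XW XY A (\<lambda>(w, y, a). enn2ereal (c ((w, y), a)))"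
    and \<alpha>: "\<alpha> \<ge> 0"
    and v: "v = horizon_value X A q c \<alpha>"
    and vinf: "vinf = discounted_value X A q c \<alpha>"
    and Aopt: "Aopt = (\<lambda>t x. {a \<in> A. v (Suc t) x = eta q c \<alpha> (v t) x a})"
    and Ainf: "Ainf = (\<lambda>x. {a \<in> A. vinf x = eta q c \<alpha> vinf x a})"
  shows "((\<forall>t. v t \<in> LW XW XY) \<and> vinf \<in> LW XW XY \<and>
      (\<forall>x\<in>X. incseq (\<lambda>t. v t x) \<and> (\<lambda>t. v t x) \<longlonglongrightarrow> vinf x))
    \<and>
    ((\<forall>x\<in>X. v 0 x = 0) \<and>
      (\<forall>t. (\<forall>x\<in>X. is_minimum (v (Suc t) x) (eta q c \<alpha> (v t) x) A) \<and>
           (\<forall>x\<in>X. Aopt t x \<noteq> {}) \<and>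
           graph_on X (Aopt t) \<in> sets (borel_on (X \<times> A)) \<and>
           (\<forall>x\<in>X. (v (Suc t) x = \<infinity> \<longrightarrow> Aopt t x = A) \<and>
                  (v (Suc t) x < \<infinity> \<longrightarrow> compact (Aopt t x)))))
    \<and>
    (\<forall>T\<ge>1.
      (\<exists>\<phi>. (\<forall>t. \<phi> t \<in> borel_on X \<rightarrow>\<^sub>M borel_on A) \<and>
           horizon_optimal X A q c \<alpha> T (markov_policy A \<phi>)) \<and>
      (\<forall>\<phi>. (\<forall>t. \<phi> t \<in> borel_on X \<rightarrow>\<^sub>M borel_on A) \<longrightarrow>
           (\<forall>t<T. \<forall>x\<in>X. \<phi> (T - 1 - t) x \<in> Aopt t x) \<longrightarrow>
           horizon_optimal X A q c \<alpha> T (markov_policy A \<phi>)))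
    \<and>
    (\<alpha> < 1 \<longrightarrow>
      (\<forall>x\<in>X. is_minimum (vinf x) (eta q c \<alpha> vinf x) A) \<and>
      (\<forall>x\<in>X. Ainf x \<noteq> {}) \<and>
      graph_on X Ainf \<in> sets (borel_on (X \<times> A)) \<and>
      (\<forall>x\<in>X. (vinf x = \<infinity> \<longrightarrow> Ainf x = A) \<and>
             (vinf x < \<infinity> \<longrightarrow> compact (Ainf x))))
    \<and>
    (\<alpha> < 1 \<longrightarrow>
      (\<exists>\<phi>. \<phi> \<in> borel_on X \<rightarrow>\<^sub>M borel_on A \<and>
           discount_optimal X A q c \<alpha> (stationary_policy A \<phi>)) \<and>
      (\<forall>\<phi>. \<phi> \<in> borel_on X \<rightarrow>\<^sub>M borel_on A \<longrightarrow>
           (discount_optimal X A q c \<alpha> (stationary_policy A \<phi>) \<longleftrightarrow> (\<forall>x\<in>X. \<phi> x \<in> Ainf x))))"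
proof -
  interpret semi_uniform_Feller_mdp XW XY A q c \<alpha>
    using XW(1) XY(1) A q c unfolding X by unfold_locales
  \<comment> \<open>Value functions and iterates are identified on \<open>X\<close> only, which is
    why the congruence lemmas are invoked below.\<close>
  have vV: "v t x = V t x" if "x \<in> X" for t x
    using that horizon_value_eq unfolding v X by simp
  have vinfV: "vinf x = Vinf x" if "x \<in> X" for x
    using that discounted_value_eq unfolding vinf X by simp
  have \<phi>A: "\<phi> x \<in> A" if "\<phi> \<in> borel_on X \<rightarrow>\<^sub>M borel_on A" "x \<in> X" for \<phi> x
    using measurable_space[OF that(1), of x] that(2) by (simp add: space_restrict_space)
  have part1: "(\<forall>t. v t \<in> LW XW XY) \<and> vinf \<in> LW XW XY \<and>
      (\<forall>x\<in>X. incseq (\<lambda>t. v t x) \<and> (\<lambda>t. v t x) \<longlonglongrightarrow> vinf x)"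
  proof (intro conjI allI ballI)
    show "v t \<in> LW XW XY" for t
      using V_LW[of t] LW_cong[of XW XY "v t" "V t"] vV by (auto simp: X)
    show "vinf \<in> LW XW XY"
      using Vinf_LW LW_cong[of XW XY vinf Vinf] vinfV by (auto simp: X)
    fix x assume x: "x \<in> X"
    show "incseq (\<lambda>t. v t x)" using V_mono[of x] x vV[OF x] by (simp add: X)
    show "(\<lambda>t. v t x) \<longlonglongrightarrow> vinf x"
      using LIMSEQ_SUP[OF V_mono[of x]] x vV[OF x] vinfV[OF x] by (simp add: X Vinf_def)
  qed
  have part2: "(\<forall>x\<in>X. is_minimum (v (Suc t) x) (eta q c \<alpha> (v t) x) A) \<and>
           (\<forall>x\<in>X. Aopt t x \<noteq> {}) \<and>
           graph_on X (Aopt t) \<in> sets (borel_on (X \<times> A)) \<and>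
           (\<forall>x\<in>X. (v (Suc t) x = \<infinity> \<longrightarrow> Aopt t x = A) \<and>
                  (v (Suc t) x < \<infinity> \<longrightarrow> compact (Aopt t x)))" for t
    using argmin_properties[of "V t" "v t" "v (Suc t)"] V_LW[of t] vV unfolding Aopt X by simp
  have greedy_iff: "\<phi> x \<in> Aopt t x \<longleftrightarrow> V (Suc t) x = \<eta> (V t) x (\<phi> x)"
    if "\<phi> \<in> borel_on X \<rightarrow>\<^sub>M borel_on A" "x \<in> X" for \<phi> t x
    using \<phi>A[OF that] vV[OF that(2)] eta_cong[of x "\<phi> x" "v t" "V t"] vV that(2)
    by (simp add: Aopt X)
  have part3: "(\<exists>\<phi>. (\<forall>t. \<phi> t \<in> borel_on X \<rightarrow>\<^sub>M borel_on A) \<and>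
           horizon_optimal X A q c \<alpha> T (markov_policy A \<phi>)) \<and>
      (\<forall>\<phi>. (\<forall>t. \<phi> t \<in> borel_on X \<rightarrow>\<^sub>M borel_on A) \<longrightarrow>
           (\<forall>t<T. \<forall>x\<in>X. \<phi> (T - 1 - t) x \<in> Aopt t x) \<longrightarrow>
           horizon_optimal X A q c \<alpha> T (markov_policy A \<phi>))" for T
  proof (intro conjI allI impI)
    show "\<exists>\<phi>. (\<forall>t. \<phi> t \<in> borel_on X \<rightarrow>\<^sub>M borel_on A) \<and>
           horizon_optimal X A q c \<alpha> T (markov_policy A \<phi>)"
      using greedy_rules_exist[of T] horizon_optimal_greedy[of _ T] unfolding X by blast
    fix \<phi> assume \<phi>: "\<forall>t. \<phi> t \<in> borel_on X \<rightarrow>\<^sub>M borel_on A"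
      "\<forall>t<T. \<forall>x\<in>X. \<phi> (T - 1 - t) x \<in> Aopt t x"
    then have "V (Suc t) y = \<eta> (V t) y (\<phi> (T - 1 - t) y)" if "t < T" "y \<in> X" for t y
      using greedy_iff that by blast
    with \<phi>(1) horizon_optimal_greedy[of \<phi> T]
    show "horizon_optimal X A q c \<alpha> T (markov_policy A \<phi>)" unfolding X by blast
  qed
  have part4: "(\<forall>x\<in>X. is_minimum (vinf x) (eta q c \<alpha> vinf x) A) \<and>
      (\<forall>x\<in>X. Ainf x \<noteq> {}) \<and>
      graph_on X Ainf \<in> sets (borel_on (X \<times> A)) \<and>
      (\<forall>x\<in>X. (vinf x = \<infinity> \<longrightarrow> Ainf x = A) \<and>
             (vinf x < \<infinity> \<longrightarrow> compact (Ainf x)))"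
    using argmin_properties[of Vinf vinf vinf] Vinf_LW vinfV Vinf_fixed_point unfolding Ainf X by simp
  have opt_iff: "discount_optimal X A q c \<alpha> (stationary_policy A \<phi>) \<longleftrightarrow> (\<forall>x\<in>X. \<phi> x \<in> Ainf x)"
    if \<phi>: "\<phi> \<in> borel_on X \<rightarrow>\<^sub>M borel_on A" for \<phi>
  proof -
    have "\<phi> x \<in> Ainf x \<longleftrightarrow> Vinf x = \<eta> Vinf x (\<phi> x)" if "x \<in> X" for x
      using \<phi>A[OF \<phi> that] vinfV eta_cong[of x "\<phi> x" vinf Vinf] that by (simp add: Ainf X)
    then show ?thesis using discount_optimal_iff_greedy[of \<phi>] \<phi> unfolding X by simp
  qed
  have optimal: "\<exists>\<phi>. \<phi> \<in> borel_on X \<rightarrow>\<^sub>M borel_on A \<and>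
      discount_optimal X A q c \<alpha> (stationary_policy A \<phi>)"
  proof -
    obtain \<phi> where \<phi>: "\<phi> \<in> borel_on X \<rightarrow>\<^sub>M borel_on A" "\<forall>x\<in>X. \<eta> Vinf x (\<phi> x) = \<nu> Vinf x"
      using argmin_selector[OF Vinf_LW] unfolding X by blast
    then have "\<forall>x\<in>X. Vinf x = \<eta> Vinf x (\<phi> x)" using Vinf_fixed_point unfolding X by simp
    with \<phi>(1) discount_optimal_iff_greedy[of \<phi>] show ?thesis unfolding X by blast
  qed
  have part5: "(\<exists>\<phi>. \<phi> \<in> borel_on X \<rightarrow>\<^sub>M borel_on A \<and>
           discount_optimal X A q c \<alpha> (stationary_policy A \<phi>)) \<and>
      (\<forall>\<phi>. \<phi> \<in> borel_on X \<rightarrow>\<^sub>M borel_on A \<longrightarrow>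
           (discount_optimal X A q c \<alpha> (stationary_policy A \<phi>) \<longleftrightarrow> (\<forall>x\<in>X. \<phi> x \<in> Ainf x)))"
    by (rule conjI[OF optimal]) (intro allI impI opt_iff)
  have part0: "\<forall>x\<in>X. v 0 x = 0" using vV by simp
  show ?thesis
    by (rule conjI[OF part1], rule conjI, rule conjI[OF part0], rule allI, rule part2,
        rule conjI, rule allI, rule impI, rule part3,
        rule conjI, rule impI, rule part4, rule impI, rule part5)
qed

end
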